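(* Let $V_1,V_2\in\mathcal{UM}$ and let $m_1=\deg(V_1,0)$, $m_2=\deg(V_2,0)$. Suppose that (a) $m_1>2$ or $m_2>2$; or (b) $m_1=m_2=2$ and $V_1(x)=\omega V_2(\tau x)$ for all $x\in\mathbb R$, for some $\omega>0$ and $\tau\neq0$ such that $\sqrt{V_1''(0)/V_2''(0)}=|\tau|\sqrt{\omega}$ is irrational. Then $\mathcal E(P,V_1,V_2)=\emptyset$ for every $P\in\mathcal{RP}$.
   Context: $\mathcal{UM}$ is the family of real-analytic $V:\mathbb R\to\mathbb R_{\ge0}$ with $V(0)=0$, $yV'(y)>0$ for $y\ne0$, and $V(y)\to+\infty$ as $y\to\pm\infty$. For $V\in\mathcal{UM}$, $\deg(V,0)$ is the least $m$ with $V^{(m)}(0)\neq0$ (it is even and $\ge2$). For $V\in\mathcal{UM}$ write $\bar V(y)=V(-y)$ and $V^{-1}:[0,\infty)\to[0,\infty)$ for the inverse of $V|_{[0,\infty)}$. $\mathcal{RP}$ is the family of bounded planar polygons (not necessarily connected or simply connected) whose boundary is a finite union of vertical and horizontal segments; a corner is convex if its interior angle is $90^\circ$ and concave if it is $270^\circ$. Dynamics: for $V_1,V_2\in\mathcal{UM}$ and $P\in\mathcal{RP}$, a particle at $(q_1,q_2)\in P$ with momenta $(p_1,p_2)$ moves by $\dot p_j=-V_j'(q_j)$, $\dot q_j=p_j$ ($j=1,2$) (Hamiltonian $H=p_1^2/2+p_2^2/2+V_1(q_1)+V_2(q_2)$), and reflects elastically: at a vertical side $(p_1,p_2)\mapsto(-p_1,p_2)$,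 at a horizontal side $(p_1,p_2)\mapsto(p_1,-p_2)$, at a convex corner $(p_1,p_2)\mapsto(-p_1,-p_2)$. For $E\ge0$, $0\le\theta\le E$, the invariant set is $S_{E,\theta}=\{(p_1,p_2,q_1,q_2): p_1^2/2+V_1(q_1)=\theta,\ p_2^2/2+V_2(q_2)=E-\theta,\ (q_1,q_2)\in P\}$. The pair $(E,\theta)$ is resonant if the motion on $S_{E,\theta}$ has a resonant orbit, i.e. a periodic orbit, where orbits running between corners count as (singular) resonant orbits; precisely, $(E,\theta)$ is resonant iff some trajectory in $S_{E,\theta}$ joins two (not necessarily distinct) corners of the rectilinear polygon $P\cap\big([-\bar V_1^{-1}(\theta),V_1^{-1}(\theta)]\times[-\bar V_2^{-1}(E-\theta),V_2^{-1}(E-\theta)]\big)$. A number $E>0$ is a resonant energy level if $(E,\theta)$ is resonant for uncountably many $\theta\in(0,E)$; $\mathcal E(P,V_1,V_2)\subset(0,\infty)$ is the set of resonant energy levels. *)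

theory Defs
  imports "HOL-Analysis.Analysis"
begin

definition real_analytic :: "(real \<Rightarrow> real) \<Rightarrow> bool" where
  "real_analytic V \<longleftrightarrow>
     (\<forall>x0. \<exists>r>0. \<exists>c::nat \<Rightarrow> real.
        \<forall>x. \<bar>x - x0\<bar> < r \<longrightarrow> (\<lambda>n. c n * (x - x0) ^ n) sums V x)"

definition UM :: "(real \<Rightarrow> real) \<Rightarrow> bool" where
  "UM V \<longleftrightarrow> real_analytic V \<and> (\<forall>y. V y \<ge> 0) \<and> V 0 = 0 \<and>
     (\<forall>y. y \<noteq> 0 \<longrightarrow> y * deriv V y > 0) \<and>
     filterlim V at_top at_top \<and> filterlim V at_top at_bot"

definition deg0 :: "(real \<Rightarrow> real) \<Rightarrow> nat" where
  "deg0 V = (LEAST m. (deriv ^^ m) V 0 \<noteq> 0)"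

definition inv_pos :: "(real \<Rightarrow> real) \<Rightarrow> real \<Rightarrow> real" where
  "inv_pos V s = (THE y. y \<ge> 0 \<and> V y = s)"

definition refl_pot :: "(real \<Rightarrow> real) \<Rightarrow> real \<Rightarrow> real" where
  "refl_pot V y = V (- y)"

definition RP :: "(real \<times> real) set \<Rightarrow> bool" where
  "RP P \<longleftrightarrow> bounded P \<and> closed P \<and> closure (interior P) = P \<and>
     (\<exists>S. finite S \<and> (\<forall>(a,b)\<in>S. fst a = fst b \<or> snd a = snd b) \<and>
          frontier P = (\<Union>(a,b)\<in>S. closed_segment a b))"

definition corner :: "(real \<times> real) set \<Rightarrow> real \<times> real \<Rightarrow> bool" where
  "corner Q c \<longleftrightarrow> c \<in> frontier Q \<and>
     (\<forall>e>0. (\<exists>a\<in>frontier Q \<inter> ball c e. fst a \<noteq> fst c) \<and>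
            (\<exists>a\<in>frontier Q \<inter> ball c e. snd a \<noteq> snd c))"

definition convex_corner :: "(real \<times> real) set \<Rightarrow> real \<times> real \<Rightarrow> bool" where
  "convex_corner P c \<longleftrightarrow> (\<exists>e>0. \<exists>s1 s2::real. s1 \<in> {-1,1} \<and> s2 \<in> {-1,1} \<and>
     P \<inter> ball c e = {x \<in> ball c e. s1 * (fst x - fst c) \<ge> 0 \<and> s2 * (snd x - snd c) \<ge> 0})"

definition vertical_side :: "(real \<times> real) set \<Rightarrow> real \<times> real \<Rightarrow> bool" where
  "vertical_side P c \<longleftrightarrow> c \<in> frontier P \<and>
     (\<exists>e>0. frontier P \<inter> ball c e \<subseteq> {x. fst x = fst c})"

definition horizontal_side :: "(real \<times> real) set \<Rightarrow> real \<times> real \<Rightarrow> bool" where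
  "horizontal_side P c \<longleftrightarrow> c \<in> frontier P \<and>
     (\<exists>e>0. frontier P \<inter> ball c e \<subseteq> {x. snd x = snd c})"

definition reflect_ok :: "(real \<times> real) set \<Rightarrow> real \<times> real \<Rightarrow> real \<times> real \<Rightarrow> real \<times> real \<Rightarrow> bool" where
  "reflect_ok P c p p' \<longleftrightarrow>
     (vertical_side P c \<and> p' = (- fst p, snd p)) \<or>
     (horizontal_side P c \<and> p' = (fst p, - snd p)) \<or>
     (convex_corner P c \<and> p' = - p)"

definition hamilton_arc :: "(real \<Rightarrow> real) \<Rightarrow> (real \<Rightarrow> real) \<Rightarrow> real \<Rightarrow> real \<Rightarrow>
     (real \<Rightarrow> real \<times> real) \<Rightarrow> (real \<Rightarrow> real \<times> real) \<Rightarrow> bool" where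
  "hamilton_arc V1 V2 a b x p \<longleftrightarrow>
     (\<forall>t\<in>{a..b}. (x has_vector_derivative p t) (at t within {a..b}) \<and>
        ((\<lambda>s. fst (p s)) has_real_derivative - deriv V1 (fst (x t))) (at t within {a..b}) \<and>
        ((\<lambda>s. snd (p s)) has_real_derivative - deriv V2 (snd (x t))) (at t within {a..b}))"

definition trajectory :: "(real \<times> real) set \<Rightarrow> (real \<Rightarrow> real) \<Rightarrow> (real \<Rightarrow> real) \<Rightarrow>
     real \<Rightarrow> real \<Rightarrow> real \<Rightarrow> (real \<Rightarrow> real \<times> real) \<Rightarrow> bool" where
  "trajectory P V1 V2 E \<theta> T q \<longleftrightarrow> T > 0 \<and>
     (\<exists>(k::nat) (t::nat \<Rightarrow> real) (xs::nat \<Rightarrow> real \<Rightarrow> real \<times> real) (ps::nat \<Rightarrow> real \<Rightarrow> real \<times> real).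
        t 0 = 0 \<and> t k = T \<and> (\<forall>i<k. t i < t (Suc i)) \<and>
        (\<forall>i<k. hamilton_arc V1 V2 (t i) (t (Suc i)) (xs i) (ps i) \<and>
           (\<forall>s\<in>{t i..t (Suc i)}. xs i s = q s \<and> q s \<in> P \<and>
              (fst (ps i s))\<^sup>2 / 2 + V1 (fst (q s)) = \<theta> \<and>
              (snd (ps i s))\<^sup>2 / 2 + V2 (snd (q s)) = E - \<theta>)) \<and>
        (\<forall>i. 0 < i \<and> i < k \<longrightarrow>
           reflect_ok P (q (t i)) (ps (i - 1) (t i)) (ps i (t i))))"

definition hill_polygon :: "(real \<times> real) set \<Rightarrow> (real \<Rightarrow> real) \<Rightarrow> (real \<Rightarrow> real) \<Rightarrow>
     real \<Rightarrow> real \<Rightarrow> (real \<times> real) set" where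
  "hill_polygon P V1 V2 E \<theta> = P \<inter>
     ({- inv_pos (refl_pot V1) \<theta> .. inv_pos V1 \<theta>} \<times>
      {- inv_pos (refl_pot V2) (E - \<theta>) .. inv_pos V2 (E - \<theta>)})"

definition resonant :: "(real \<times> real) set \<Rightarrow> (real \<Rightarrow> real) \<Rightarrow> (real \<Rightarrow> real) \<Rightarrow>
     real \<Rightarrow> real \<Rightarrow> bool" where
  "resonant P V1 V2 E \<theta> \<longleftrightarrow>
     (\<exists>T q. trajectory P V1 V2 E \<theta> T q \<and>
        corner (hill_polygon P V1 V2 E \<theta>) (q 0) \<and>
        corner (hill_polygon P V1 V2 E \<theta>) (q T))"

definition resonant_energies :: "(real \<times> real) set \<Rightarrow> (real \<Rightarrow> real) \<Rightarrow> (real \<Rightarrow> real) \<Rightarrow> real set" where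
  "resonant_energies P V1 V2 =
     {E. E > 0 \<and> uncountable {\<theta>. 0 < \<theta> \<and> \<theta> < E \<and> resonant P V1 V2 E \<theta>}}"

end

theory Submission
  imports Defs "HOL-Complex_Analysis.Complex_Analysis"
begin

text \<open>
  In each coordinate the motion is that of a one-dimensional oscillator whose momentum flips only at
  walls, so the duration of a trajectory between corners is
  \<open>N T\<^sup>+ + M T\<^sup>- + \<Sum>\<^sub>a n\<^sub>a t\<^sub>a\<close>, with natural numbers \<open>N, M\<close> and integers \<open>n\<^sub>a\<close>, where \<open>T\<^sup>+\<close> and
  \<open>T\<^sup>-\<close> are the travel times from \<open>0\<close> to the two turning points and \<open>t\<^sub>a\<close> the travel time from
  \<open>0\<close> to a wall coordinate \<open>a\<close>. Equating the two coordinates leaves countably many equations in \<open>\<theta>\<close>,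
  real-analytic between the thresholds \<open>\<theta> = V\<^sub>1 a\<close> and \<open>E - \<theta> = V\<^sub>2 b\<close>, so uncountably many
  resonant \<open>\<theta>\<close> force one of them to hold on a whole interval.

  At its own threshold \<open>c = V a\<close> the term \<open>t\<^sub>a\<close> has a square-root singularity \<open>sqrt (\<theta> - c)\<close> with an Abel
  transform of the derivative of \<open>V\<^sup>-\<^sup>1\<close> as coefficient, while everything else is analytic there.
  Hence the singular parts cancel, which by injectivity of the Abel transform is only possible for the
  two walls \<open>\<plusminus>a\<close> of an even potential, whose contributions cancel altogether. Removing the thresholds
  from the highest downwards gives
  \<open>N T\<^sub>1\<^sup>+ \<theta> + M T\<^sub>1\<^sup>- \<theta> = N' T\<^sub>2\<^sup>+ (E - \<theta>) + M' T\<^sub>2\<^sup>- (E - \<theta>)\<close> for all \<open>\<theta>\<close> in \<open>(0, E)\<close>.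

  If \<open>V\<^sub>1''(0) = 0\<close>, the left side tends to infinity as \<open>\<theta>\<close> tends to \<open>0\<close> while the right side stays bounded; the case
  \<open>V\<^sub>2''(0) = 0\<close> is symmetric. Otherwise \<open>T\<^sup>\<plusminus>\<close> are the branches \<open>A (\<plusminus> sqrt \<theta>)\<close> of one analytic
  function \<open>A\<close>, and analyticity of the opposite side at the end points makes each side depend on
  \<open>T\<^sup>+ + T\<^sup>-\<close> only. Under \<open>V\<^sub>1 x = \<omega> V\<^sub>2 (\<tau> x)\<close> both sides are proportional at the energy with
  \<open>\<theta> / \<omega> = E - \<theta>\<close>, so that \<open>\<bar>\<tau>\<bar> sqrt \<omega>\<close> would be rational.
\<close>

section \<open>Real-analytic functions\<close>

text \<open>Analyticity is expressed by a holomorphic extension rather than by a power series, so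
  that composition, inverse functions, parameter integrals and the identity theorem can all be taken
  from complex analysis.\<close>

definition real_analytic_at :: "(real \<Rightarrow> real) \<Rightarrow> real \<Rightarrow> bool" where
  "real_analytic_at f x \<longleftrightarrow>
     (\<exists>F. F analytic_on {complex_of_real x} \<and> (\<forall>\<^sub>F y in nhds x. F (of_real y) = of_real (f y)))"

lemma real_analytic_atI:
  assumes "F analytic_on {complex_of_real x}" "\<forall>\<^sub>F y in nhds x. F (of_real y) = of_real (f y)"
  shows "real_analytic_at f x"
  using assms unfolding real_analytic_at_def by blast

lemma real_analytic_at_cong:
  assumes "real_analytic_at f x" "\<forall>\<^sub>F y in nhds x. f y = g y"
  shows "real_analytic_at g x"
proof -
  obtain F where F: "F analytic_on {complex_of_real x}" "\<forall>\<^sub>F y in nhds x. F (of_real y) = of_real (f y)"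
    using assms(1) unfolding real_analytic_at_def by blast
  show ?thesis
    by (rule real_analytic_atI[OF F(1)]) (use F(2) assms(2) in eventually_elim, simp)
qed

lemma real_analytic_at_const: "real_analytic_at (\<lambda>_. c) x"
  by (rule real_analytic_atI[where F = "\<lambda>_. of_real c"]) (auto intro!: analytic_intros)

lemma real_analytic_at_ident: "real_analytic_at (\<lambda>y. y) x"
  by (rule real_analytic_atI[where F = "\<lambda>z. z"]) (auto intro!: analytic_intros)

lemma real_analytic_at_add:
  assumes "real_analytic_at f x" "real_analytic_at g x"
  shows "real_analytic_at (\<lambda>y. f y + g y) x"
proof -
  obtain F G where "F analytic_on {complex_of_real x}" "\<forall>\<^sub>F y in nhds x. F (of_real y) = of_real (f y)"
    "G analytic_on {complex_of_real x}" "\<forall>\<^sub>F y in nhds x. G (of_real y) = of_real (g y)"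
    using assms unfolding real_analytic_at_def by blast
  then show ?thesis
    by (intro real_analytic_atI[where F = "\<lambda>z. F z + G z"] analytic_intros) (auto elim: eventually_elim2)
qed

lemma real_analytic_at_mult:
  assumes "real_analytic_at f x" "real_analytic_at g x"
  shows "real_analytic_at (\<lambda>y. f y * g y) x"
proof -
  obtain F G where "F analytic_on {complex_of_real x}" "\<forall>\<^sub>F y in nhds x. F (of_real y) = of_real (f y)"
    "G analytic_on {complex_of_real x}" "\<forall>\<^sub>F y in nhds x. G (of_real y) = of_real (g y)"
    using assms unfolding real_analytic_at_def by blast
  then show ?thesis
    by (intro real_analytic_atI[where F = "\<lambda>z. F z * G z"] analytic_intros) (auto elim: eventually_elim2)
qed

lemma real_analytic_at_minus:
  assumes "real_analytic_at f x"
  shows "real_analytic_at (\<lambda>y. - f y) x"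
  using real_analytic_at_mult[OF real_analytic_at_const[of "-1"] assms] by simp

lemma real_analytic_at_diff:
  assumes "real_analytic_at f x" "real_analytic_at g x"
  shows "real_analytic_at (\<lambda>y. f y - g y) x"
  using real_analytic_at_add[OF assms(1) real_analytic_at_minus[OF assms(2)]] by simp

lemma real_analytic_at_power:
  assumes "real_analytic_at f x"
  shows "real_analytic_at (\<lambda>y. f y ^ n) x"
  by (induction n) (auto intro!: real_analytic_at_mult real_analytic_at_const assms)

lemma real_analytic_at_sum:
  assumes "\<And>i. i \<in> I \<Longrightarrow> real_analytic_at (f i) x"
  shows "real_analytic_at (\<lambda>y. \<Sum>i\<in>I. f i y) x"
  using assms
  by (induction I rule: infinite_finite_induct) (auto intro!: real_analytic_at_add real_analytic_at_const)

lemma real_analytic_at_inverse: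
  assumes "real_analytic_at f x" "f x \<noteq> 0"
  shows "real_analytic_at (\<lambda>y. inverse (f y)) x"
proof -
  obtain F where F: "F analytic_on {complex_of_real x}" "\<forall>\<^sub>F y in nhds x. F (of_real y) = of_real (f y)"
    using assms unfolding real_analytic_at_def by blast
  have "F (of_real x) = of_real (f x)"
    using eventually_nhds_x_imp_x[OF F(2)] .
  with F assms(2) show ?thesis
    by (intro real_analytic_atI[where F = "\<lambda>z. inverse (F z)"] analytic_intros) (auto elim: eventually_mono)
qed

lemma real_analytic_at_divide:
  assumes "real_analytic_at f x" "real_analytic_at g x" "g x \<noteq> 0"
  shows "real_analytic_at (\<lambda>y. f y / g y) x"
  using real_analytic_at_mult[OF assms(1) real_analytic_at_inverse[OF assms(2,3)]]
  by (simp add: divide_inverse)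

lemma real_analytic_at_sqrt:
  assumes "x > 0"
  shows "real_analytic_at sqrt x"
proof (rule real_analytic_atI[where F = csqrt])
  show "csqrt analytic_on {complex_of_real x}"
    using assms by (intro analytic_intros) auto
  have "\<forall>\<^sub>F y in nhds x. y > 0"
    using assms by (intro eventually_nhds_in_open[of "{0<..}", simplified]) auto
  then show "\<forall>\<^sub>F y in nhds x. csqrt (of_real y) = of_real (sqrt y)"
    by eventually_elim simp
qed

lemma real_analytic_at_extension_deriv:
  assumes F: "F analytic_on {complex_of_real x}" "\<forall>\<^sub>F y in nhds x. F (of_real y) = of_real (f y)"
  shows "(f has_real_derivative Re (deriv F (of_real x))) (at x)" and "Im (deriv F (of_real x)) = 0"
proof -
  have D: "(F has_field_derivative deriv F (of_real x)) (at (of_real x))"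
    using F(1) by (rule analytic_derivI)
  have V: "((\<lambda>y. F (of_real y)) has_vector_derivative deriv F (of_real x)) (at x)"
    by (rule has_vector_derivative_real_field[OF D])
  have "((\<lambda>y. Re (F (of_real y))) has_vector_derivative Re (deriv F (of_real x))) (at x)"
    using bounded_linear.has_vector_derivative[OF bounded_linear_Re V] .
  then have R: "((\<lambda>y. Re (F (of_real y))) has_real_derivative Re (deriv F (of_real x))) (at x)"
    by (simp add: has_real_derivative_iff_has_vector_derivative)
  have "\<forall>\<^sub>F y in nhds x. Re (F (of_real y)) = f y"
    using F(2) by eventually_elim simp
  with R show "(f has_real_derivative Re (deriv F (of_real x))) (at x)"
    by (subst (asm) DERIV_cong_ev[OF refl _ refl]) auto
  have "((\<lambda>y. Im (F (of_real y))) has_vector_derivative Im (deriv F (of_real x))) (at x)"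
    using bounded_linear.has_vector_derivative[OF bounded_linear_Im V] .
  then have I: "((\<lambda>y. Im (F (of_real y))) has_real_derivative Im (deriv F (of_real x))) (at x)"
    by (simp add: has_real_derivative_iff_has_vector_derivative)
  have "\<forall>\<^sub>F y in nhds x. Im (F (of_real y)) = 0"
    using F(2) by eventually_elim simp
  with I have "((\<lambda>y. 0::real) has_real_derivative Im (deriv F (of_real x))) (at x)"
    by (subst (asm) DERIV_cong_ev[OF refl _ refl]) auto
  then show "Im (deriv F (of_real x)) = 0"
    using DERIV_const DERIV_unique by blast
qed

lemma real_analytic_at_DERIV:
  assumes "real_analytic_at f x"
  shows "(f has_real_derivative deriv f x) (at x)"
proof -
  from assms obtain D where "(f has_real_derivative D) (at x)"
    unfolding real_analytic_at_def using real_analytic_at_extension_deriv by blast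
  then show ?thesis by (metis DERIV_imp_deriv)
qed

lemma real_analytic_at_isCont: "real_analytic_at f x \<Longrightarrow> isCont f x"
  using real_analytic_at_DERIV DERIV_isCont by blast

lemma real_analytic_at_nhds:
  assumes F: "F analytic_on {complex_of_real x}" "\<forall>\<^sub>F y in nhds x. F (of_real y) = of_real (f y)"
  shows "\<forall>\<^sub>F z in nhds x. F analytic_on {of_real z} \<and> (\<forall>\<^sub>F y in nhds z. F (of_real y) = of_real (f y))"
proof -
  obtain S where S: "open S" "complex_of_real x \<in> S" "F holomorphic_on S"
    using F(1) unfolding analytic_at by blast
  have "\<forall>\<^sub>F z in nhds x. z \<in> of_real -` S"
    using S by (intro eventually_nhds_in_open open_vimage) (auto intro: continuous_intros)
  then have "\<forall>\<^sub>F z in nhds x. F analytic_on {of_real z}"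
    by eventually_elim (use S in \<open>auto simp: analytic_at\<close>)
  moreover have "\<forall>\<^sub>F z in nhds x. \<forall>\<^sub>F y in nhds z. F (of_real y) = of_real (f y)"
    using F(2) by (simp add: eventually_eventually)
  ultimately show ?thesis by eventually_elim simp
qed

lemma real_analytic_at_deriv:
  assumes "real_analytic_at f x"
  shows "real_analytic_at (deriv f) x"
proof -
  from assms obtain F where F: "F analytic_on {complex_of_real x}" "\<forall>\<^sub>F y in nhds x. F (of_real y) = of_real (f y)"
    unfolding real_analytic_at_def by blast
  show ?thesis
  proof (rule real_analytic_atI[where F = "deriv F"])
    show "deriv F analytic_on {complex_of_real x}" using F(1) by (rule analytic_deriv)
    show "\<forall>\<^sub>F y in nhds x. deriv F (of_real y) = of_real (deriv f y)"
      using real_analytic_at_nhds[OF F]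
    proof eventually_elim
      case (elim y)
      then have "(f has_real_derivative Re (deriv F (of_real y))) (at y)" "Im (deriv F (of_real y)) = 0"
        using real_analytic_at_extension_deriv by blast+
      then show ?case
        by (metis DERIV_imp_deriv complex_eqI Im_complex_of_real Re_complex_of_real)
    qed
  qed
qed

lemma real_analytic_at_compose:
  assumes "real_analytic_at f x" "real_analytic_at h (f x)"
  shows "real_analytic_at (\<lambda>y. h (f y)) x"
proof -
  obtain F G where F: "F analytic_on {complex_of_real x}" "\<forall>\<^sub>F y in nhds x. F (of_real y) = of_real (f y)"
    and G: "G analytic_on {complex_of_real (f x)}" "\<forall>\<^sub>F y in nhds (f x). G (of_real y) = of_real (h y)"
    using assms unfolding real_analytic_at_def by blast
  have Fx: "F (of_real x) = of_real (f x)"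
    using eventually_nhds_x_imp_x[OF F(2)] .
  have "(f \<longlongrightarrow> f x) (nhds x)"
    using real_analytic_at_isCont[OF assms(1)] by (simp add: isCont_def tendsto_at_iff_tendsto_nhds)
  then have "\<forall>\<^sub>F y in nhds x. G (of_real (f y)) = of_real (h (f y))"
    using G(2) unfolding filterlim_iff by blast
  with F(2) have ev: "\<forall>\<^sub>F y in nhds x. (G \<circ> F) (of_real y) = of_real (h (f y))"
    by eventually_elim simp
  have "(G \<circ> F) analytic_on {complex_of_real x}"
    using F(1) G(1) by (intro analytic_on_compose) (auto simp: Fx)
  from this ev show ?thesis by (rule real_analytic_atI)
qed

lemma real_analytic_at_sqrt': "real_analytic_at f x \<Longrightarrow> f x > 0 \<Longrightarrow> real_analytic_at (\<lambda>y. sqrt (f y)) x"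
  by (rule real_analytic_at_compose[OF _ real_analytic_at_sqrt])

lemma real_analytic_imp_real_analytic_at:
  assumes "real_analytic V"
  shows "real_analytic_at V x"
proof -
  obtain r c where r: "r > 0" and c: "\<And>y. \<bar>y - x\<bar> < r \<Longrightarrow> (\<lambda>n. c n * (y - x) ^ n) sums V y"
    using assms unfolding real_analytic_def by blast
  define C where "C n = complex_of_real (c n)" for n
  define F where "F z = (\<Sum>n. C n * (z - of_real x) ^ n)" for z
  \<comment> \<open>At the real point \<open>x + \<rho>\<close> the given series converges, so the
    complex series converges on the whole open disc of radius \<open>\<rho>\<close>.\<close>
  define \<rho> where "\<rho> = r / 2"
  have \<rho>: "\<rho> > 0" "\<rho> < r" using r by (auto simp: \<rho>_def)
  have "summable (\<lambda>n. c n * \<rho> ^ n)"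
    using c[of "x + \<rho>"] \<rho> by (auto dest: sums_summable)
  then have "summable (\<lambda>n. complex_of_real (c n * \<rho> ^ n))"
    by (rule summable_of_real)
  then have S: "summable (\<lambda>n. C n * of_real \<rho> ^ n)"
    by (simp add: C_def)
  have "F analytic_on ball (of_real x) \<rho>"
  proof (rule power_series_analytic[where a = C])
    fix w assume "w \<in> ball (complex_of_real x) \<rho>"
    then have "norm (w - of_real x) < norm (complex_of_real \<rho>)"
      using \<rho> by (simp add: dist_norm norm_minus_commute)
    from powser_inside[OF S this] show "(\<lambda>n. C n * (w - of_real x) ^ n) sums F w"
      unfolding F_def by (rule summable_sums)
  qed
  then have an: "F analytic_on {of_real x}"
    by (rule analytic_on_subset) (use \<rho> in auto)
  have "\<forall>\<^sub>F y in nhds x. y \<in> ball x r"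
    using r by (intro eventually_nhds_in_open) auto
  then have "\<forall>\<^sub>F y in nhds x. F (of_real y) = of_real (V y)"
  proof eventually_elim
    case (elim y)
    then have "(\<lambda>n. c n * (y - x) ^ n) sums V y"
      by (intro c) (auto simp: dist_real_def)
    then have "(\<lambda>n. complex_of_real (c n * (y - x) ^ n)) sums of_real (V y)"
      by (simp only: sums_of_real_iff)
    then have "(\<lambda>n. C n * (of_real y - of_real x) ^ n) sums of_real (V y)"
      by (simp add: C_def)
    then show ?case unfolding F_def by (simp add: sums_iff)
  qed
  from an this show ?thesis by (rule real_analytic_atI)
qed

section \<open>Identity theorem, inverse functions and parameter integrals\<close>

lemma real_analytic_at_eventually_zero:
  assumes "real_analytic_at f x" "x islimpt U" "\<And>y. y \<in> U \<Longrightarrow> f y = 0"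
  shows "\<forall>\<^sub>F y in nhds x. f y = 0"
proof -
  obtain F where F: "F analytic_on {complex_of_real x}" "\<forall>\<^sub>F y in nhds x. F (of_real y) = of_real (f y)"
    using assms unfolding real_analytic_at_def by blast
  obtain e where e: "e > 0" "F holomorphic_on ball (of_real x) e"
    using F(1) unfolding analytic_on_def by auto
  obtain d where d: "d > 0" "\<And>y. dist y x < d \<Longrightarrow> F (of_real y) = of_real (f y)"
    using F(2) unfolding eventually_nhds_metric by blast
  define \<delta> where "\<delta> = min d e"
  have \<delta>: "\<delta> > 0" using d e by (simp add: \<delta>_def)
  \<comment> \<open>The zeros of \<open>f\<close> accumulate at the centre of the disc, so the
    identity theorem for holomorphic functions annihilates \<open>F\<close> on all of it.\<close>
  have z: "F w = 0" if w: "w \<in> ball (of_real x) \<delta>" for w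
  proof (rule analytic_continuation[of F "ball (of_real x) \<delta>" "of_real ` (U \<inter> ball x \<delta>)" "of_real x"])
    show "F holomorphic_on ball (of_real x) \<delta>"
      using e(2) by (rule holomorphic_on_subset) (auto simp: \<delta>_def)
    show "complex_of_real ` (U \<inter> ball x \<delta>) \<subseteq> ball (of_real x) \<delta>"
      by (auto simp: dist_of_real)
    show "complex_of_real x islimpt complex_of_real ` (U \<inter> ball x \<delta>)"
      unfolding islimpt_approachable
    proof (intro allI impI)
      fix \<epsilon> :: real assume "\<epsilon> > 0"
      with assms(2) \<delta> obtain y where "y \<in> U" "y \<noteq> x" "dist y x < min \<epsilon> \<delta>"
        unfolding islimpt_approachable by (metis min_less_iff_conj)
      then show "\<exists>x'\<in>of_real ` (U \<inter> ball x \<delta>). x' \<noteq> complex_of_real x \<and> dist x' (of_real x) < \<epsilon>"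
        by (intro bexI[of _ "of_real y"]) (auto simp: dist_of_real dist_commute)
    qed
    show "F z = 0" if "z \<in> of_real ` (U \<inter> ball x \<delta>)" for z
      using that assms(3) d(2) by (auto simp: dist_commute \<delta>_def)
  qed (use \<delta> w in auto)
  show ?thesis
    unfolding eventually_nhds_metric
  proof (intro exI[of _ \<delta>] conjI allI impI)
    fix y assume "dist y x < \<delta>"
    then show "f y = 0"
      using z[of "of_real y"] d(2)[of y] by (auto simp: dist_of_real dist_commute \<delta>_def)
  qed (fact \<delta>)
qed

text \<open>The set \<open>Z\<close> of points near which \<open>f\<close> vanishes is open. Its
  part in \<open>S\<close> is also closed in \<open>S\<close>, since at a limit point of zeros an
  analytic function vanishes in a whole neighbourhood. Connectedness then leaves only
  \<open>S\<close> itself, as \<open>\<xi>\<close> belongs to \<open>Z\<close>.\<close>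

lemma real_analytic_identity:
  assumes S: "open S" "connected S" and an: "\<And>x. x \<in> S \<Longrightarrow> real_analytic_at f x"
    and U: "\<xi> \<in> S" "\<xi> islimpt U" "\<And>y. y \<in> U \<Longrightarrow> f y = 0" and x: "x \<in> S"
  shows "f x = 0"
proof -
  define Z where "Z = {x. \<forall>\<^sub>F y in nhds x. f y = 0}"
  have oZ: "open Z"
    unfolding Z_def open_subopen[of "Collect _"]
    by (auto simp: eventually_nhds)
  have cl: "x \<in> Z" if "x \<in> S" "x islimpt Z" for x
    using real_analytic_at_eventually_zero[OF an[OF that(1)] that(2)] eventually_nhds_x_imp_x
    unfolding Z_def by blast
  have "\<xi> \<in> Z"
    using real_analytic_at_eventually_zero[OF an[OF U(1)] U(2,3)] by (simp add: Z_def)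
  have "openin (top_of_set S) (S \<inter> Z)" using oZ by auto
  moreover have "closedin (top_of_set S) (S \<inter> Z)"
    unfolding closedin_limpt using cl islimpt_subset by blast
  ultimately have "S \<inter> Z = {} \<or> S \<inter> Z = S"
    using S(2) unfolding connected_clopen by blast
  with \<open>\<xi> \<in> Z\<close> U(1) x have "x \<in> Z" by auto
  then show ?thesis unfolding Z_def using eventually_nhds_x_imp_x by auto
qed

text \<open>A nonzero derivative makes the complex extension injective on a ball, so it has a
  holomorphic inverse \<open>G\<close> on the open image of that ball. Continuity of
  \<open>g\<close> keeps \<open>g y\<close> in the ball for \<open>y\<close> near
  \<open>f x\<close>, where \<open>G\<close> must then agree with it.\<close>

lemma real_analytic_at_inverse_function:
  assumes f: "real_analytic_at f x" "deriv f x \<noteq> 0"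
    and g: "isCont g (f x)" "g (f x) = x" "\<forall>\<^sub>F y in nhds (f x). f (g y) = y"
  shows "real_analytic_at g (f x)"
proof -
  obtain F where F: "F analytic_on {complex_of_real x}" "\<forall>\<^sub>F y in nhds x. F (of_real y) = of_real (f y)"
    using assms unfolding real_analytic_at_def by blast
  have Fx: "F (of_real x) = of_real (f x)"
    using eventually_nhds_x_imp_x[OF F(2)] .
  have "deriv f x = Re (deriv F (of_real x))"
    using real_analytic_at_extension_deriv(1)[OF F] by (rule DERIV_imp_deriv)
  with f(2) have dnz: "deriv F (of_real x) \<noteq> 0" by auto
  obtain S where S: "open S" "complex_of_real x \<in> S" "F holomorphic_on S"
    using F(1) unfolding analytic_at by blast
  obtain r where r: "r > 0" "ball (of_real x) r \<subseteq> S" "inj_on F (ball (of_real x) r)"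
    using has_complex_derivative_locally_injective[OF S(3,2,1) dnz] by blast
  let ?B = "ball (complex_of_real x) r"
  have holB: "F holomorphic_on ?B" using S(3) r(2) by (rule holomorphic_on_subset)
  obtain G where G: "G holomorphic_on F ` ?B" "\<And>z. z \<in> ?B \<Longrightarrow> G (F z) = z"
    using holomorphic_has_inverse[OF holB _ r(3)] by (metis open_ball)
  have oF: "open (F ` ?B)"
    using holB r(3) by (intro open_mapping_thm3) auto
  have "G analytic_on {of_real (f x)}"
    unfolding analytic_at using oF G(1) r(1) Fx[symmetric] by (intro exI[of _ "F ` ?B"]) auto
  moreover have "\<forall>\<^sub>F y in nhds (f x). G (of_real y) = of_real (g y)"
  proof -
    have tg: "(g \<longlongrightarrow> x) (nhds (f x))"
      using g(1,2) by (metis isCont_def tendsto_at_iff_tendsto_nhds)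
    have "\<forall>\<^sub>F y in nhds (f x). F (of_real (g y)) = of_real (f (g y))"
      using tg F(2) unfolding filterlim_iff by blast
    moreover have "\<forall>\<^sub>F y in nhds (f x). g y \<in> ball x r"
      using r(1) by (intro eventually_compose_filterlim[OF eventually_nhds_in_open tg]) auto
    ultimately show ?thesis
      using g(3)
    proof eventually_elim
      case (elim y)
      then have "G (F (of_real (g y))) = of_real (g y)"
        by (intro G(2)) (auto simp: dist_of_real)
      with elim show ?case by simp
    qed
  qed
  ultimately show ?thesis by (rule real_analytic_atI)
qed

lemma real_analytic_at_divided_ident:
  assumes "real_analytic_at f 0" "f 0 = 0"
  shows "real_analytic_at (\<lambda>y. if y = 0 then deriv f 0 else f y / y) 0"
proof -
  obtain F where F: "F analytic_on {complex_of_real 0}" "\<forall>\<^sub>F y in nhds 0. F (of_real y) = of_real (f y)"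
    using assms unfolding real_analytic_at_def by blast
  have F0: "F 0 = 0"
    using eventually_nhds_x_imp_x[OF F(2)] assms(2) by simp
  have "deriv f 0 = Re (deriv F 0)" "Im (deriv F 0) = 0"
    using real_analytic_at_extension_deriv[OF F] DERIV_imp_deriv by auto
  then have D: "deriv F 0 = of_real (deriv f 0)" by (simp add: complex_eq_iff)
  obtain S where S: "open S" "0 \<in> S" "F holomorphic_on S"
    using F(1) unfolding analytic_at by auto
  show ?thesis
  proof (rule real_analytic_atI)
    have "(\<lambda>z. if z = 0 then deriv F 0 else (F z - F 0) / (z - 0)) holomorphic_on S"
      by (rule pole_lemma_open[OF S(3,1)])
    then show "(\<lambda>z. if z = 0 then deriv F 0 else (F z - F 0) / (z - 0)) analytic_on {complex_of_real 0}"
      unfolding analytic_at using S by auto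
    show "\<forall>\<^sub>F y in nhds 0. (if complex_of_real y = 0 then deriv F 0 else (F (of_real y) - F 0) / (of_real y - 0))
        = of_real (if y = 0 then deriv f 0 else f y / y)"
      using F(2) by eventually_elim (simp add: D F0)
  qed
qed

text \<open>The affine shape \<open>\<kappa> v + z * \<mu> v\<close> covers three integrals: travel
  times with a constant \<open>\<mu>\<close>, Abel means with weights \<open>v\<^sup>2\<close> and
  \<open>1 - v\<^sup>2\<close>, and the integral over \<open>r * sin v\<close> near a minimum.
  Bisection of the interval reduces the claim to pieces on which one complex extension of
  \<open>h\<close> serves all \<open>v\<close>, and there it is differentiation under the
  integral.\<close>

lemma real_analytic_at_parametric_integral:
  fixes a b z0 :: real
  assumes ab: "a \<le> b" and cont: "continuous_on {a..b} \<kappa>" "continuous_on {a..b} \<mu>"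
    and h: "\<And>v. v \<in> {a..b} \<Longrightarrow> real_analytic_at h (\<kappa> v + z0 * \<mu> v)"
  shows "real_analytic_at (\<lambda>z. integral {a..b} (\<lambda>v. h (\<kappa> v + z * \<mu> v))) z0"
proof -
  define P where "P c e \<longleftrightarrow> (a \<le> c \<and> e \<le> b \<longrightarrow>
      (\<forall>\<^sub>F z in nhds z0. (\<lambda>v. h (\<kappa> v + z * \<mu> v)) integrable_on {c..e}) \<and>
      real_analytic_at (\<lambda>z. integral {c..e} (\<lambda>v. h (\<kappa> v + z * \<mu> v))) z0)" for c e
  obtain \<Lambda> where \<Lambda>: "\<Lambda> > 0" "\<And>v. v \<in> {a..b} \<Longrightarrow> \<bar>\<mu> v\<bar> \<le> \<Lambda>"
    using compact_imp_bounded[OF compact_continuous_image[OF cont(2) compact_Icc]]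
    unfolding bounded_pos by auto
  have "P a b" using ab
  proof (induct rule: Bolzano)
    case (trans c m e)
    show ?case
      unfolding P_def
    proof (intro impI)
      assume *: "a \<le> c \<and> e \<le> b"
      then have A: "\<forall>\<^sub>F z in nhds z0. (\<lambda>v. h (\<kappa> v + z * \<mu> v)) integrable_on {c..m}"
        "\<forall>\<^sub>F z in nhds z0. (\<lambda>v. h (\<kappa> v + z * \<mu> v)) integrable_on {m..e}"
        "real_analytic_at (\<lambda>z. integral {c..m} (\<lambda>v. h (\<kappa> v + z * \<mu> v))) z0"
        "real_analytic_at (\<lambda>z. integral {m..e} (\<lambda>v. h (\<kappa> v + z * \<mu> v))) z0"
        using trans unfolding P_def by auto
      from A(1,2) have i: "\<forall>\<^sub>F z in nhds z0. (\<lambda>v. h (\<kappa> v + z * \<mu> v)) integrable_on {c..e}"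
        by eventually_elim (rule Henstock_Kurzweil_Integration.integrable_combine[OF trans(3,4)])
      from i have "\<forall>\<^sub>F z in nhds z0. integral {c..m} (\<lambda>v. h (\<kappa> v + z * \<mu> v))
          + integral {m..e} (\<lambda>v. h (\<kappa> v + z * \<mu> v)) = integral {c..e} (\<lambda>v. h (\<kappa> v + z * \<mu> v))"
        by eventually_elim (rule Henstock_Kurzweil_Integration.integral_combine[OF trans(3,4)])
      from real_analytic_at_cong[OF real_analytic_at_add[OF A(3,4)] this] i
      show "(\<forall>\<^sub>F z in nhds z0. (\<lambda>v. h (\<kappa> v + z * \<mu> v)) integrable_on {c..e}) \<and>
          real_analytic_at (\<lambda>z. integral {c..e} (\<lambda>v. h (\<kappa> v + z * \<mu> v))) z0" by blast
    qed
  next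
    case (local v0)
    define w0 where "w0 = \<kappa> v0 + z0 * \<mu> v0"
    obtain F where F: "F analytic_on {complex_of_real w0}" "\<forall>\<^sub>F y in nhds w0. F (of_real y) = of_real (h y)"
      using h[of v0] local unfolding real_analytic_at_def w0_def by auto
    obtain r1 where r1: "r1 > 0" "F holomorphic_on ball (of_real w0) r1"
      using F(1) unfolding analytic_on_def by auto
    obtain r2 where r2: "r2 > 0" "\<And>y. dist y w0 < r2 \<Longrightarrow> F (of_real y) = of_real (h y)"
      using F(2) unfolding eventually_nhds_metric by blast
    define \<rho> where "\<rho> = min r1 r2"
    have \<rho>: "\<rho> > 0" using r1 r2 by (simp add: \<rho>_def)
    have holF: "F holomorphic_on ball (of_real w0) \<rho>"
      using r1(2) by (rule holomorphic_on_subset) (auto simp: \<rho>_def)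
    have Fh: "F (of_real y) = of_real (h y)" if "\<bar>y - w0\<bar> < \<rho>" for y
      using r2(2) that by (auto simp: \<rho>_def dist_real_def)
    have "continuous_on {a..b} (\<lambda>v. \<kappa> v + z0 * \<mu> v)"
      by (intro continuous_intros cont)
    then obtain d where d: "d > 0"
        "\<And>v. v \<in> {a..b} \<Longrightarrow> dist v v0 < d \<Longrightarrow> dist (\<kappa> v + z0 * \<mu> v) w0 < \<rho> / 2"
      unfolding continuous_on_iff w0_def using local \<rho> by (metis atLeastAtMost_iff half_gt_zero)
    \<comment> \<open>Moving the parameter by less than \<open>\<epsilon>\<close> moves the argument
      by at most \<open>\<rho> / 2\<close>; moving \<open>v\<close> within \<open>d\<close> of
      \<open>v0\<close> costs less than the other half.\<close>
    define \<epsilon> where "\<epsilon> = \<rho> / (2 * \<Lambda>)"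
    have \<epsilon>: "\<epsilon> > 0" using \<rho> \<Lambda> by (simp add: \<epsilon>_def)
    have inball: "norm (of_real (\<kappa> v) + z * of_real (\<mu> v) - of_real w0) < \<rho>"
      if "v \<in> {a..b}" "dist v v0 < d" "z \<in> ball (of_real z0) \<epsilon>" for v and z :: complex
    proof -
      have "of_real (\<kappa> v) + z * of_real (\<mu> v) - of_real w0
          = of_real (\<kappa> v + z0 * \<mu> v - w0) + (z - of_real z0) * of_real (\<mu> v)"
        by (simp add: algebra_simps)
      also have "norm \<dots> \<le> norm (complex_of_real (\<kappa> v + z0 * \<mu> v - w0)) + norm ((z - of_real z0) * of_real (\<mu> v))"
        by (rule norm_triangle_ineq)
      also have "norm (complex_of_real (\<kappa> v + z0 * \<mu> v - w0)) < \<rho> / 2"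
        using d(2)[OF that(1,2)] unfolding norm_of_real dist_real_def .
      also have "norm ((z - of_real z0) * of_real (\<mu> v)) \<le> \<epsilon> * \<Lambda>"
        unfolding norm_mult using that(3) \<Lambda>(2)[OF that(1)] \<epsilon> \<Lambda>(1)
        by (intro mult_mono) (auto simp: dist_norm norm_minus_commute)
      also have "\<epsilon> * \<Lambda> = \<rho> / 2" using \<Lambda>(1) by (simp add: \<epsilon>_def)
      finally show ?thesis by simp
    qed
    have inball': "of_real (\<kappa> v) + z * of_real (\<mu> v) \<in> ball (complex_of_real w0) \<rho>"
      if "v \<in> {a..b}" "dist v v0 < d" "z \<in> ball (of_real z0) \<epsilon>" for v and z :: complex
      using inball[OF that] by (simp add: dist_norm norm_minus_commute)
    show ?case
    proof (intro exI[of _ d] conjI allI impI)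
      fix c e assume ce: "c \<le> v0 \<and> v0 \<le> e \<and> e - c < d"
      show "P c e"
        unfolding P_def
      proof (rule impI)
        assume ab': "a \<le> c \<and> e \<le> b"
        have near: "v \<in> {a..b} \<and> dist v v0 < d" if "v \<in> {c..e}" for v
          using that ce ab' by (auto simp: dist_real_def)
        have contc: "continuous_on {c..e} (\<lambda>v. complex_of_real (\<kappa> v))" "continuous_on {c..e} (\<lambda>v. complex_of_real (\<mu> v))"
          using ab' by (auto intro!: continuous_intros intro: continuous_on_subset[OF cont(1)] continuous_on_subset[OF cont(2)])
        let ?f = "\<lambda>z v. F (of_real (\<kappa> v) + z * of_real (\<mu> v))"
        have int: "?f z integrable_on {c..e}" if "z \<in> ball (of_real z0) \<epsilon>" for z
          using that near
          by (intro integrable_continuous_real continuous_on_compose2[OF holomorphic_on_imp_continuous_on[OF holF]]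
              continuous_on_add continuous_on_mult continuous_on_const contc) (blast intro: inball')+
        have "(\<lambda>z. integral (cbox c e) (?f z)) holomorphic_on ball (of_real z0) \<epsilon>"
        proof (rule leibniz_rule_holomorphic)
          fix z v assume z: "z \<in> ball (of_real z0 :: complex) \<epsilon>" and v: "v \<in> cbox c e"
          have "(F has_field_derivative deriv F (of_real (\<kappa> v) + z * of_real (\<mu> v)))
              (at (of_real (\<kappa> v) + z * of_real (\<mu> v)))"
            using inball[of v z] near[of v] z v
            by (intro holomorphic_derivI[OF holF]) (auto simp: dist_norm norm_minus_commute)
          then show "((\<lambda>z. ?f z v) has_field_derivative
              deriv F (of_real (\<kappa> v) + z * of_real (\<mu> v)) * of_real (\<mu> v)) (at z within ball (of_real z0) \<epsilon>)"
            by (rule DERIV_chain2) (auto intro!: derivative_eq_intros)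
        next
          show "continuous_on (ball (of_real z0) \<epsilon> \<times> cbox c e)
              (\<lambda>(z, v). deriv F (of_real (\<kappa> v) + z * of_real (\<mu> v)) * of_real (\<mu> v))"
            unfolding split_beta
            using near holF
            by (intro continuous_intros continuous_on_compose2[OF holomorphic_on_imp_continuous_on[OF holomorphic_deriv[OF holF open_ball]]]
                continuous_on_compose2[OF contc(1)] continuous_on_compose2[OF contc(2)])
              (auto intro!: inball' simp del: mem_ball dist_norm)
        qed (use int in auto)
        then have an: "(\<lambda>z. integral {c..e} (?f z)) analytic_on {of_real z0}"
          unfolding analytic_at using \<epsilon> by (intro exI[of _ "ball (of_real z0) \<epsilon>"]) auto
        have ev: "\<forall>\<^sub>F z in nhds z0. z \<in> ball z0 \<epsilon>"
          using \<epsilon> by (intro eventually_nhds_in_open) auto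
        have eq: "?f (of_real z) v = of_real (h (\<kappa> v + z * \<mu> v))" if "z \<in> ball z0 \<epsilon>" "v \<in> {c..e}" for z v
        proof -
          have "norm (of_real (\<kappa> v) + of_real z * of_real (\<mu> v) - complex_of_real w0) < \<rho>"
            using inball[of v "of_real z"] near[OF that(2)] that(1) by (simp add: dist_of_real)
          then have "norm (complex_of_real (\<kappa> v + z * \<mu> v - w0)) < \<rho>"
            by simp
          from Fh[OF this[unfolded norm_of_real]] show ?thesis by simp
        qed
        have I: "((\<lambda>v. complex_of_real (h (\<kappa> v + z * \<mu> v))) has_integral integral {c..e} (?f (of_real z))) {c..e}"
          if "z \<in> ball z0 \<epsilon>" for z
          using int[of "of_real z"] that eq[OF that]
          by (subst has_integral_cong[of _ _ "?f (of_real z)"]) (auto simp: integrable_integral dist_of_real)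
        have "((\<lambda>v. h (\<kappa> v + z * \<mu> v)) has_integral Re (integral {c..e} (?f (of_real z)))) {c..e}"
          if "z \<in> ball z0 \<epsilon>" for z
          using has_integral_linear[OF I[OF that] bounded_linear_Re] by (simp add: o_def)
        then have int': "(\<lambda>v. h (\<kappa> v + z * \<mu> v)) integrable_on {c..e}" if "z \<in> ball z0 \<epsilon>" for z
          using that by blast
        have "integral {c..e} (?f (of_real z)) = of_real (integral {c..e} (\<lambda>v. h (\<kappa> v + z * \<mu> v)))"
          if "z \<in> ball z0 \<epsilon>" for z
          using has_integral_unique[OF I[OF that] has_integral_linear[OF integrable_integral[OF int'[OF that]]
              bounded_linear_of_real, unfolded o_def]] .
        with ev have "\<forall>\<^sub>F z in nhds z0. integral {c..e} (?f (of_real z)) = of_real (integral {c..e} (\<lambda>v. h (\<kappa> v + z * \<mu> v)))"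
          by (auto elim: eventually_mono)
        from real_analytic_atI[OF an this] ev int'
        show "(\<forall>\<^sub>F z in nhds z0. (\<lambda>v. h (\<kappa> v + z * \<mu> v)) integrable_on {c..e}) \<and>
          real_analytic_at (\<lambda>z. integral {c..e} (\<lambda>v. h (\<kappa> v + z * \<mu> v))) z0"
          by (auto elim: eventually_mono)
      qed
    qed (fact d(1))
  qed
  then show ?thesis unfolding P_def by simp
qed

text \<open>\<open>f\<close> may be unbounded at the end points, since the derivative of
  \<open>w\<close> is needed in the interior only: the antiderivative of \<open>\<Gamma>\<close>
  composed with \<open>w\<close> stays continuous up to both ends. Existence of the integral of
  \<open>f\<close> is part of the conclusion, which is what singular travel-time integrals
  need.\<close>

lemma has_integral_substitution_interior:
  fixes f :: "real \<Rightarrow> real"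
  assumes "a \<le> r" and w: "continuous_on {a..r} w" "\<And>x. x \<in> {a..r} \<Longrightarrow> w x \<in> {\<alpha>..\<beta>}"
    and win: "\<And>x. x \<in> {a<..<r} \<Longrightarrow> w x \<in> {\<alpha><..<\<beta>}"
    and \<Gamma>: "continuous_on {\<alpha>..\<beta>} \<Gamma>"
    and d: "\<And>x. x \<in> {a<..<r} \<Longrightarrow> (w has_real_derivative w' x) (at x)"
    and f: "\<And>x. x \<in> {a<..<r} \<Longrightarrow> f x = \<Gamma> (w x) * w' x"
  shows "(f has_integral integral {\<alpha>..w r} \<Gamma> - integral {\<alpha>..w a} \<Gamma>) {a..r}"
proof (rule fundamental_theorem_of_calculus_interior[OF assms(1)])
  have \<Gamma>i: "\<Gamma> integrable_on {\<alpha>..\<beta>}" using \<Gamma> by (rule integrable_continuous_real)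
  show "continuous_on {a..r} (\<lambda>x. integral {\<alpha>..w x} \<Gamma>)"
    by (rule continuous_on_compose2[OF indefinite_integral_continuous_1[OF \<Gamma>i] w(1)]) (use w(2) in auto)
  fix x assume x: "x \<in> {a<..<r}"
  have "((\<lambda>y. integral {\<alpha>..y} \<Gamma>) has_real_derivative \<Gamma> (w x)) (at (w x) within {\<alpha>..\<beta>})"
    using win[OF x] by (intro integral_has_real_derivative[OF \<Gamma>]) auto
  then have "((\<lambda>y. integral {\<alpha>..y} \<Gamma>) has_real_derivative \<Gamma> (w x)) (at (w x))"
    using win[OF x] at_within_interior[of "w x" "{\<alpha>..\<beta>}"] by (auto simp: interior_atLeastAtMost_real)
  from DERIV_chain2[OF this d[OF x]] f[OF x]
  show "((\<lambda>x. integral {\<alpha>..w x} \<Gamma>) has_vector_derivative f x) (at x)"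
    by (simp add: has_real_derivative_iff_has_vector_derivative)
qed

section \<open>Unimodal potentials and travel times\<close>

lemma UM_real_analytic_at: "UM V \<Longrightarrow> real_analytic_at V x"
  by (simp add: UM_def real_analytic_imp_real_analytic_at)

lemma UM_DERIV: "UM V \<Longrightarrow> (V has_real_derivative deriv V x) (at x)"
  by (simp add: UM_real_analytic_at real_analytic_at_DERIV)

lemma UM_isCont: "UM V \<Longrightarrow> isCont V x"
  by (simp add: UM_real_analytic_at real_analytic_at_isCont)

lemma UM_continuous_on: "UM V \<Longrightarrow> continuous_on A V"
  by (simp add: UM_isCont continuous_at_imp_continuous_on)

lemma UM_0: "UM V \<Longrightarrow> V 0 = 0"
  by (simp add: UM_def)

lemma UM_mult_deriv_pos: "UM V \<Longrightarrow> x \<noteq> 0 \<Longrightarrow> x * deriv V x > 0"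
  by (simp add: UM_def)

lemma UM_deriv_pos: "UM V \<Longrightarrow> x > 0 \<Longrightarrow> deriv V x > 0"
  using UM_mult_deriv_pos[of V x] by (simp add: zero_less_mult_iff)

lemma UM_deriv_nonzero: "UM V \<Longrightarrow> x \<noteq> 0 \<Longrightarrow> deriv V x \<noteq> 0"
  using UM_mult_deriv_pos[of V x] by auto

lemma UM_deriv_0: "UM V \<Longrightarrow> deriv V 0 = 0"
  by (rule DERIV_local_min[OF UM_DERIV, where d = 1]) (auto simp: UM_def)

lemma UM_strict_mono:
  assumes "UM V" "0 \<le> x" "x < y"
  shows "V x < V y"
  using assms by (intro DERIV_pos_imp_increasing_open[OF assms(3)])
    (auto intro!: exI UM_DERIV UM_deriv_pos UM_continuous_on)

lemma UM_less_iff: "UM V \<Longrightarrow> 0 \<le> x \<Longrightarrow> 0 \<le> y \<Longrightarrow> V x < V y \<longleftrightarrow> x < y"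
  using UM_strict_mono[of V x y] UM_strict_mono[of V y x] by (cases x y rule: linorder_cases) auto

lemma UM_eq_iff: "UM V \<Longrightarrow> 0 \<le> x \<Longrightarrow> 0 \<le> y \<Longrightarrow> V x = V y \<longleftrightarrow> x = y"
  using UM_strict_mono[of V x y] UM_strict_mono[of V y x] by (cases x y rule: linorder_cases) auto

lemma deriv_refl_pot:
  assumes "UM V"
  shows "deriv (refl_pot V) y = - deriv V (- y)"
proof (rule DERIV_imp_deriv)
  have "((\<lambda>y. V (- y)) has_real_derivative deriv V (- y) * - 1) (at y)"
    by (rule DERIV_chain2[OF UM_DERIV[OF assms]]) (auto intro!: derivative_eq_intros)
  then show "(refl_pot V has_real_derivative - deriv V (- y)) (at y)"
    by (simp add: refl_pot_def[abs_def])
qed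

lemma UM_refl_pot:
  assumes "UM V"
  shows "UM (refl_pot V)"
proof -
  have "real_analytic (refl_pot V)"
    unfolding real_analytic_def
  proof
    fix x0
    obtain r c where r: "r > 0" and c: "\<And>x. \<bar>x - (- x0)\<bar> < r \<Longrightarrow> (\<lambda>n. c n * (x - (- x0)) ^ n) sums V x"
      using assms unfolding UM_def real_analytic_def by meson
    have "(\<lambda>n. (c n * (- 1) ^ n) * (x - x0) ^ n) sums refl_pot V x" if "\<bar>x - x0\<bar> < r" for x
    proof -
      have "(\<lambda>n. c n * (- x - (- x0)) ^ n) sums refl_pot V x"
        unfolding refl_pot_def using that by (intro c) auto
      moreover have "(- x - (- x0)) ^ n = (- 1) ^ n * (x - x0) ^ n" for n
        using power_mult_distrib[of "- 1" "x - x0" n] by simp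
      ultimately show ?thesis by (simp only: mult.assoc)
    qed
    then have "\<forall>x. \<bar>x - x0\<bar> < r \<longrightarrow> (\<lambda>n. (c n * (- 1) ^ n) * (x - x0) ^ n) sums refl_pot V x"
      by blast
    with r show "\<exists>r>0. \<exists>c. \<forall>x. \<bar>x - x0\<bar> < r \<longrightarrow> (\<lambda>n. c n * (x - x0) ^ n) sums refl_pot V x"
      by (intro exI[of _ r] exI[of _ "\<lambda>n. c n * (- 1) ^ n"] conjI)
  qed
  moreover have "y * deriv (refl_pot V) y > 0" if "y \<noteq> 0" for y
    using UM_mult_deriv_pos[OF assms, of "- y"] that by (simp add: deriv_refl_pot[OF assms])
  moreover have "filterlim (refl_pot V) at_top at_top" "filterlim (refl_pot V) at_top at_bot"
    using filterlim_compose[of V at_top at_bot uminus at_top] filterlim_compose[of V at_top at_top uminus at_bot]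
      filterlim_uminus_at_bot_at_top filterlim_uminus_at_top_at_bot assms
    unfolding UM_def refl_pot_def[abs_def] by blast+
  ultimately show ?thesis
    using assms unfolding UM_def by (auto simp: refl_pot_def)
qed

lemma UM_pos:
  assumes "UM V" "x \<noteq> 0"
  shows "V x > 0"
proof (cases "x > 0")
  case True
  then show ?thesis using UM_strict_mono[OF assms(1), of 0 x] UM_0[OF assms(1)] by simp
next
  case False
  then show ?thesis
    using UM_strict_mono[OF UM_refl_pot[OF assms(1)], of 0 "- x"] UM_0[OF assms(1)] assms(2)
    by (simp add: refl_pot_def)
qed

lemma inv_pos_eq: "UM V \<Longrightarrow> x \<ge> 0 \<Longrightarrow> inv_pos V (V x) = x"
  unfolding inv_pos_def by (rule the_equality) (auto simp: UM_eq_iff)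

lemma UM_surj:
  assumes "UM V" "s \<ge> 0"
  obtains x where "x \<ge> 0" "V x = s"
proof -
  have "\<forall>\<^sub>F y in at_top. V y \<ge> s"
    using assms(1) unfolding UM_def filterlim_at_top by blast
  then obtain N where N: "\<And>y. y \<ge> N \<Longrightarrow> V y \<ge> s" unfolding eventually_at_top_linorder by blast
  have "\<exists>x\<ge>0. x \<le> max 0 N \<and> V x = s"
    using N[of "max 0 N"] assms by (intro IVT') (auto simp: UM_0 UM_continuous_on)
  then show ?thesis using that by blast
qed

lemma inv_pos_nonneg: "UM V \<Longrightarrow> s \<ge> 0 \<Longrightarrow> inv_pos V s \<ge> 0"
  by (rule UM_surj[of V s]) (auto simp: inv_pos_eq)

lemma V_inv_pos: "UM V \<Longrightarrow> s \<ge> 0 \<Longrightarrow> V (inv_pos V s) = s"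
  by (rule UM_surj[of V s]) (auto simp: inv_pos_eq)

lemma inv_pos_pos: "UM V \<Longrightarrow> s > 0 \<Longrightarrow> inv_pos V s > 0"
  using inv_pos_nonneg[of V s] V_inv_pos[of V s] UM_0[of V] by (cases "inv_pos V s = 0") auto

lemma less_inv_pos_iff: "UM V \<Longrightarrow> x \<ge> 0 \<Longrightarrow> s \<ge> 0 \<Longrightarrow> x < inv_pos V s \<longleftrightarrow> V x < s"
  using UM_less_iff[of V x "inv_pos V s"] V_inv_pos[of V s] inv_pos_nonneg[of V s] by simp

lemma UM_less_iff_between:
  assumes "UM V" "\<theta> \<ge> 0"
  shows "V x < \<theta> \<longleftrightarrow> - inv_pos (refl_pot V) \<theta> < x \<and> x < inv_pos V \<theta>"
proof (cases "x \<ge> 0")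
  case True
  then show ?thesis
    using less_inv_pos_iff[OF assms(1) True assms(2)] inv_pos_nonneg[OF UM_refl_pot[OF assms(1)] assms(2)]
      UM_0[OF assms(1)] inv_pos_pos[OF UM_refl_pot[OF assms(1)], of \<theta>] UM_pos[OF assms(1), of x] assms(2)
    by (cases "x = 0") auto
next
  case False
  then show ?thesis
    using less_inv_pos_iff[OF UM_refl_pot[OF assms(1)], of "- x" \<theta>] assms(2) inv_pos_nonneg[OF assms(1,2)]
    by (auto simp: refl_pot_def)
qed

lemma UM_eq_cases:
  assumes "UM V" "\<theta> \<ge> 0" "V x = \<theta>"
  shows "x = inv_pos V \<theta> \<or> x = - inv_pos (refl_pot V) \<theta>"
  using inv_pos_eq[OF assms(1), of x] inv_pos_eq[OF UM_refl_pot[OF assms(1)], of "- x"] assms(3)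
  by (cases "x \<ge> 0") (auto simp: refl_pot_def)

lemma real_analytic_at_inv_pos:
  assumes V: "UM V" and s: "s > 0"
  shows "real_analytic_at (inv_pos V) s"
proof -
  define x where "x = inv_pos V s"
  have x: "x > 0" "V x = s" using V s by (auto simp: x_def inv_pos_pos V_inv_pos)
  have "real_analytic_at (inv_pos V) (V x)"
  proof (rule real_analytic_at_inverse_function[where f = V and x = x])
    show "isCont (inv_pos V) (V x)"
      using x by (intro isCont_inverse_function[where f = V and x = x and d = x]) (auto simp: inv_pos_eq[OF V] UM_isCont[OF V])
    have "\<forall>\<^sub>F y in nhds (V x). y \<in> {0<..}"
      using x s by (intro eventually_nhds_in_open) auto
    then show "\<forall>\<^sub>F y in nhds (V x). V (inv_pos V y) = y"
      by eventually_elim (use V V_inv_pos in auto)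
  qed (use x V in \<open>auto simp: UM_real_analytic_at UM_deriv_nonzero inv_pos_eq\<close>)
  then show ?thesis by (simp add: x)
qed

lemma deriv_inv_pos:
  assumes V: "UM V" and x: "x > 0"
  shows "deriv (inv_pos V) (V x) = 1 / deriv V x"
proof -
  have "(inv_pos V has_real_derivative inverse (deriv V x)) (at (V x))"
  proof (rule DERIV_inverse_function[where a = 0 and b = "V x + 1" and f = V])
    show "(V has_real_derivative deriv V x) (at (inv_pos V (V x)))"
      using V x by (simp add: inv_pos_eq UM_DERIV)
    show "isCont (inv_pos V) (V x)"
      using V x by (intro real_analytic_at_isCont real_analytic_at_inv_pos UM_pos) auto
  qed (use V x in \<open>auto simp: UM_deriv_nonzero UM_pos V_inv_pos\<close>)
  then show ?thesis by (simp add: DERIV_imp_deriv field_simps)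
qed

lemma deriv_inv_pos_pos:
  assumes "UM V" "s > 0"
  shows "deriv (inv_pos V) s > 0"
  using deriv_inv_pos[OF assms(1) inv_pos_pos[OF assms]] UM_deriv_pos[OF assms(1) inv_pos_pos[OF assms]]
    V_inv_pos[OF assms(1)] assms(2) by simp

lemma continuous_on_deriv_inv_pos:
  assumes "UM V" "A \<subseteq> {0<..}"
  shows "continuous_on A (deriv (inv_pos V))"
  using assms by (intro continuous_at_imp_continuous_on ballI real_analytic_at_isCont
      real_analytic_at_deriv real_analytic_at_inv_pos) auto

section \<open>Travel times and quarter periods as functions of the energy\<close>

definition travel_time :: "(real \<Rightarrow> real) \<Rightarrow> real \<Rightarrow> real \<Rightarrow> real" where
  "travel_time V x \<theta> = integral {0..x} (\<lambda>q. 1 / sqrt (2 * (\<theta> - V q)))"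

text \<open>At energy \<open>\<theta>\<close> the speed at \<open>q\<close> is
  \<open>sqrt (2 * (\<theta> - V q))\<close>, so this is the time from 0 to the right turning point;
  for the left one \<open>V\<close> is replaced by \<open>refl_pot V\<close>. For even
  \<open>V\<close> it is a quarter of the full period.\<close>

definition quarter_period :: "(real \<Rightarrow> real) \<Rightarrow> real \<Rightarrow> real" where
  "quarter_period V \<theta> = travel_time V (inv_pos V \<theta>) \<theta>"

text \<open>
  The Abel integral of \<open>deriv (inv_pos V)\<close> over \<open>[c, \<theta>]\<close> divided by \<open>2 sqrt (\<theta> - c)\<close>: the substitution
  \<open>u = c v\<^sup>2 + \<theta> (1 - v\<^sup>2)\<close> removes the singularity of the kernel.
\<close>

definition abel_mean :: "(real \<Rightarrow> real) \<Rightarrow> real \<Rightarrow> real \<Rightarrow> real" where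
  "abel_mean V c \<theta> = integral {0..1} (\<lambda>v. deriv (inv_pos V) (c * v\<^sup>2 + \<theta> * (1 - v\<^sup>2)))"

lemma convex_sq_pos:
  fixes c \<theta> v :: real
  assumes "c > 0" "\<theta> > 0" "v \<in> {0..1}"
  shows "c * v\<^sup>2 + \<theta> * (1 - v\<^sup>2) > 0"
proof -
  have "v\<^sup>2 \<le> 1" using assms(3) by (simp add: power_le_one)
  then have "c * v\<^sup>2 \<ge> 0" "\<theta> * (1 - v\<^sup>2) \<ge> 0" using assms by auto
  moreover have "c * v\<^sup>2 \<noteq> 0 \<or> \<theta> * (1 - v\<^sup>2) \<noteq> 0" using assms by auto
  ultimately show ?thesis by linarith
qed

lemma continuous_on_abel_integrand:
  assumes V: "UM V" and c: "c > 0" "\<theta> > 0"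
  shows "continuous_on {0..1} (\<lambda>v. deriv (inv_pos V) (c * v\<^sup>2 + \<theta> * (1 - v\<^sup>2)))"
  by (rule continuous_on_compose2[OF continuous_on_deriv_inv_pos[OF V order_refl]])
    (use convex_sq_pos[OF c] in \<open>auto intro!: continuous_intros\<close>)

text \<open>The new variable is \<open>w = sqrt ((\<theta> - V x) / (\<theta> - c))\<close> with
  \<open>c = V a\<close>, that is, \<open>V x = c * w\<^sup>2 + \<theta> * (1 - w\<^sup>2)\<close>.
  The root in the denominator cancels against the derivative of \<open>w\<close>, leaving the
  continuous factor \<open>deriv (inv_pos V)\<close>.\<close>

lemma has_integral_near_turning_point:
  assumes V: "UM V" and a: "a > 0" "V a < \<theta>"
  shows "((\<lambda>q. 1 / sqrt (2 * (\<theta> - V q))) has_integral sqrt 2 * sqrt (\<theta> - V a) * abel_mean V (V a) \<theta>)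
     {a..inv_pos V \<theta>}"
proof -
  define c where "c = V a"
  define r where "r = inv_pos V \<theta>"
  define w where "w x = sqrt ((\<theta> - V x) / (\<theta> - c))" for x
  \<comment> \<open>The minus sign appears because \<open>w\<close> falls from 1 at \<open>a\<close>
    to 0 at the turning point.\<close>
  define \<Gamma> where "\<Gamma> v = - (sqrt 2 * sqrt (\<theta> - c)) * deriv (inv_pos V) (c * v\<^sup>2 + \<theta> * (1 - v\<^sup>2))" for v
  have c: "c > 0" "c < \<theta>" using a V by (auto simp: c_def UM_pos)
  have r: "a < r" "V r = \<theta>"
    using less_inv_pos_iff[OF V, of a \<theta>] a c V_inv_pos[OF V, of \<theta>] by (auto simp: r_def)
  have mono: "c \<le> V x" "V x \<le> \<theta>" if "x \<in> {a..r}" for x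
    using UM_strict_mono[OF V, of a x] UM_strict_mono[OF V, of x r] that a r
    unfolding c_def by force+
  have mono': "c < V x" "V x < \<theta>" if "x \<in> {a<..<r}" for x
    using UM_strict_mono[OF V, of a x] UM_strict_mono[OF V, of x r] that a r
    unfolding c_def by force+
  have "((\<lambda>q. 1 / sqrt (2 * (\<theta> - V q))) has_integral integral {0..w r} \<Gamma> - integral {0..w a} \<Gamma>) {a..r}"
  proof (rule has_integral_substitution_interior)
    show "continuous_on {a..r} w"
      unfolding w_def using c by (intro continuous_intros UM_continuous_on V) auto
    show "w x \<in> {0..1}" if "x \<in> {a..r}" for x
      unfolding w_def using mono[OF that] c by auto
    show "w x \<in> {0<..<1}" if "x \<in> {a<..<r}" for x
      unfolding w_def using mono'[OF that] c by auto
    show "continuous_on {0..1} \<Gamma>"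
      unfolding \<Gamma>_def using c by (intro continuous_intros continuous_on_abel_integrand V) auto
    fix x assume x: "x \<in> {a<..<r}"
    have pos: "(\<theta> - V x) / (\<theta> - c) > 0" using mono'[OF x] c by auto
    show "(w has_real_derivative - deriv V x / (\<theta> - c) * (inverse (w x) / 2)) (at x)"
    proof -
      have "((\<lambda>x. (\<theta> - V x) / (\<theta> - c)) has_real_derivative - deriv V x / (\<theta> - c)) (at x)"
        using c by (auto intro!: derivative_eq_intros UM_DERIV V)
      from DERIV_chain2[OF DERIV_real_sqrt[OF pos] this] show ?thesis
        unfolding w_def by (simp add: mult.commute)
    qed
    have w2: "(w x)\<^sup>2 = (\<theta> - V x) / (\<theta> - c)" unfolding w_def using pos by simp
    have "c * (w x)\<^sup>2 + \<theta> * (1 - (w x)\<^sup>2) = \<theta> - (\<theta> - c) * (w x)\<^sup>2" by (simp add: algebra_simps)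
    also have "\<dots> = V x" using w2 c by simp
    finally have e: "deriv (inv_pos V) (c * (w x)\<^sup>2 + \<theta> * (1 - (w x)\<^sup>2)) = 1 / deriv V x"
      using deriv_inv_pos[OF V, of x] x a by simp
    have nz: "deriv V x > 0" using x a by (intro UM_deriv_pos[OF V]) auto
    have "\<Gamma> (w x) * (- deriv V x / (\<theta> - c) * (inverse (w x) / 2))
        = sqrt 2 * sqrt (\<theta> - c) / ((\<theta> - c) * 2 * w x)"
      unfolding \<Gamma>_def e using nz by (simp add: field_simps)
    also have "\<dots> = sqrt 2 * sqrt (\<theta> - c) / ((sqrt (\<theta> - c) * sqrt (\<theta> - c)) * (sqrt 2 * sqrt 2) * (sqrt (\<theta> - V x) / sqrt (\<theta> - c)))"
      using c by (simp add: w_def real_sqrt_divide)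
    also have "\<dots> = 1 / (sqrt 2 * sqrt (\<theta> - V x))"
    proof -
      have "D * S / ((S * S) * (D * D) * (K / S)) = 1 / (D * K)" if "S \<noteq> 0" "D \<noteq> 0" for D S K :: real
        using that by (simp add: divide_simps)
      from this[of "sqrt (\<theta> - c)" "sqrt 2"] show ?thesis using c by simp
    qed
    finally show "1 / sqrt (2 * (\<theta> - V x)) = \<Gamma> (w x) * (- deriv V x / (\<theta> - c) * (inverse (w x) / 2))"
      by (simp only: real_sqrt_mult)
  qed (use r in auto)
  moreover have "w r = 0" "w a = 1" using r c by (auto simp: w_def c_def)
  moreover have "integral {0..1} \<Gamma> = - (sqrt 2 * sqrt (\<theta> - c)) * abel_mean V c \<theta>"
    unfolding \<Gamma>_def abel_mean_def by (rule integral_mult_right)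
  ultimately show ?thesis by (simp add: r_def c_def)
qed

lemma continuous_on_travel_integrand:
  assumes V: "UM V" and A: "\<And>x. x \<in> A \<Longrightarrow> V x < \<theta>"
  shows "continuous_on A (\<lambda>q. 1 / sqrt (2 * (\<theta> - V q)))"
  using A by (intro continuous_intros UM_continuous_on V) (auto dest: A)

lemma UM_less_of_between: "UM V \<Longrightarrow> V a < \<theta> \<Longrightarrow> 0 \<le> x \<Longrightarrow> x \<le> a \<Longrightarrow> V x < \<theta>"
  using UM_strict_mono[of V x a] by (cases "x = a") auto

lemma travel_integrable:
  assumes V: "UM V" and \<theta>: "\<theta> > 0"
  shows "(\<lambda>q. 1 / sqrt (2 * (\<theta> - V q))) integrable_on {0..inv_pos V \<theta>}"
proof -
  define a where "a = inv_pos V (\<theta> / 2)"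
  have a: "a > 0" "V a < \<theta>" using V \<theta> by (auto simp: a_def inv_pos_pos V_inv_pos)
  have ar: "a < inv_pos V \<theta>" using a V \<theta> by (simp add: less_inv_pos_iff)
  show ?thesis
  proof (rule Henstock_Kurzweil_Integration.integrable_combine)
    show "(\<lambda>q. 1 / sqrt (2 * (\<theta> - V q))) integrable_on {0..a}"
      using UM_less_of_between[OF V a(2)] by (intro integrable_continuous_real continuous_on_travel_integrand V) auto
    show "(\<lambda>q. 1 / sqrt (2 * (\<theta> - V q))) integrable_on {a..inv_pos V \<theta>}"
      using has_integral_near_turning_point[OF V a] by blast
  qed (use a ar in auto)
qed

text \<open>This isolates the square-root singularity of the travel time to a wall:
  \<open>travel_time V a\<close> differs from the quarter period by
  \<open>sqrt (\<theta> - V a)\<close> times an Abel mean, and both the quarter period and the Abel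
  mean are analytic across \<open>\<theta> = V a\<close>.\<close>

lemma quarter_period_eq:
  assumes V: "UM V" and a: "a > 0" "V a < \<theta>"
  shows "quarter_period V \<theta> = travel_time V a \<theta> + sqrt 2 * sqrt (\<theta> - V a) * abel_mean V (V a) \<theta>"
proof -
  have \<theta>: "\<theta> > 0" using UM_pos[OF V, of a] a by linarith
  have ar: "a < inv_pos V \<theta>" using a V \<theta> by (simp add: less_inv_pos_iff)
  show ?thesis
    unfolding quarter_period_def travel_time_def
    using Henstock_Kurzweil_Integration.integral_combine[OF _ _ travel_integrable[OF V \<theta>], of a] a ar
      integral_unique[OF has_integral_near_turning_point[OF V a]] by simp
qed

lemma travel_time_0 [simp]: "travel_time V 0 \<theta> = 0"
  by (simp add: travel_time_def)

lemma real_analytic_at_travel_time: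
  assumes V: "UM V" and a: "a \<ge> 0" "V a < \<theta>"
  shows "real_analytic_at (travel_time V a) \<theta>"
proof -
  have "real_analytic_at (\<lambda>z. integral {0..a} (\<lambda>v. (\<lambda>u. 1 / sqrt (2 * u)) (- V v + z * 1))) \<theta>"
  proof (rule real_analytic_at_parametric_integral)
    fix v assume v: "v \<in> {0..a}"
    have pos: "- V v + \<theta> * 1 > 0" using UM_less_of_between[OF V a(2), of v] v by auto
    show "real_analytic_at (\<lambda>u. 1 / sqrt (2 * u)) (- V v + \<theta> * 1)"
      using pos by (intro real_analytic_at_divide real_analytic_at_const
          real_analytic_at_sqrt' real_analytic_at_mult real_analytic_at_ident) auto
  qed (use a in \<open>auto intro!: continuous_on_minus continuous_on_const UM_continuous_on[OF V]\<close>)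
  then show ?thesis by (simp add: travel_time_def[abs_def] algebra_simps)
qed

lemma real_analytic_at_abel_mean:
  assumes V: "UM V" and c: "c > 0" "\<theta> > 0"
  shows "real_analytic_at (abel_mean V c) \<theta>"
  unfolding abel_mean_def[abs_def]
  by (rule real_analytic_at_parametric_integral)
    (auto intro!: continuous_intros real_analytic_at_deriv real_analytic_at_inv_pos V convex_sq_pos c)

text \<open>The upper limit and the singularity move with the energy. Splitting at a fixed
  \<open>a\<close> with half the energy puts the moving end into an Abel mean over the fixed
  interval from 0 to 1.\<close>

lemma real_analytic_at_quarter_period:
  assumes V: "UM V" and \<theta>: "\<theta> > 0"
  shows "real_analytic_at (quarter_period V) \<theta>"
proof -
  define a where "a = inv_pos V (\<theta> / 2)"
  have a: "a > 0" "V a = \<theta> / 2" using V \<theta> by (auto simp: a_def inv_pos_pos V_inv_pos)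
  have "\<forall>\<^sub>F z in nhds \<theta>. z \<in> {V a<..}"
    using a \<theta> by (intro eventually_nhds_in_open) auto
  then have "\<forall>\<^sub>F z in nhds \<theta>. travel_time V a z + sqrt 2 * sqrt (z - V a) * abel_mean V (V a) z = quarter_period V z"
    by eventually_elim (use V a quarter_period_eq in auto)
  moreover have "real_analytic_at (\<lambda>z. travel_time V a z + sqrt 2 * sqrt (z - V a) * abel_mean V (V a) z) \<theta>"
    using a \<theta> by (intro real_analytic_at_add real_analytic_at_mult real_analytic_at_const
        real_analytic_at_sqrt' real_analytic_at_diff real_analytic_at_ident
        real_analytic_at_travel_time real_analytic_at_abel_mean V) auto
  ultimately show ?thesis by (rule real_analytic_at_cong[rotated])
qed

text \<open>The speed never exceeds \<open>sqrt (2 * \<theta>)\<close>.\<close>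

lemma quarter_period_lower_bound:
  assumes V: "UM V" and \<theta>: "\<theta> > 0"
  shows "quarter_period V \<theta> \<ge> inv_pos V \<theta> / sqrt (2 * \<theta>)"
proof -
  have r: "inv_pos V \<theta> > 0" using V \<theta> by (rule inv_pos_pos)
  \<comment> \<open>The turning point is removed because division by zero gives the integrand the
    value 0 there, which would violate the pointwise bound.\<close>
  have le: "1 / sqrt (2 * \<theta>) \<le> 1 / sqrt (2 * (\<theta> - V q))" if "q \<in> {0..inv_pos V \<theta>} - {inv_pos V \<theta>}" for q
  proof -
    have "V q < \<theta>" "V q \<ge> 0"
      using that less_inv_pos_iff[OF V, of q \<theta>] \<theta> V by (auto simp: UM_def)
    then show ?thesis by (intro divide_left_mono) auto
  qed
  have I: "((\<lambda>q. 1 / sqrt (2 * (\<theta> - V q))) has_integral quarter_period V \<theta>) ({0..inv_pos V \<theta>} - {inv_pos V \<theta>})"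
    unfolding quarter_period_def travel_time_def
    using integrable_integral[OF travel_integrable[OF V \<theta>]]
    by (subst has_integral_spike_set_eq[where T = "{0..inv_pos V \<theta>}"]) (auto intro: negligible_subset[of "{inv_pos V \<theta>}"])
  have J: "((\<lambda>q. 1 / sqrt (2 * \<theta>)) has_integral inv_pos V \<theta> / sqrt (2 * \<theta>)) ({0..inv_pos V \<theta>} - {inv_pos V \<theta>})"
    using has_integral_const_real[of "1 / sqrt (2 * \<theta>)" 0 "inv_pos V \<theta>"] r
    by (subst has_integral_spike_set_eq[where T = "{0..inv_pos V \<theta>}"]) (auto intro: negligible_subset[of "{inv_pos V \<theta>}"])
  show ?thesis using has_integral_le[OF J I le] .
qed

lemma quarter_period_pos:
  assumes V: "UM V" and \<theta>: "\<theta> > 0"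
  shows "quarter_period V \<theta> > 0"
  using quarter_period_lower_bound[OF assms] inv_pos_pos[OF assms] \<theta>
  by (meson divide_pos_pos less_le_trans mult_pos_pos real_sqrt_gt_zero zero_less_numeral)

text \<open>The sign makes this one increasing primitive of the reciprocal speed between the two
  turning points, vanishing at 0.\<close>

definition signed_time :: "(real \<Rightarrow> real) \<Rightarrow> real \<Rightarrow> real \<Rightarrow> real" where
  "signed_time V x \<theta> = (if x \<ge> 0 then travel_time V x \<theta> else - travel_time (refl_pot V) (- x) \<theta>)"

lemma real_analytic_at_signed_time:
  assumes V: "UM V" and a: "V a < \<theta>"
  shows "real_analytic_at (signed_time V a) \<theta>"
proof (cases "a \<ge> 0")
  case True
  with real_analytic_at_travel_time[OF V True a] show ?thesis
    by (simp add: signed_time_def[abs_def])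
next
  case False
  then have "real_analytic_at (\<lambda>\<theta>. - travel_time (refl_pot V) (- a) \<theta>) \<theta>"
    using a by (intro real_analytic_at_minus real_analytic_at_travel_time UM_refl_pot V) (auto simp: refl_pot_def)
  with False show ?thesis by (simp add: signed_time_def[abs_def])
qed

text \<open>Both branches of \<open>signed_time\<close> are \<open>J y - J 0\<close> for one
  integral \<open>J\<close> with a base point \<open>u\<close> to the left of both \<open>x\<close>
  and 0, so the point 0 needs no separate treatment.\<close>

lemma DERIV_signed_time:
  assumes V: "UM V" and x: "V x < \<theta>"
  shows "((\<lambda>x. signed_time V x \<theta>) has_real_derivative 1 / sqrt (2 * (\<theta> - V x))) (at x)"
proof -
  define f where "f q = 1 / sqrt (2 * (\<theta> - V q))" for q
  have \<theta>: "\<theta> > 0" using x V by (auto simp: UM_def intro: le_less_trans)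
  have lr: "inv_pos (refl_pot V) \<theta> > 0" "inv_pos V \<theta> > 0"
    using V \<theta> by (auto intro: inv_pos_pos UM_refl_pot)
  obtain u where u: "- inv_pos (refl_pot V) \<theta> < u" "u < x" "u < 0"
    using x lr dense[of "- inv_pos (refl_pot V) \<theta>" "min x 0"]
    unfolding UM_less_iff_between[OF V less_imp_le[OF \<theta>]] by auto
  obtain u' where u': "u' < inv_pos V \<theta>" "x < u'" "0 < u'"
    using x lr dense[of "max x 0" "inv_pos V \<theta>"]
    unfolding UM_less_iff_between[OF V less_imp_le[OF \<theta>]] by auto
  have lt: "V q < \<theta>" if "q \<in> {u..u'}" for q
    using that u u' unfolding UM_less_iff_between[OF V less_imp_le[OF \<theta>]] by auto
  have cf: "continuous_on {u..u'} f"
    unfolding f_def using lt by (intro continuous_on_travel_integrand V)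
  then have fi: "f integrable_on {u..u'}" by (rule integrable_continuous_real)
  define J where "J y = integral {u..y} f" for y
  have sJ: "J y - J 0 = signed_time V y \<theta>" if y: "y \<in> {u<..<u'}" for y
  proof (cases "y \<ge> 0")
    case True
    have "f integrable_on {u..y}" using fi y by (auto intro: integrable_on_subinterval)
    from Henstock_Kurzweil_Integration.integral_combine[OF _ True this] u
    show ?thesis using True by (simp add: J_def signed_time_def travel_time_def f_def[abs_def])
  next
    case False
    have "f integrable_on {u..0}" using fi u' by (auto intro: integrable_on_subinterval)
    from Henstock_Kurzweil_Integration.integral_combine[OF _ _ this, of y] y False
    have "J y - J 0 = - integral {y..0} f" by (simp add: J_def)
    also have "integral {y..0} f = integral {-0..-y} (\<lambda>q. f (- q))"
      by (simp only: Henstock_Kurzweil_Integration.integral_reflect_real)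
    finally show ?thesis using False
      by (simp add: signed_time_def travel_time_def f_def[abs_def] refl_pot_def)
  qed
  have "(J has_real_derivative f x) (at x within {u..u'})"
    unfolding J_def[abs_def] using u u' by (intro integral_has_real_derivative cf) auto
  then have "(J has_real_derivative f x) (at x)"
    using u u' at_within_interior[of x "{u..u'}"] by (auto simp: interior_atLeastAtMost_real)
  then have "((\<lambda>y. J y - J 0) has_real_derivative f x) (at x)"
    by (auto intro!: derivative_eq_intros)
  moreover have "\<forall>\<^sub>F y in nhds x. y \<in> {u<..<u'}"
    using u u' by (intro eventually_nhds_in_open) auto
  then have "\<forall>\<^sub>F y in nhds x. J y - J 0 = signed_time V y \<theta>"
    by eventually_elim (rule sJ)
  ultimately show ?thesis
    unfolding f_def by (subst (asm) DERIV_cong_ev[OF refl _ refl]) auto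
qed

lemma continuous_on_signed_time:
  assumes V: "UM V" and \<theta>: "\<theta> > 0"
  shows "continuous_on {- inv_pos (refl_pot V) \<theta>..inv_pos V \<theta>} (\<lambda>x. signed_time V x \<theta>)"
proof -
  have cont: "continuous_on {0..inv_pos V \<theta>} (\<lambda>x. travel_time V x \<theta>)" if "UM V" for V
    unfolding travel_time_def by (rule indefinite_integral_continuous_1[OF travel_integrable[OF that \<theta>]])
  have c2: "continuous_on {- inv_pos (refl_pot V) \<theta>..0} (\<lambda>x. - travel_time (refl_pot V) (- x) \<theta>)"
    by (rule continuous_on_minus, rule continuous_on_compose2[OF cont[OF UM_refl_pot[OF V]]])
      (auto intro!: continuous_intros)
  have "continuous_on ({0..inv_pos V \<theta>} \<union> {- inv_pos (refl_pot V) \<theta>..0}) (\<lambda>x. signed_time V x \<theta>)"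
    unfolding signed_time_def
    by (rule continuous_on_cases[OF _ _ cont[OF V] c2]) auto
  moreover have "{0..inv_pos V \<theta>} \<union> {- inv_pos (refl_pot V) \<theta>..0} = {- inv_pos (refl_pot V) \<theta>..inv_pos V \<theta>}"
    using inv_pos_nonneg[OF V, of \<theta>] inv_pos_nonneg[OF UM_refl_pot[OF V], of \<theta>] \<theta> by auto
  ultimately show ?thesis by simp
qed

lemma signed_time_turning_points:
  assumes "UM V" "\<theta> > 0"
  shows "signed_time V (inv_pos V \<theta>) \<theta> = quarter_period V \<theta>"
    and "signed_time V (- inv_pos (refl_pot V) \<theta>) \<theta> = - quarter_period (refl_pot V) \<theta>"
  using inv_pos_pos[OF assms] inv_pos_pos[OF UM_refl_pot[OF assms(1)] assms(2)]
  by (auto simp: signed_time_def quarter_period_def)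

section \<open>Elimination of thresholds\<close>

text \<open>If \<open>h\<close> had no zeros in a punctured neighbourhood of \<open>c\<close>, then
  for \<open>\<theta>\<close> slightly above \<open>c\<close> the integrand of the difference of the
  two sides would have a constant sign and a nonzero integral. So zeros of \<open>h\<close>
  accumulate at \<open>c\<close>, and the identity theorem extends \<open>h = 0\<close> to all
  positive energies.\<close>

lemma abel_mean_injective:
  assumes V: "UM V" "UM W" and c: "c > 0" and \<delta>: "\<delta> > 0"
    and eq: "\<And>\<theta>. c < \<theta> \<Longrightarrow> \<theta> < c + \<delta> \<Longrightarrow> p * abel_mean V c \<theta> = q * abel_mean W c \<theta>"
    and s: "s > 0"
  shows "p * deriv (inv_pos V) s = q * deriv (inv_pos W) s"
proof -
  define h where "h s = p * deriv (inv_pos V) s - q * deriv (inv_pos W) s" for s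
  have h: "real_analytic_at h s" if "s > 0" for s
    unfolding h_def using V that
    by (intro real_analytic_at_diff real_analytic_at_mult real_analytic_at_const real_analytic_at_deriv
        real_analytic_at_inv_pos)
  have lim: "c islimpt {s. h s = 0}"
  proof (rule ccontr)
    assume "\<not> c islimpt {s. h s = 0}"
    then obtain e where e: "e > 0" "\<And>s. s \<noteq> c \<Longrightarrow> dist s c < e \<Longrightarrow> h s \<noteq> 0"
      unfolding islimpt_approachable by blast
    define \<theta> where "\<theta> = c + min e \<delta> / 2"
    have \<theta>: "c < \<theta>" "\<theta> < c + \<delta>" "\<theta> < c + e" "\<theta> > 0"
      using e(1) \<delta> c by (auto simp: \<theta>_def min_def)
    define f where "f v = h (c * v\<^sup>2 + \<theta> * (1 - v\<^sup>2))" for v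
    have cont: "continuous_on {0..1} f"
      unfolding f_def h_def
      by (intro continuous_intros continuous_on_abel_integrand V c \<theta>)
    have nz: "f v \<noteq> 0" if "v \<in> {0<..<1}" for v
    proof -
      have v: "0 < v\<^sup>2" "v\<^sup>2 < 1" using that by (auto simp: power_less_one_iff)
      have e1: "c * v\<^sup>2 + \<theta> * (1 - v\<^sup>2) - c = (\<theta> - c) * (1 - v\<^sup>2)" by (simp add: algebra_simps)
      have "(\<theta> - c) * (1 - v\<^sup>2) > 0" using v \<theta> by simp
      moreover have "(\<theta> - c) * (1 - v\<^sup>2) < (\<theta> - c) * 1" using v \<theta> by (intro mult_strict_left_mono) auto
      ultimately show ?thesis
        unfolding f_def using \<theta>(3) e1 by (intro e(2)) (auto simp: dist_real_def)
    qed
    have I: "integral {0..1} f = p * abel_mean V c \<theta> - q * abel_mean W c \<theta>"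
      unfolding f_def h_def abel_mean_def
      by (subst Henstock_Kurzweil_Integration.integral_diff)
        (auto intro!: integrable_continuous_real continuous_on_mult_left continuous_on_abel_integrand V c \<theta>)
    have con: "connected (f ` {0<..<1})"
      using cont by (intro connected_continuous_image) (auto elim: continuous_on_subset)
    have "(\<forall>v\<in>{0<..<1}. f v > 0) \<or> (\<forall>v\<in>{0<..<1}. f v < 0)"
    proof (rule ccontr)
      assume "\<not> ?thesis"
      then obtain u v where uv: "u \<in> {0<..<1}" "f u \<le> 0" "v \<in> {0<..<1}" "f v \<ge> 0"
        by (auto simp: not_less)
      then have "0 \<in> f ` {0<..<1}"
        using connectedD_interval[OF con, of "f u" "f v" 0] by auto
      with nz show False by auto
    qed
    then have "integral {0..1} f \<noteq> 0"
      using integral_less_real[OF continuous_on_const[of _ 0] cont]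
        integral_less_real[OF cont continuous_on_const[of _ 0]] by auto
    with I eq[OF \<theta>(1,2)] show False by simp
  qed
  have "h s = 0"
    by (rule real_analytic_identity[OF _ _ _ _ lim, of "{0<..}"]) (use h c s in simp_all)
  then show ?thesis by (simp add: h_def)
qed

text \<open>Injectivity gives a linear relation between the derivatives of the two inverse
  functions, and then between these functions themselves because both tend to 0 at energy 0. With
  nonzero coefficients it reads \<open>V (l * y) = V (- y)\<close> for \<open>y > 0\<close> and, by
  analyticity, for all real \<open>y\<close>; applying it twice forces \<open>l = 1\<close>, that
  is, an even potential.\<close>

lemma abel_mean_reflection_dependent:
  assumes V: "UM V" and c: "c > 0" and \<delta>: "\<delta> > 0"
    and eq: "\<And>\<theta>. c < \<theta> \<Longrightarrow> \<theta> < c + \<delta> \<Longrightarrow> p * abel_mean V c \<theta> = q * abel_mean (refl_pot V) c \<theta>"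
  shows "(p = 0 \<and> q = 0) \<or> (p = q \<and> refl_pot V = V)"
proof -
  define W where "W = refl_pot V"
  have W: "UM W" using V by (simp add: W_def UM_refl_pot)
  define d where "d s = p * inv_pos V s - q * inv_pos W s" for s
  have "(d has_real_derivative 0) (at s within {0<..})" if "s \<in> {0<..}" for s
  proof -
    have D: "(inv_pos U has_real_derivative deriv (inv_pos U) s) (at s)" if "UM U" for U
      using that \<open>s \<in> {0<..}\<close> by (intro real_analytic_at_DERIV real_analytic_at_inv_pos) auto
    have "(d has_real_derivative p * deriv (inv_pos V) s - q * deriv (inv_pos W) s) (at s)"
      unfolding d_def[abs_def] using DERIV_diff[OF DERIV_cmult[OF D[OF V]] DERIV_cmult[OF D[OF W]]] .
    moreover have "p * deriv (inv_pos V) s - q * deriv (inv_pos W) s = 0"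
      using abel_mean_injective[OF V W c \<delta>, of p q s] eq that by (simp add: W_def)
    ultimately show ?thesis by (metis has_field_derivative_at_within)
  qed
  then have "\<exists>C. \<forall>s\<in>{0<..}. d s = C"
    by (intro has_field_derivative_zero_constant) auto
  then obtain C where C: "\<And>s. s > 0 \<Longrightarrow> d s = C" by auto
  have "C = 0"
  proof (rule ccontr)
    assume "C \<noteq> 0"
    \<comment> \<open>Where both inverse functions stay below this \<open>y\<close>, their
      combination \<open>d s\<close> is smaller than \<open>\<bar>C\<bar>\<close> in absolute
      value.\<close>
    define y where "y = \<bar>C\<bar> / (2 * (\<bar>p\<bar> + \<bar>q\<bar> + 1))"
    have y: "y > 0" using \<open>C \<noteq> 0\<close> by (simp add: y_def field_simps)
    define s where "s = min (V y) (W y) / 2"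
    have Vy: "V y > 0" "W y > 0" using V W y by (auto simp: UM_pos)
    have s: "s > 0" "s < V y" "s < W y" using Vy by (auto simp: s_def)
    have g: "0 < inv_pos U s" "inv_pos U s < y" if "UM U" "s < U y" for U
      using that s(1) y less_inv_pos_iff[OF that(1), of y s] UM_less_iff[OF that(1), of "inv_pos U s" y]
      by (auto simp: inv_pos_pos V_inv_pos inv_pos_nonneg)
    have "\<bar>C\<bar> \<le> \<bar>p\<bar> * inv_pos V s + \<bar>q\<bar> * inv_pos W s"
      using C[OF s(1)] g(1)[OF V s(2)] g(1)[OF W s(3)] abs_triangle_ineq4[of "p * inv_pos V s" "q * inv_pos W s"]
      by (simp add: d_def abs_mult)
    also have "\<dots> \<le> \<bar>p\<bar> * y + \<bar>q\<bar> * y"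
      using g(2)[OF V s(2)] g(2)[OF W s(3)] by (intro add_mono mult_left_mono) auto
    also have "\<dots> < 2 * (\<bar>p\<bar> + \<bar>q\<bar> + 1) * y"
    proof -
      have "\<bar>p\<bar> * y \<ge> 0" "\<bar>q\<bar> * y \<ge> 0" using y by auto
      moreover have "2 * (\<bar>p\<bar> + \<bar>q\<bar> + 1) * y = 2 * (\<bar>p\<bar> * y) + 2 * (\<bar>q\<bar> * y) + 2 * y"
        by (simp add: algebra_simps)
      ultimately show ?thesis using y by linarith
    qed
    also have "\<dots> = \<bar>C\<bar>" by (simp add: y_def)
    finally show False by simp
  qed
  with C have gk: "p * inv_pos V s = q * inv_pos W s" if "s > 0" for s
    using that by (simp add: d_def)
  have pos: "inv_pos V 1 > 0" "inv_pos W 1 > 0" using V W by (auto intro: inv_pos_pos)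
  show ?thesis
  proof (cases "p = 0 \<or> q = 0")
    case True
    then show ?thesis using gk[of 1] pos by auto
  next
    case False
    define l where "l = q / p"
    have gk': "inv_pos V s = l * inv_pos W s" if "s > 0" for s
      using gk[OF that] False by (simp add: l_def field_simps)
    have l: "l > 0" using gk'[of 1] pos by (simp add: zero_less_mult_iff)
    have eq0: "V (l * y) - V (- y) = 0" if "y > 0" for y
    proof -
      have "W y > 0" using W that by (simp add: UM_pos)
      then have "V (inv_pos V (W y)) = W y" using V by (simp add: V_inv_pos)
      moreover have "inv_pos V (W y) = l * y"
        using gk'[OF \<open>W y > 0\<close>] W that by (simp add: inv_pos_eq)
      ultimately show ?thesis by (simp add: W_def refl_pot_def)
    qed
    have an: "real_analytic_at (\<lambda>y. V (l * y) - V (- y)) x" for x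
      by (intro real_analytic_at_diff real_analytic_at_compose[OF _ UM_real_analytic_at[OF V]] real_analytic_at_mult
          real_analytic_at_minus real_analytic_at_const real_analytic_at_ident)
    have lim: "(1::real) islimpt {0<..}" by (intro interior_limit_point) (auto simp: interior_open)
    have all: "V (l * y) = V (- y)" for y
      using real_analytic_identity[OF open_UNIV connected_UNIV an UNIV_I lim eq0 UNIV_I, of y] by simp
    \<comment> \<open>Both values are equal to \<open>V (- l)\<close>.\<close>
    have "V (l * l) = V 1" using all[of l] all[of "-1"] by simp
    then have "l * l = 1" using UM_eq_iff[OF V, of "l * l" 1] l by simp
    then have "l = 1" using l square_eq_1_iff[of l] by auto
    with all False show ?thesis by (auto simp: l_def fun_eq_iff refl_pot_def)
  qed
qed

text \<open>Setting \<open>\<theta> = c + r\<^sup>2\<close> turns the root into the analytic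
  variable \<open>r\<close>, whose sign can be reversed while \<open>K\<close> and \<open>M\<close>
  keep their values.\<close>

lemma sqrt_singularity_vanishes:
  fixes c \<delta> :: real
  assumes K: "real_analytic_at K c" and M: "real_analytic_at M c" and \<delta>: "\<delta> > 0"
    and eq: "\<And>\<theta>. c < \<theta> \<Longrightarrow> \<theta> < c + \<delta> \<Longrightarrow> sqrt (\<theta> - c) * K \<theta> = M \<theta>"
  obtains \<epsilon> where "\<epsilon> > 0" "\<And>\<theta>. c < \<theta> \<Longrightarrow> \<theta> < c + \<epsilon> \<Longrightarrow> K \<theta> = 0"
proof -
  define D where "D r = r * K (c + r\<^sup>2) - M (c + r\<^sup>2)" for r
  have sq: "real_analytic_at (\<lambda>r. c + r\<^sup>2) 0"
    by (intro real_analytic_at_add real_analytic_at_power real_analytic_at_const real_analytic_at_ident)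
  have D: "real_analytic_at D 0"
    unfolding D_def using K M
    by (intro real_analytic_at_diff real_analytic_at_mult real_analytic_at_ident real_analytic_at_compose[OF sq]) auto
  \<comment> \<open>\<open>D\<close> is analytic, hence vanishes for negative \<open>r\<close> too; the two signs give \<open>r K = M = - r K\<close>.\<close>
  have z: "D r = 0" if "r \<in> {0<..<sqrt \<delta>}" for r
  proof -
    have "r\<^sup>2 < (sqrt \<delta>)\<^sup>2" using that by (intro power_strict_mono) auto
    then have "r\<^sup>2 < \<delta>" using \<delta> by simp
    then show ?thesis using eq[of "c + r\<^sup>2"] that by (simp add: D_def)
  qed
  have "(0::real) islimpt {0<..<sqrt \<delta>}"
    using \<delta> by (simp add: islimpt_greaterThanLessThan1)
  from real_analytic_at_eventually_zero[OF D this z] obtain e where e: "e > 0" "\<And>r. \<bar>r\<bar> < e \<Longrightarrow> D r = 0"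
    unfolding eventually_nhds_metric by (auto simp: dist_real_def)
  show thesis
  proof (rule that[of "e\<^sup>2"])
    fix \<theta> assume \<theta>: "c < \<theta>" "\<theta> < c + e\<^sup>2"
    define r where "r = sqrt (\<theta> - c)"
    have r: "r > 0" "r\<^sup>2 = \<theta> - c" using \<theta> by (auto simp: r_def)
    have "r\<^sup>2 < e\<^sup>2" using \<theta> r(2) by simp
    then have "r < e" by (rule power2_less_imp_less) (use e(1) in simp)
    then have "D r = 0" "D (- r) = 0" using r(1) by (auto intro!: e(2))
    then have "r * K \<theta> = M \<theta>" "- r * K \<theta> = M \<theta>" by (simp_all add: D_def r(2))
    then have "r * K \<theta> = 0" by simp
    then show "K \<theta> = 0" using r(1) by simp
  qed (use e in auto)
qed

text \<open>Induction on the set of walls, removing those with the highest threshold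
  \<open>c\<close>. Above \<open>c\<close> the travel times to these walls are rewritten as quarter
  periods minus root terms; all other terms are analytic at \<open>c\<close>, so the root terms must
  cancel. Without these walls the identity continues analytically below \<open>c\<close>, down to
  the next threshold.\<close>

lemma threshold_elimination:
  assumes V: "UM V" and "finite A" "0 \<notin> A" "\<beta> > 0" "\<And>a. a \<in> A \<Longrightarrow> V a < \<beta>"
    and B: "\<And>\<theta>. \<theta> > 0 \<Longrightarrow> real_analytic_at B \<theta>"
    and M: "\<And>\<theta>. 0 < \<theta> \<Longrightarrow> \<theta> < \<beta> \<Longrightarrow> real_analytic_at M \<theta>"
    and eq: "\<And>\<theta>. 0 < \<theta> \<Longrightarrow> \<theta> < \<beta> \<Longrightarrow> (\<And>a. a \<in> A \<Longrightarrow> V a < \<theta>) \<Longrightarrow>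
        B \<theta> + (\<Sum>a\<in>A. n a * signed_time V a \<theta>) = M \<theta>"
    and \<theta>: "0 < \<theta>" "\<theta> < \<beta>"
  shows "B \<theta> = M \<theta>"
  using assms(2,3,5) eq
proof (induction A rule: finite_psubset_induct)
  case (psubset A)
  show ?case
  proof (cases "A = {}")
    case True
    then show ?thesis using psubset.prems(3)[OF \<theta>] by simp
  next
    case False
    define c where "c = Max (V ` A)"
    have c_ge: "V a \<le> c" if "a \<in> A" for a
      using that psubset.hyps by (simp add: c_def)
    have "c \<in> V ` A"
      unfolding c_def using False psubset.hyps by (intro Max_in) auto
    then obtain a0 where a0: "a0 \<in> A" "V a0 = c" by blast
    have "a0 \<noteq> 0" using a0 psubset.prems(1) by auto
    then have c: "0 < c" "c < \<beta>"
      using UM_pos[OF V, of a0] a0 psubset.prems(2)[of a0] by auto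
    define A' where "A' = {a \<in> A. V a < c}"
    define Ac where "Ac = {a \<in> A. V a = c}"
    have A: "A = A' \<union> Ac" "A' \<inter> Ac = {}" "finite A'" "finite Ac"
      using c_ge psubset.hyps by (force simp: A'_def Ac_def)+
    define W where "W = refl_pot V"
    have W: "UM W" using V by (simp add: W_def UM_refl_pot)
    define b b' where "b = inv_pos V c" and "b' = inv_pos W c"
    have b: "b > 0" "V b = c" "b' > 0" "W b' = c"
      using V W c by (auto simp: b_def b'_def inv_pos_pos V_inv_pos)
    define p q where "p = (if b \<in> A then n b else 0)" and "q = (if - b' \<in> A then n (- b') else 0)"
    have Ac_sub: "Ac \<subseteq> {b, - b'}"
      using UM_eq_cases[OF V less_imp_le[OF c(1)]] by (auto simp: Ac_def b_def b'_def W_def)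
    have Sc: "(\<Sum>a\<in>Ac. n a * signed_time V a \<theta>) = p * travel_time V b \<theta> - q * travel_time W b' \<theta>" for \<theta>
    proof -
      have bAc: "b \<in> Ac \<longleftrightarrow> b \<in> A" "- b' \<in> Ac \<longleftrightarrow> - b' \<in> A"
        using b by (auto simp: Ac_def W_def refl_pot_def)
      have "(\<Sum>a\<in>Ac. n a * signed_time V a \<theta>) = (\<Sum>a\<in>{b, - b'}. if a \<in> Ac then n a * signed_time V a \<theta> else 0)"
        using Ac_sub by (intro sum.mono_neutral_cong_left) auto
      also have "\<dots> = p * signed_time V b \<theta> + q * signed_time V (- b') \<theta>"
        using b bAc by (simp add: p_def q_def)
      finally show ?thesis using b by (simp add: signed_time_def W_def)
    qed
    define Q where "Q \<theta> = B \<theta> + (\<Sum>a\<in>A'. n a * signed_time V a \<theta>)" for \<theta>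
    have Q: "real_analytic_at Q \<theta>" if "\<theta> > 0" "\<And>a. a \<in> A' \<Longrightarrow> V a < \<theta>" for \<theta>
      unfolding Q_def using that
      by (intro real_analytic_at_add B real_analytic_at_sum real_analytic_at_mult real_analytic_at_const
          real_analytic_at_signed_time V) auto
    have Q_eq: "Q \<theta> + (p * travel_time V b \<theta> - q * travel_time W b' \<theta>) = M \<theta>" if "c < \<theta>" "\<theta> < \<beta>" for \<theta>
    proof -
      have "V a < \<theta>" if "a \<in> A" for a using c_ge[OF that] \<open>c < \<theta>\<close> by simp
      with psubset.prems(3)[of \<theta>] that c have "B \<theta> + (\<Sum>a\<in>A. n a * signed_time V a \<theta>) = M \<theta>" by auto
      moreover have "(\<Sum>a\<in>A. n a * signed_time V a \<theta>) =
          (\<Sum>a\<in>A'. n a * signed_time V a \<theta>) + (\<Sum>a\<in>Ac. n a * signed_time V a \<theta>)"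
        by (subst A(1)) (rule sum.union_disjoint[OF A(3,4,2)])
      ultimately show ?thesis unfolding Sc Q_def by simp
    qed
    define K where "K \<theta> = sqrt 2 * (p * abel_mean V c \<theta> - q * abel_mean W c \<theta>)" for \<theta>
    define R where "R \<theta> = Q \<theta> + p * quarter_period V \<theta> - q * quarter_period W \<theta> - M \<theta>" for \<theta>
    have K: "real_analytic_at K c"
      unfolding K_def using V W c
      by (intro real_analytic_at_mult real_analytic_at_diff real_analytic_at_const real_analytic_at_abel_mean)
    have R: "real_analytic_at R c"
      unfolding R_def using V W c
      by (intro real_analytic_at_mult real_analytic_at_diff real_analytic_at_add real_analytic_at_const
          real_analytic_at_quarter_period Q M) (auto simp: A'_def)
    have KR: "sqrt (\<theta> - c) * K \<theta> = R \<theta>" if "c < \<theta>" "\<theta> < c + (\<beta> - c)" for \<theta>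
    proof -
      have "quarter_period V \<theta> = travel_time V b \<theta> + sqrt 2 * sqrt (\<theta> - c) * abel_mean V c \<theta>"
        "quarter_period W \<theta> = travel_time W b' \<theta> + sqrt 2 * sqrt (\<theta> - c) * abel_mean W c \<theta>"
        using quarter_period_eq[OF V, of b \<theta>] quarter_period_eq[OF W, of b' \<theta>] b that by auto
      then show ?thesis
        using Q_eq[of \<theta>] that unfolding K_def R_def by (simp add: algebra_simps)
    qed
    have \<beta>c: "\<beta> - c > 0" using c by simp
    obtain \<epsilon> where \<epsilon>: "\<epsilon> > 0" "\<And>\<theta>. c < \<theta> \<Longrightarrow> \<theta> < c + \<epsilon> \<Longrightarrow> K \<theta> = 0"
      using sqrt_singularity_vanishes[OF K R \<beta>c KR] by blast
    have "p * abel_mean V c \<theta> = q * abel_mean (refl_pot V) c \<theta>" if "c < \<theta>" "\<theta> < c + \<epsilon>" for \<theta>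
      using \<epsilon>(2)[OF that] by (simp add: K_def W_def)
    from abel_mean_reflection_dependent[OF V c(1) \<epsilon>(1) this]
    have "(p = 0 \<and> q = 0) \<or> (p = q \<and> W = V)" by (simp add: W_def)
    \<comment> \<open>If \<open>p = q\<close> and \<open>V\<close> is even, then
      \<open>b = b'\<close> and the two contributions, which have opposite signs, cancel.\<close>
    then have cancel: "p * travel_time V b \<theta> - q * travel_time W b' \<theta> = 0" for \<theta>
      by (auto simp: b_def b'_def)
    then have QM: "Q \<theta> - M \<theta> = 0" if "\<theta> \<in> {c<..<\<beta>}" for \<theta>
      using Q_eq[of \<theta>] that by simp
    \<comment> \<open>This is the next threshold below \<open>c\<close>, or 0 if there is none;
      above it both sides stay analytic.\<close>
    define m where "m = Max (insert 0 (V ` A'))"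
    have m: "0 \<le> m" "\<And>a. a \<in> A' \<Longrightarrow> V a \<le> m" "m < c"
      using A(3) c by (auto simp: m_def A'_def)
    have "B \<theta> + (\<Sum>a\<in>A'. n a * signed_time V a \<theta>) = M \<theta>"
      if "0 < \<theta>" "\<theta> < \<beta>" "\<And>a. a \<in> A' \<Longrightarrow> V a < \<theta>" for \<theta>
    proof -
      have \<theta>m: "\<theta> \<in> {m<..<\<beta>}" using that A(3) by (auto simp: m_def)
      have "Q \<theta> - M \<theta> = 0"
      proof (rule real_analytic_identity[of "{m<..<\<beta>}" "\<lambda>\<theta>. Q \<theta> - M \<theta>" "(c + \<beta>) / 2" "{c<..<\<beta>}"])
        show "real_analytic_at (\<lambda>\<theta>. Q \<theta> - M \<theta>) x" if "x \<in> {m<..<\<beta>}" for x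
          using that m by (intro real_analytic_at_diff Q M) (auto intro: le_less_trans)
        show "(c + \<beta>) / 2 islimpt {c<..<\<beta>}"
          using c by (intro interior_limit_point) (auto simp: interior_open)
      qed (use \<theta>m QM m c in auto)
      then show ?thesis by (simp add: Q_def)
    qed
    moreover have "A' \<subset> A" using a0 by (auto simp: A'_def)
    ultimately show ?thesis
      using psubset.IH[of A'] psubset.prems(1,2) by (auto simp: A'_def)
  qed
qed

section \<open>Duration of a trajectory\<close>

text \<open>
  \<open>t\<close> is, modulo \<open>R\<close>, the signed travel time to the present position. At a turning point both
  the value needed to stop there and the one needed to move on are required.
\<close>

definition phase_inv :: "(real \<Rightarrow> real) \<Rightarrow> real \<Rightarrow> real set \<Rightarrow> real \<Rightarrow> real \<Rightarrow> real \<Rightarrow> bool" where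
  "phase_inv V \<theta> R t x p \<longleftrightarrow>
     (if p = 0 then t \<in> R \<and> t + \<bar>signed_time V x \<theta>\<bar> \<in> R else t - sgn p * signed_time V x \<theta> \<in> R)"

lemma UM_turning_point_cases:
  assumes V: "UM V" and \<theta>: "\<theta> > 0" and x: "V x = \<theta>"
  shows "(x = inv_pos V \<theta> \<and> x > 0 \<and> sgn x * signed_time V x \<theta> = quarter_period V \<theta>) \<or>
    (x = - inv_pos (refl_pot V) \<theta> \<and> x < 0 \<and> sgn x * signed_time V x \<theta> = quarter_period (refl_pot V) \<theta>)"
  using UM_eq_cases[OF V less_imp_le[OF \<theta>] x] signed_time_turning_points[OF V \<theta>]
    inv_pos_pos[OF V \<theta>] inv_pos_pos[OF UM_refl_pot[OF V] \<theta>] by auto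

lemma turning_point_travel_time:
  assumes V: "UM V" and \<theta>: "\<theta> > 0" and x: "V x = \<theta>"
  shows "\<bar>signed_time V x \<theta>\<bar> \<in> {quarter_period V \<theta>, quarter_period (refl_pot V) \<theta>}"
    and "sgn x * signed_time V x \<theta> = \<bar>signed_time V x \<theta>\<bar>"
  using UM_turning_point_cases[OF assms] quarter_period_pos[OF V \<theta>] quarter_period_pos[OF UM_refl_pot[OF V] \<theta>]
  by auto

lemma UM_le_between:
  assumes V: "UM V" and \<theta>: "\<theta> > 0" and x: "V x \<le> \<theta>"
  shows "x \<in> {- inv_pos (refl_pot V) \<theta>..inv_pos V \<theta>}"
proof (cases "V x = \<theta>")
  case True
  then show ?thesis
    using UM_turning_point_cases[OF V \<theta> True] inv_pos_pos[OF V \<theta>] inv_pos_pos[OF UM_refl_pot[OF V] \<theta>] by auto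
next
  case False
  then show ?thesis using x UM_less_iff_between[OF V less_imp_le[OF \<theta>], of x] by auto
qed

section \<open>One coordinate of the motion between reflections\<close>

context
  fixes V :: "real \<Rightarrow> real" and \<theta> a b :: real and x p :: "real \<Rightarrow> real"
  assumes V: "UM V" and \<theta>: "\<theta> > 0"
    and dx: "\<And>t. t \<in> {a..b} \<Longrightarrow> (x has_real_derivative p t) (at t within {a..b})"
    and dp: "\<And>t. t \<in> {a..b} \<Longrightarrow> (p has_real_derivative - deriv V (x t)) (at t within {a..b})"
    and energy: "\<And>t. t \<in> {a..b} \<Longrightarrow> (p t)\<^sup>2 / 2 + V (x t) = \<theta>"
begin

text \<open>Where the momentum has the sign \<open>e\<close>, the signed travel time of the position
  changes at the rate \<open>e\<close>. At the ends, where the momentum may vanish, continuity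
  suffices.\<close>

lemma signed_time_along_arc:
  assumes cd: "a \<le> c" "c \<le> d" "d \<le> b" and e: "\<bar>e\<bar> = 1" and pos: "\<And>t. c < t \<Longrightarrow> t < d \<Longrightarrow> e * p t > 0"
  shows "d - e * signed_time V (x d) \<theta> = c - e * signed_time V (x c) \<theta>"
proof (cases "c = d")
  case False
  with cd have "c < d" by simp
  then show ?thesis
  proof (rule DERIV_isconst_end)
    have "continuous_on {a..b} x" using dx by (rule DERIV_continuous_on)
    then have cx: "continuous_on {c..d} x" by (rule continuous_on_subset) (use cd in auto)
    have "V (x t) \<le> \<theta>" if "t \<in> {c..d}" for t
      using energy[of t] that cd zero_le_power2[of "p t"] by auto
    then show "continuous_on {c..d} (\<lambda>t. t - e * signed_time V (x t) \<theta>)"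
      by (intro continuous_intros continuous_on_compose2[OF continuous_on_signed_time[OF V \<theta>] cx] image_subsetI UM_le_between[OF V \<theta>])
    fix t assume t: "c < t" "t < d"
    have tab: "t \<in> {a..b}" using t cd by auto
    have dxt: "(x has_real_derivative p t) (at t)"
      using dx[OF tab] at_within_interior[of t "{a..b}"] t cd by (auto simp: interior_atLeastAtMost_real)
    have pt: "p t \<noteq> 0" using pos[OF t] by auto
    have p2: "2 * (\<theta> - V (x t)) = (p t)\<^sup>2" using energy[OF tab] by (simp add: field_simps)
    from p2 pt have "2 * (\<theta> - V (x t)) > 0" by simp
    then have "V (x t) < \<theta>" by simp
    note D = DERIV_chain2[OF DERIV_signed_time[OF V this] dxt]
    have "((\<lambda>t. signed_time V (x t) \<theta>) has_real_derivative sgn (p t)) (at t)"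
    proof -
      have "1 / \<bar>p t\<bar> * p t = sgn (p t)" using pt by (auto simp: abs_if sgn_real_def)
      then show ?thesis using D unfolding p2 by simp
    qed
    moreover have "sgn (p t) = e"
      using e pos[OF t] by (auto simp: abs_if sgn_real_def zero_less_mult_iff split: if_splits)
    ultimately have "((\<lambda>t. t - e * signed_time V (x t) \<theta>) has_real_derivative 1 - e * e) (at t)"
      by (auto intro!: derivative_eq_intros)
    moreover have "e * e = 1" using e by (metis abs_mult_self_eq mult_1)
    ultimately show "((\<lambda>t. t - e * signed_time V (x t) \<theta>) has_real_derivative 0) (at t)" by simp
  qed
qed simp

text \<open>Bisection in time reduces the claim to a neighbourhood of each instant. If the momentum
  is nonzero there, its sign is locally constant. If it vanishes, the particle is at a turning
  point, where the force is nonzero, so the momentum changes sign there and nowhere else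
  nearby.\<close>

lemma phase_inv_along_arc:
  assumes R: "\<And>\<rho>. \<rho> \<in> R \<Longrightarrow> \<rho> + quarter_period V \<theta> \<in> R"
      "\<And>\<rho>. \<rho> \<in> R \<Longrightarrow> \<rho> + quarter_period (refl_pot V) \<theta> \<in> R"
    and ab: "a \<le> b" and inv: "phase_inv V \<theta> R a (x a) (p a)"
  shows "phase_inv V \<theta> R b (x b) (p b)"
proof -
  define I where "I t \<longleftrightarrow> phase_inv V \<theta> R t (x t) (p t)" for t
  define P where "P c d \<longleftrightarrow> (a \<le> c \<and> d \<le> b \<longrightarrow> I c \<longrightarrow> I d)" for c d
  have "P a b" using ab
  proof (induct rule: Bolzano)
    case (trans c m d)
    then show ?case by (auto simp: P_def)
  next
    case (local \<tau>)
    then have \<tau>: "\<tau> \<in> {a..b}" by simp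
    show ?case
    proof (cases "p \<tau> = 0")
      case False
      define e where "e = sgn (p \<tau>)"
      have e: "\<bar>e\<bar> = 1" using False by (simp add: e_def)
      have "continuous_on {a..b} p" using dp by (rule DERIV_continuous_on)
      then have "\<forall>\<epsilon>>0. \<exists>\<delta>>0. \<forall>t\<in>{a..b}. dist t \<tau> < \<delta> \<longrightarrow> dist (p t) (p \<tau>) < \<epsilon>"
        using \<tau> unfolding continuous_on_iff by blast
      with False obtain \<delta> where \<delta>: "\<delta> > 0" "\<And>t. t \<in> {a..b} \<Longrightarrow> dist t \<tau> < \<delta> \<Longrightarrow> dist (p t) (p \<tau>) < \<bar>p \<tau>\<bar>"
        by (meson zero_less_abs_iff)
      have pe: "e * p t > 0" "sgn (p t) = e" if "t \<in> {a..b}" "dist t \<tau> < \<delta>" for t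
        using \<delta>(2)[OF that] False by (auto simp: e_def dist_real_def sgn_real_def abs_if split: if_splits)
      show ?thesis
      proof (intro exI[of _ \<delta>] conjI allI impI)
        fix c d assume cd: "c \<le> \<tau> \<and> \<tau> \<le> d \<and> d - c < \<delta>"
        show "P c d"
          unfolding P_def
        proof (intro impI)
          assume ab': "a \<le> c \<and> d \<le> b" and Ic: "I c"
          have near: "t \<in> {a..b}" "dist t \<tau> < \<delta>" if "t \<in> {c..d}" for t
            using that cd ab' by (auto simp: dist_real_def)
          have "d - e * signed_time V (x d) \<theta> = c - e * signed_time V (x c) \<theta>"
            using cd ab' near by (intro signed_time_along_arc e pe) auto
          moreover have "sgn (p c) = e" "sgn (p d) = e"
            using pe(2)[OF near, of c] pe(2)[OF near, of d] cd by auto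
          moreover from this e have "p c \<noteq> 0" "p d \<noteq> 0" by auto
          ultimately show "I d" using Ic by (simp add: I_def phase_inv_def)
        qed
      qed (fact \<delta>(1))
    next
      case True
      have Vx: "V (x \<tau>) = \<theta>" using energy[OF \<tau>] True by simp
      define e where "e = sgn (x \<tau>)"
      have x\<tau>: "x \<tau> \<noteq> 0" using UM_0[OF V] Vx \<theta> by auto
      then have e: "\<bar>e\<bar> = 1" "\<bar>- e\<bar> = 1" by (auto simp: e_def)
      \<comment> \<open>The force points back to 0, so \<open>e * p\<close> is positive just before
        \<open>\<tau>\<close> and negative just after it.\<close>
      have neg: "e * - deriv V (x \<tau>) < 0"
        using UM_mult_deriv_pos[OF V x\<tau>] by (auto simp: e_def sgn_real_def zero_less_mult_iff)
      have D: "((\<lambda>t. e * p t) has_real_derivative e * - deriv V (x \<tau>)) (at \<tau> within {a..b})"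
        by (rule DERIV_cmult[OF dp[OF \<tau>]])
      obtain \<delta>1 where \<delta>1: "\<delta>1 > 0" "\<And>h. h > 0 \<Longrightarrow> \<tau> + h \<in> {a..b} \<Longrightarrow> h < \<delta>1 \<Longrightarrow> e * p (\<tau> + h) < 0"
        using has_real_derivative_neg_dec_right[OF D neg] True by auto
      obtain \<delta>2 where \<delta>2: "\<delta>2 > 0" "\<And>h. h > 0 \<Longrightarrow> \<tau> - h \<in> {a..b} \<Longrightarrow> h < \<delta>2 \<Longrightarrow> e * p (\<tau> - h) > 0"
        using has_real_derivative_neg_dec_left[OF D neg] True by auto
      define S where "S = \<bar>signed_time V (x \<tau>) \<theta>\<bar>"
      have S: "e * signed_time V (x \<tau>) \<theta> = S" "S \<in> {quarter_period V \<theta>, quarter_period (refl_pot V) \<theta>}"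
        using turning_point_travel_time[OF V \<theta> Vx] by (auto simp: S_def e_def)
      have RS: "\<rho> + S \<in> R" if "\<rho> \<in> R" for \<rho> using that S(2) R by auto
      have sg: "sgn q = e" if "e * q > 0" for q using that e by (auto simp: sgn_real_def abs_if zero_less_mult_iff split: if_splits)
      have sg': "sgn q = - e" if "e * q < 0" for q using that e by (auto simp: sgn_real_def abs_if mult_less_0_iff split: if_splits)
      show ?thesis
      proof (intro exI[of _ "min \<delta>1 \<delta>2"] conjI allI impI)
        fix c d assume cd: "c \<le> \<tau> \<and> \<tau> \<le> d \<and> d - c < min \<delta>1 \<delta>2"
        show "P c d"
          unfolding P_def
        proof (intro impI)
          assume ab': "a \<le> c \<and> d \<le> b" and Ic: "I c"
          have before: "e * p t > 0" if "c \<le> t" "t < \<tau>" for t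
            using \<delta>2(2)[of "\<tau> - t"] that cd ab' by auto
          have after: "- e * p t > 0" if "\<tau> < t" "t \<le> d" for t
            using \<delta>1(2)[of "t - \<tau>"] that cd ab' by auto
          \<comment> \<open>The approach gives \<open>\<tau> - S \<in> R\<close>; adding the quarter
            period \<open>S\<close> once allows stopping at \<open>\<tau>\<close>, adding it twice
            allows moving on.\<close>
          have I\<tau>: "\<tau> \<in> R \<and> \<tau> + S \<in> R"
          proof (cases "c = \<tau>")
            case True
            then show ?thesis using Ic \<open>p \<tau> = 0\<close> by (simp add: I_def phase_inv_def S_def)
          next
            case False
            with cd have "c < \<tau>" by simp
            have "\<tau> - e * signed_time V (x \<tau>) \<theta> = c - e * signed_time V (x c) \<theta>"
              using cd ab' before by (intro signed_time_along_arc e) auto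
            moreover have "sgn (p c) = e" "p c \<noteq> 0"
              using before[of c] sg[of "p c"] \<open>c < \<tau>\<close> by auto
            then have "c - e * signed_time V (x c) \<theta> \<in> R"
              using Ic by (simp add: I_def phase_inv_def)
            ultimately have "\<tau> - S \<in> R" by (simp add: S)
            then show ?thesis using RS[of "\<tau> - S"] RS[of \<tau>] by simp
          qed
          show "I d"
          proof (cases "d = \<tau>")
            case True
            then show ?thesis using I\<tau> \<open>p \<tau> = 0\<close> by (simp add: I_def phase_inv_def S_def)
          next
            case False
            with cd have "\<tau> < d" by simp
            have "d - (- e) * signed_time V (x d) \<theta> = \<tau> - (- e) * signed_time V (x \<tau>) \<theta>"
              using cd ab' after by (intro signed_time_along_arc e) auto
            then have "d - (- e) * signed_time V (x d) \<theta> \<in> R" using I\<tau> S(1) by simp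
            moreover have "sgn (p d) = - e" "p d \<noteq> 0"
              using after[of d] sg'[of "p d"] \<open>\<tau> < d\<close> by auto
            ultimately show ?thesis by (simp add: I_def phase_inv_def)
          qed
        qed
      qed (use \<delta>1 \<delta>2 in auto)
    qed
  qed
  then show ?thesis using inv by (simp add: P_def I_def)
qed

end

text \<open>\<open>R\<close> is any set with the closure properties that motion and reflection use:
  passing a turning point adds a quarter period twice, and reversing the momentum at a wall
  \<open>x\<close> adds or subtracts \<open>signed_time V x \<theta>\<close> twice. A start or an
  end at a wall with nonzero momentum uses the wall time once.\<close>

lemma broken_arc_travel_time:
  fixes xs ps :: "nat \<Rightarrow> real \<Rightarrow> real"
  assumes V: "UM V" and \<theta>: "\<theta> > 0" and k: "k > 0" and t0: "t 0 = 0"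
    and t: "\<And>i. i < k \<Longrightarrow> t i < t (Suc i)"
    and dx: "\<And>i s. i < k \<Longrightarrow> s \<in> {t i..t (Suc i)} \<Longrightarrow> (xs i has_real_derivative ps i s) (at s within {t i..t (Suc i)})"
    and dp: "\<And>i s. i < k \<Longrightarrow> s \<in> {t i..t (Suc i)} \<Longrightarrow> (ps i has_real_derivative - deriv V (xs i s)) (at s within {t i..t (Suc i)})"
    and energy: "\<And>i s. i < k \<Longrightarrow> s \<in> {t i..t (Suc i)} \<Longrightarrow> (ps i s)\<^sup>2 / 2 + V (xs i s) = \<theta>"
    and cont: "\<And>i. Suc i < k \<Longrightarrow> xs (Suc i) (t (Suc i)) = xs i (t (Suc i))"
    and break: "\<And>i. Suc i < k \<Longrightarrow> ps (Suc i) (t (Suc i)) = ps i (t (Suc i)) \<or>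
        (ps (Suc i) (t (Suc i)) = - ps i (t (Suc i)) \<and> xs i (t (Suc i)) \<in> X)"
    and R: "0 \<in> R" "\<And>\<rho>. \<rho> \<in> R \<Longrightarrow> \<rho> + quarter_period V \<theta> \<in> R"
      "\<And>\<rho>. \<rho> \<in> R \<Longrightarrow> \<rho> + quarter_period (refl_pot V) \<theta> \<in> R"
      "\<And>\<rho> x. \<rho> \<in> R \<Longrightarrow> x \<in> X \<Longrightarrow> V x < \<theta> \<Longrightarrow> \<rho> + signed_time V x \<theta> \<in> R"
      "\<And>\<rho> x. \<rho> \<in> R \<Longrightarrow> x \<in> X \<Longrightarrow> V x < \<theta> \<Longrightarrow> \<rho> - signed_time V x \<theta> \<in> R"
    and ends: "xs 0 0 \<in> X \<or> V (xs 0 0) = \<theta>" "xs (k - 1) (t k) \<in> X \<or> V (xs (k - 1) (t k)) = \<theta>"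
  shows "t k \<in> R"
proof -
  have Vle: "V x < \<theta>" if "p\<^sup>2 / 2 + V x = \<theta>" "p \<noteq> 0" for x p :: real
  proof -
    have "p\<^sup>2 > 0" using that(2) by simp
    with that(1) show ?thesis by linarith
  qed
  have shift: "\<rho> + sgn p * signed_time V x \<theta> \<in> R" "\<rho> - sgn p * signed_time V x \<theta> \<in> R"
    if "\<rho> \<in> R" "x \<in> X" "V x < \<theta>" "p \<noteq> 0" for \<rho> x p :: real
    using R(4,5)[OF that(1-3)] that(4) by (auto simp: sgn_real_def)
  have "i < k \<Longrightarrow> phase_inv V \<theta> R (t i) (xs i (t i)) (ps i (t i))" for i
  proof (induction i)
    case 0
    let ?p = "ps 0 0" and ?x = "xs 0 0"
    have en: "?p\<^sup>2 / 2 + V ?x = \<theta>" using energy[OF k, of 0] t[OF k] t0 by simp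
    show ?case
    proof (cases "?p = 0")
      case True
      then have "V ?x = \<theta>" using en by simp
      from turning_point_travel_time(1)[OF V \<theta> this] R(2)[OF R(1)] R(3)[OF R(1)]
      show ?thesis using True R(1) by (auto simp: phase_inv_def t0)
    next
      case False
      with en have "V ?x < \<theta>" by (rule Vle)
      with ends(1) shift(2)[OF R(1) _ this False] show ?thesis
        using False by (auto simp: phase_inv_def t0)
    qed
  next
    case (Suc i)
    then have i: "i < k" "Suc i < k" by auto
    have "phase_inv V \<theta> R (t (Suc i)) (xs i (t (Suc i))) (ps i (t (Suc i)))"
      using i t[OF i(1)] Suc.IH[OF i(1)]
      by (intro phase_inv_along_arc[OF V \<theta> dx[OF i(1)] dp[OF i(1)] energy[OF i(1)] R(2,3)]) auto
    moreover have "phase_inv V \<theta> R s x (- p)"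
      if inv: "phase_inv V \<theta> R s x p" and x: "x \<in> X" and en: "p\<^sup>2 / 2 + V x = \<theta>" for s x p
    proof (cases "p = 0")
      case False
      have "s - sgn p * signed_time V x \<theta> \<in> R" using inv False by (simp add: phase_inv_def)
      from shift(1)[OF shift(1)[OF this x Vle[OF en False] False] x Vle[OF en False] False]
      show ?thesis using False by (simp add: phase_inv_def sgn_minus)
    qed (use inv in simp)
    ultimately show ?case
      using break[OF i(2)] energy[OF i(1), of "t (Suc i)"] t[OF i(1)] by (auto simp: cont[OF i(2)])
  qed
  from this[of "k - 1"] have "phase_inv V \<theta> R (t (k - 1)) (xs (k - 1) (t (k - 1))) (ps (k - 1) (t (k - 1)))"
    using k by simp
  moreover have k1: "k - 1 < k" "Suc (k - 1) = k" using k by auto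
  ultimately have inv: "phase_inv V \<theta> R (t k) (xs (k - 1) (t k)) (ps (k - 1) (t k))"
    using t[OF k1(1)]
    by (intro phase_inv_along_arc[OF V \<theta> dx[OF k1(1)] dp[OF k1(1)] energy[OF k1(1)] R(2,3), unfolded k1(2)]) auto
  have en: "(ps (k - 1) (t k))\<^sup>2 / 2 + V (xs (k - 1) (t k)) = \<theta>"
    using energy[OF k1(1), of "t k"] t[OF k1(1)] k1(2) by simp
  show ?thesis
  proof (cases "ps (k - 1) (t k) = 0")
    case True
    with inv show ?thesis by (simp add: phase_inv_def)
  next
    case False
    from Vle[OF en False] ends(2) have x: "xs (k - 1) (t k) \<in> X" by auto
    have "t k - sgn (ps (k - 1) (t k)) * signed_time V (xs (k - 1) (t k)) \<theta> \<in> R"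
      using inv False by (simp add: phase_inv_def)
    from shift(1)[OF this x Vle[OF en False] False] show ?thesis by simp
  qed
qed

text \<open>Wall times enter with integer coefficients of either sign, quarter periods only with
  natural ones, so that the period part vanishes only for \<open>N = M = 0\<close>. The wall at 0 is
  left out since its travel time is 0, and walls with \<open>V a \<ge> \<theta>\<close> cannot be
  hit with nonzero momentum.\<close>

definition travel_times :: "(real \<Rightarrow> real) \<Rightarrow> real set \<Rightarrow> real \<Rightarrow> real set" where
  "travel_times V X \<theta> = {real N * quarter_period V \<theta> + real M * quarter_period (refl_pot V) \<theta> +
     (\<Sum>a | a \<in> X \<and> a \<noteq> 0 \<and> V a < \<theta>. of_int (n a) * signed_time V a \<theta>) | N M n. True}"

lemma travel_times_0: "0 \<in> travel_times V X \<theta>"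
  unfolding travel_times_def by (intro CollectI exI[of _ 0] exI[of _ "\<lambda>_. 0"]) simp

lemma travel_times_add:
  assumes "\<rho> \<in> travel_times V X \<theta>" "\<rho>' \<in> travel_times V X \<theta>"
  shows "\<rho> + \<rho>' \<in> travel_times V X \<theta>"
proof -
  let ?S = "\<lambda>n :: real \<Rightarrow> int. \<Sum>a | a \<in> X \<and> a \<noteq> 0 \<and> V a < \<theta>. of_int (n a) * signed_time V a \<theta>"
  obtain N M n N' M' n' where
    "\<rho> = real N * quarter_period V \<theta> + real M * quarter_period (refl_pot V) \<theta> + ?S n"
    "\<rho>' = real N' * quarter_period V \<theta> + real M' * quarter_period (refl_pot V) \<theta> + ?S n'"
    using assms unfolding travel_times_def by blast
  moreover have "?S (\<lambda>a. n a + n' a) = ?S n + ?S n'"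
    by (simp add: ring_distribs sum.distrib)
  ultimately have "\<rho> + \<rho>' = real (N + N') * quarter_period V \<theta> + real (M + M') * quarter_period (refl_pot V) \<theta>
      + ?S (\<lambda>a. n a + n' a)"
    by (simp add: ring_distribs)
  then show ?thesis
    unfolding travel_times_def
    by (intro CollectI exI[of _ "N + N'"] exI[of _ "M + M'"] exI[of _ "\<lambda>a. n a + n' a"] conjI TrueI)
qed

lemma travel_times_quarter_period:
  "quarter_period V \<theta> \<in> travel_times V X \<theta>" "quarter_period (refl_pot V) \<theta> \<in> travel_times V X \<theta>"
  unfolding travel_times_def
  by (intro CollectI exI[of _ 1] exI[of _ 0] exI[of _ "\<lambda>_. 0"]; simp)+

lemma travel_times_signed_time:
  assumes "finite X" "x \<in> X" "V x < \<theta>"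
  shows "signed_time V x \<theta> \<in> travel_times V X \<theta>" "- signed_time V x \<theta> \<in> travel_times V X \<theta>"
proof -
  have gen: "of_int z * signed_time V x \<theta> \<in> travel_times V X \<theta>" for z
  proof (cases "x = 0")
    case True
    then show ?thesis using travel_times_0 by (simp add: signed_time_def)
  next
    case False
    have "(\<Sum>a | a \<in> X \<and> a \<noteq> 0 \<and> V a < \<theta>. of_int (if a = x then z else 0) * signed_time V a \<theta>) =
        (\<Sum>a | a \<in> X \<and> a \<noteq> 0 \<and> V a < \<theta>. if a = x then of_int z * signed_time V a \<theta> else 0)"
      by (intro sum.cong) auto
    also have "\<dots> = of_int z * signed_time V x \<theta>"
      using assms False by (subst sum.delta) auto
    finally show ?thesis
      unfolding travel_times_def by (intro CollectI exI[of _ 0] exI[of _ "\<lambda>a. if a = x then z else 0"]) simp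
  qed
  show "signed_time V x \<theta> \<in> travel_times V X \<theta>" "- signed_time V x \<theta> \<in> travel_times V X \<theta>"
    using gen[of 1] gen[of "-1"] by auto
qed

section \<open>Sides and corners of rectilinear polygons\<close>

lemma eventually_fst_in_finite:
  fixes c :: "real \<times> real"
  assumes "finite Z"
  shows "\<forall>\<^sub>F y in nhds c. fst y \<in> Z \<longrightarrow> fst y = fst c"
proof -
  have "open (- (Z - {fst c}))" using assms by (intro open_Compl finite_imp_closed) auto
  then have "\<forall>\<^sub>F y in nhds c. y \<in> fst -` (- (Z - {fst c}))"
    by (intro eventually_nhds_in_open open_vimage) (auto intro: continuous_intros)
  then show ?thesis by eventually_elim auto
qed

lemma eventually_snd_in_finite:
  fixes c :: "real \<times> real"
  assumes "finite Z"
  shows "\<forall>\<^sub>F y in nhds c. snd y \<in> Z \<longrightarrow> snd y = snd c"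
proof -
  have "open (- (Z - {snd c}))" using assms by (intro open_Compl finite_imp_closed) auto
  then have "\<forall>\<^sub>F y in nhds c. y \<in> snd -` (- (Z - {snd c}))"
    by (intro eventually_nhds_in_open open_vimage) (auto intro: continuous_intros)
  then show ?thesis by eventually_elim auto
qed

lemma fst_closed_segment_eq:
  fixes a b c :: "real \<times> real"
  assumes "c \<in> closed_segment a b" "fst a = fst b"
  shows "fst c = fst a"
proof -
  obtain u where "c = (1 - u) *\<^sub>R a + u *\<^sub>R b" using assms(1) by (auto simp: in_segment)
  then have "fst c = (1 - u) * fst a + u * fst b" by simp
  then show ?thesis using assms(2) by (simp add: algebra_simps)
qed

lemma snd_closed_segment_eq:
  fixes a b c :: "real \<times> real"
  assumes "c \<in> closed_segment a b" "snd a = snd b"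
  shows "snd c = snd a"
proof -
  obtain u where "c = (1 - u) *\<^sub>R a + u *\<^sub>R b" using assms(1) by (auto simp: in_segment)
  then have "snd c = (1 - u) * snd a + u * snd b" by simp
  then show ?thesis using assms(2) by (simp add: algebra_simps)
qed

lemma frontier_rectangle_subset:
  fixes l r b t :: real
  shows "frontier ({l..r} \<times> {b..t}) \<subseteq> {y. fst y \<in> {l, r} \<or> snd y \<in> {b, t}}"
  by (auto simp: frontier_def closure_Times interior_Times interior_atLeastAtMost_real)

context
  fixes P :: "(real \<times> real) set" and S :: "((real \<times> real) \<times> (real \<times> real)) set" and X Y :: "real set"
  assumes fin: "finite S" and axis: "\<And>a b. (a, b) \<in> S \<Longrightarrow> fst a = fst b \<or> snd a = snd b"
    and frontier: "frontier P = (\<Union>(a,b)\<in>S. closed_segment a b)"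
    and X: "\<And>a b. (a, b) \<in> S \<Longrightarrow> fst a \<in> X" and Y: "\<And>a b. (a, b) \<in> S \<Longrightarrow> snd a \<in> Y"
begin

text \<open>No vertical segment passes through \<open>c\<close>, because the first coordinate of
  \<open>c\<close> would then lie in \<open>X\<close>. Segments through \<open>c\<close> are
  therefore horizontal, and the finitely many others, being closed, stay away from
  \<open>c\<close>.\<close>

lemma eventually_frontier_horizontal:
  assumes c: "fst c \<notin> X"
  shows "\<forall>\<^sub>F y in nhds c. y \<in> frontier P \<longrightarrow> snd y = snd c"
proof -
  have "\<forall>s\<in>S. \<forall>\<^sub>F y in nhds c. y \<in> closed_segment (fst s) (snd s) \<longrightarrow> snd y = snd c"
  proof
    fix s assume "s \<in> S"
    obtain a b where s: "s = (a, b)" by (cases s)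
    with \<open>s \<in> S\<close> have ab: "(a, b) \<in> S" by simp
    show "\<forall>\<^sub>F y in nhds c. y \<in> closed_segment (fst s) (snd s) \<longrightarrow> snd y = snd c"
    proof (cases "c \<in> closed_segment a b")
      case True
      with c X[OF ab] have "fst a \<noteq> fst b" using fst_closed_segment_eq[of c a b] by auto
      with axis[OF ab] have "snd a = snd b" by simp
      with True show ?thesis unfolding s by (auto simp: snd_closed_segment_eq)
    next
      case False
      then have "\<forall>\<^sub>F y in nhds c. y \<in> - closed_segment a b"
        by (intro eventually_nhds_in_open) auto
      then show ?thesis unfolding s by eventually_elim auto
    qed
  qed
  then have "\<forall>\<^sub>F y in nhds c. \<forall>s\<in>S. y \<in> closed_segment (fst s) (snd s) \<longrightarrow> snd y = snd c"
    using fin by (intro eventually_ball_finite) auto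
  then show ?thesis by eventually_elim (auto simp: frontier case_prod_unfold)
qed

lemma eventually_frontier_vertical:
  assumes c: "snd c \<notin> Y"
  shows "\<forall>\<^sub>F y in nhds c. y \<in> frontier P \<longrightarrow> fst y = fst c"
proof -
  have "\<forall>s\<in>S. \<forall>\<^sub>F y in nhds c. y \<in> closed_segment (fst s) (snd s) \<longrightarrow> fst y = fst c"
  proof
    fix s assume "s \<in> S"
    obtain a b where s: "s = (a, b)" by (cases s)
    with \<open>s \<in> S\<close> have ab: "(a, b) \<in> S" by simp
    show "\<forall>\<^sub>F y in nhds c. y \<in> closed_segment (fst s) (snd s) \<longrightarrow> fst y = fst c"
    proof (cases "c \<in> closed_segment a b")
      case True
      with c Y[OF ab] have "snd a \<noteq> snd b" using snd_closed_segment_eq[of c a b] by auto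
      with axis[OF ab] have "fst a = fst b" by simp
      with True show ?thesis unfolding s by (auto simp: fst_closed_segment_eq)
    next
      case False
      then have "\<forall>\<^sub>F y in nhds c. y \<in> - closed_segment a b"
        by (intro eventually_nhds_in_open) auto
      then show ?thesis unfolding s by eventually_elim auto
    qed
  qed
  then have "\<forall>\<^sub>F y in nhds c. \<forall>s\<in>S. y \<in> closed_segment (fst s) (snd s) \<longrightarrow> fst y = fst c"
    using fin by (intro eventually_ball_finite) auto
  then show ?thesis by eventually_elim (auto simp: frontier case_prod_unfold)
qed

text \<open>A degenerate segment through \<open>c\<close> is a single end point, whose two
  coordinates lie in \<open>X\<close> and \<open>Y\<close>. The segment through \<open>c\<close> is
  therefore nondegenerate, and all its points are limit points of it.\<close>

lemma frontier_not_isolated: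
  assumes c: "c \<in> frontier P" "fst c \<notin> X \<or> snd c \<notin> Y"
  shows "c islimpt frontier P"
proof -
  obtain a b where ab: "(a, b) \<in> S" "c \<in> closed_segment a b" using c(1) by (auto simp: frontier)
  have "a \<noteq> b" using c(2) ab X[OF ab(1)] Y[OF ab(1)] by auto
  then have "c islimpt closed_segment a b"
    using ab(2) by (intro connected_imp_perfect) (auto, metis ends_in_segment singletonD)
  then show ?thesis by (rule islimpt_subset) (use ab(1) in \<open>auto simp: frontier\<close>)
qed

text \<open>Otherwise the frontier near \<open>c\<close> would be both vertical and horizontal,
  leaving \<open>c\<close> isolated in it.\<close>

lemma vertical_side_coordinate:
  assumes "vertical_side P c"
  shows "fst c \<in> X"
proof (rule ccontr)
  assume c: "fst c \<notin> X"
  from assms obtain e where e: "c \<in> frontier P" "e > 0" "frontier P \<inter> ball c e \<subseteq> {x. fst x = fst c}"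
    unfolding vertical_side_def by blast
  have "\<forall>\<^sub>F y in nhds c. y \<in> ball c e" using e(2) by (intro eventually_nhds_in_open) auto
  with eventually_frontier_horizontal[OF c] have "\<forall>\<^sub>F y in nhds c. y \<in> frontier P \<longrightarrow> y = c"
    by eventually_elim (use e(3) in \<open>auto simp: prod_eq_iff\<close>)
  with frontier_not_isolated[OF e(1)] c show False
    unfolding islimpt_approachable eventually_nhds_metric by (metis dist_commute)
qed

lemma horizontal_side_coordinate:
  assumes "horizontal_side P c"
  shows "snd c \<in> Y"
proof (rule ccontr)
  assume c: "snd c \<notin> Y"
  from assms obtain e where e: "c \<in> frontier P" "e > 0" "frontier P \<inter> ball c e \<subseteq> {x. snd x = snd c}"
    unfolding horizontal_side_def by blast
  have "\<forall>\<^sub>F y in nhds c. y \<in> ball c e" using e(2) by (intro eventually_nhds_in_open) auto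
  with eventually_frontier_vertical[OF c] have "\<forall>\<^sub>F y in nhds c. y \<in> frontier P \<longrightarrow> y = c"
    by eventually_elim (use e(3) in \<open>auto simp: prod_eq_iff\<close>)
  with frontier_not_isolated[OF e(1)] c show False
    unfolding islimpt_approachable eventually_nhds_metric by (metis dist_commute)
qed

lemma quadrant_vertical_edge:
  assumes e: "e > 0" and s: "s1 \<in> {-1, 1::real}" "s2 \<in> {-1, 1::real}"
    and Q: "P \<inter> ball c e = {x \<in> ball c e. s1 * (fst x - fst c) \<ge> 0 \<and> s2 * (snd x - snd c) \<ge> 0}"
    and \<eta>: "0 < \<eta>" "\<eta> < e"
  shows "(fst c, snd c + s2 * \<eta>) \<in> frontier P"
proof -
  let ?y = "(fst c, snd c + s2 * \<eta>)"
  have abs: "\<bar>s1\<bar> = 1" "\<bar>s2\<bar> = 1" "s1 * s1 = 1" "s2 * s2 = 1" using s by auto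
  have dy: "dist c ?y = \<eta>" using \<eta> abs by (cases c) (simp add: dist_Pair_Pair dist_real_def abs_mult)
  have "?y \<in> {x \<in> ball c e. s1 * (fst x - fst c) \<ge> 0 \<and> s2 * (snd x - snd c) \<ge> 0}"
    using \<eta> abs dy by (auto simp flip: mult.assoc)
  then have "?y \<in> P" unfolding Q[symmetric] by simp
  moreover have "?y \<notin> interior P"
  proof
    assume "?y \<in> interior P"
    then obtain r where r: "r > 0" "ball ?y r \<subseteq> P" by (auto simp: mem_interior)
    define h where "h = min r (e - \<eta>) / 2"
    have h: "h > 0" "h < r" "h < e - \<eta>" using r \<eta> by (auto simp: h_def min_def)
    let ?z = "(fst c - s1 * h, snd c + s2 * \<eta>)"
    have dz: "dist ?y ?z = h" using h abs by (simp add: dist_Pair_Pair dist_real_def abs_mult)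
    have "dist c ?z < e" using dist_triangle[of c ?z ?y] dy dz h by simp
    moreover have "?z \<in> P" using r(2) dz h by auto
    ultimately have "?z \<in> P \<inter> ball c e" by simp
    then have "s1 * (fst ?z - fst c) \<ge> 0" unfolding Q by simp
    then show False using h abs by (simp flip: mult.assoc)
  qed
  ultimately show ?thesis using closure_subset by (auto simp: frontier_def)
qed

lemma quadrant_horizontal_edge:
  assumes e: "e > 0" and s: "s1 \<in> {-1, 1::real}" "s2 \<in> {-1, 1::real}"
    and Q: "P \<inter> ball c e = {x \<in> ball c e. s1 * (fst x - fst c) \<ge> 0 \<and> s2 * (snd x - snd c) \<ge> 0}"
    and \<eta>: "0 < \<eta>" "\<eta> < e"
  shows "(fst c + s1 * \<eta>, snd c) \<in> frontier P"
proof -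
  let ?y = "(fst c + s1 * \<eta>, snd c)"
  have abs: "\<bar>s1\<bar> = 1" "\<bar>s2\<bar> = 1" "s1 * s1 = 1" "s2 * s2 = 1" using s by auto
  have dy: "dist c ?y = \<eta>" using \<eta> abs by (cases c) (simp add: dist_Pair_Pair dist_real_def abs_mult)
  have "?y \<in> {x \<in> ball c e. s1 * (fst x - fst c) \<ge> 0 \<and> s2 * (snd x - snd c) \<ge> 0}"
    using \<eta> abs dy by (auto simp flip: mult.assoc)
  then have "?y \<in> P" unfolding Q[symmetric] by simp
  moreover have "?y \<notin> interior P"
  proof
    assume "?y \<in> interior P"
    then obtain r where r: "r > 0" "ball ?y r \<subseteq> P" by (auto simp: mem_interior)
    define h where "h = min r (e - \<eta>) / 2"
    have h: "h > 0" "h < r" "h < e - \<eta>" using r \<eta> by (auto simp: h_def min_def)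
    let ?z = "(fst c + s1 * \<eta>, snd c - s2 * h)"
    have dz: "dist ?y ?z = h" using h abs by (simp add: dist_Pair_Pair dist_real_def abs_mult)
    have "dist c ?z < e" using dist_triangle[of c ?z ?y] dy dz h by simp
    moreover have "?z \<in> P" using r(2) dz h by auto
    ultimately have "?z \<in> P \<inter> ball c e" by simp
    then have "s2 * (snd ?z - snd c) \<ge> 0" unfolding Q by simp
    then show False using h abs by (simp flip: mult.assoc)
  qed
  ultimately show ?thesis using closure_subset by (auto simp: frontier_def)
qed

text \<open>From a convex corner, frontier points run off along both axes at arbitrarily small
  distance \<open>\<eta>\<close>, which a locally horizontal or locally vertical frontier
  excludes.\<close>

lemma convex_corner_coordinates:
  assumes "convex_corner P c"
  shows "fst c \<in> X" "snd c \<in> Y"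
proof -
  from assms obtain e s1 s2 where e: "e > 0" and s: "s1 \<in> {-1, 1::real}" "s2 \<in> {-1, 1::real}"
    and Q: "P \<inter> ball c e = {x \<in> ball c e. s1 * (fst x - fst c) \<ge> 0 \<and> s2 * (snd x - snd c) \<ge> 0}"
    unfolding convex_corner_def by blast
  have abs: "\<bar>s1\<bar> = 1" "\<bar>s2\<bar> = 1" using s by auto
  show "fst c \<in> X"
  proof (rule ccontr)
    assume "fst c \<notin> X"
    then obtain d where d: "d > 0" "\<And>y. dist y c < d \<Longrightarrow> y \<in> frontier P \<Longrightarrow> snd y = snd c"
      using eventually_frontier_horizontal unfolding eventually_nhds_metric by blast
    define \<eta> where "\<eta> = min d e / 2"
    have \<eta>: "0 < \<eta>" "\<eta> < d" "\<eta> < e" using d e by (auto simp: \<eta>_def min_def)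
    have "dist (fst c, snd c + s2 * \<eta>) c < d"
      using \<eta> abs by (cases c) (simp add: dist_Pair_Pair dist_real_def abs_mult)
    from d(2)[OF this quadrant_vertical_edge[OF e s Q \<eta>(1,3)]] \<eta> abs show False by auto
  qed
  show "snd c \<in> Y"
  proof (rule ccontr)
    assume "snd c \<notin> Y"
    then obtain d where d: "d > 0" "\<And>y. dist y c < d \<Longrightarrow> y \<in> frontier P \<Longrightarrow> fst y = fst c"
      using eventually_frontier_vertical unfolding eventually_nhds_metric by blast
    define \<eta> where "\<eta> = min d e / 2"
    have \<eta>: "0 < \<eta>" "\<eta> < d" "\<eta> < e" using d e by (auto simp: \<eta>_def min_def)
    have "dist (fst c + s1 * \<eta>, snd c) c < d"
      using \<eta> abs by (cases c) (simp add: dist_Pair_Pair dist_real_def abs_mult)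
    from d(2)[OF this quadrant_horizontal_edge[OF e s Q \<eta>(1,3)]] \<eta> abs show False by auto
  qed
qed

text \<open>A frontier point of the clipped polygon lies on the frontier of \<open>P\<close> or on
  one of the four lines bounding the rectangle. Away from the listed first coordinates both kinds
  are locally horizontal, and symmetrically for the second coordinates.\<close>

lemma corner_clipped_coordinates:
  assumes "corner (P \<inter> ({l..r} \<times> {b..t})) c"
  shows "fst c \<in> X \<union> {l, r}" "snd c \<in> Y \<union> {b, t}"
proof -
  let ?Q = "P \<inter> ({l..r} \<times> {b..t})"
  have fr: "y \<in> frontier P \<or> fst y \<in> {l, r} \<or> snd y \<in> {b, t}" if "y \<in> frontier ?Q" for y
    using that frontier_Int_subset[of P "{l..r} \<times> {b..t}"] frontier_rectangle_subset[of l r b t] by blast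
  have Z1: "\<forall>\<^sub>F y in nhds c. fst y \<in> {l, r} \<longrightarrow> fst y = fst c" by (rule eventually_fst_in_finite) simp
  have Z2: "\<forall>\<^sub>F y in nhds c. snd y \<in> {b, t} \<longrightarrow> snd y = snd c" by (rule eventually_snd_in_finite) simp
  show "fst c \<in> X \<union> {l, r}"
  proof (rule ccontr)
    assume c: "fst c \<notin> X \<union> {l, r}"
    have "\<forall>\<^sub>F y in nhds c. y \<in> frontier P \<longrightarrow> snd y = snd c"
      using c by (intro eventually_frontier_horizontal) auto
    with Z1 Z2 have "\<forall>\<^sub>F y in nhds c. y \<in> frontier ?Q \<longrightarrow> snd y = snd c"
    proof eventually_elim
      case (elim y)
      then show ?case using fr[of y] c by auto
    qed
    then obtain d where "d > 0" "\<And>y. dist y c < d \<Longrightarrow> y \<in> frontier ?Q \<Longrightarrow> snd y = snd c"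
      unfolding eventually_nhds_metric by blast
    with assms show False unfolding corner_def by (metis Int_iff dist_commute mem_ball)
  qed
  show "snd c \<in> Y \<union> {b, t}"
  proof (rule ccontr)
    assume c: "snd c \<notin> Y \<union> {b, t}"
    have "\<forall>\<^sub>F y in nhds c. y \<in> frontier P \<longrightarrow> fst y = fst c"
      using c by (intro eventually_frontier_vertical) auto
    with Z1 Z2 have "\<forall>\<^sub>F y in nhds c. y \<in> frontier ?Q \<longrightarrow> fst y = fst c"
    proof eventually_elim
      case (elim y)
      then show ?case using fr[of y] c by auto
    qed
    then obtain d where "d > 0" "\<And>y. dist y c < d \<Longrightarrow> y \<in> frontier ?Q \<Longrightarrow> fst y = fst c"
      unfolding eventually_nhds_metric by blast
    with assms show False unfolding corner_def by (metis Int_iff dist_commute mem_ball)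
  qed
qed

end

section \<open>Durations of resonant trajectories\<close>

lemma travel_times_broken_arc:
  fixes xs ps :: "nat \<Rightarrow> real \<Rightarrow> real"
  assumes "UM V" "\<theta> > 0" "finite X" "k > 0" "t 0 = 0"
    "\<And>i. i < k \<Longrightarrow> t i < t (Suc i)"
    "\<And>i s. i < k \<Longrightarrow> s \<in> {t i..t (Suc i)} \<Longrightarrow> (xs i has_real_derivative ps i s) (at s within {t i..t (Suc i)})"
    "\<And>i s. i < k \<Longrightarrow> s \<in> {t i..t (Suc i)} \<Longrightarrow> (ps i has_real_derivative - deriv V (xs i s)) (at s within {t i..t (Suc i)})"
    "\<And>i s. i < k \<Longrightarrow> s \<in> {t i..t (Suc i)} \<Longrightarrow> (ps i s)\<^sup>2 / 2 + V (xs i s) = \<theta>"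
    "\<And>i. Suc i < k \<Longrightarrow> xs (Suc i) (t (Suc i)) = xs i (t (Suc i))"
    "\<And>i. Suc i < k \<Longrightarrow> ps (Suc i) (t (Suc i)) = ps i (t (Suc i)) \<or>
        (ps (Suc i) (t (Suc i)) = - ps i (t (Suc i)) \<and> xs i (t (Suc i)) \<in> X)"
    "xs 0 0 \<in> X \<or> V (xs 0 0) = \<theta>" "xs (k - 1) (t k) \<in> X \<or> V (xs (k - 1) (t k)) = \<theta>"
  shows "t k \<in> travel_times V X \<theta>"
proof (rule broken_arc_travel_time[where V = V and \<theta> = \<theta> and X = X and xs = xs and ps = ps])
  show "\<rho> + signed_time V x \<theta> \<in> travel_times V X \<theta>" "\<rho> - signed_time V x \<theta> \<in> travel_times V X \<theta>"
    if "\<rho> \<in> travel_times V X \<theta>" "x \<in> X" "V x < \<theta>" for \<rho> x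
    using travel_times_add[OF that(1), of "signed_time V x \<theta>"] travel_times_add[OF that(1), of "- signed_time V x \<theta>"]
      travel_times_signed_time[of X x V \<theta>] assms(3) that by auto
qed (use assms travel_times_0 travel_times_add travel_times_quarter_period in auto)

lemma V_turning_points:
  assumes "UM V" "\<theta> \<ge> 0" "x \<in> {- inv_pos (refl_pot V) \<theta>, inv_pos V \<theta>}"
  shows "V x = \<theta>"
  using assms V_inv_pos[OF assms(1,2)] V_inv_pos[OF UM_refl_pot[OF assms(1)] assms(2)]
  by (auto simp: refl_pot_def)

text \<open>\<open>X\<close> and \<open>Y\<close> are chosen from the polygon alone, independently
  of \<open>E\<close> and \<open>\<theta>\<close>. The first momentum is reversed only at vertical
  sides and convex corners, whose first coordinate lies in \<open>X\<close>, and the second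
  symmetrically; in each coordinate a corner of the clipped polygon is at a wall or at a turning
  point. The same duration is thus computed in either coordinate.\<close>

lemma resonant_travel_times:
  assumes V: "UM V1" "UM V2" and P: "RP P"
  obtains X Y where "finite X" "finite Y"
    "\<And>E \<theta>. 0 < \<theta> \<Longrightarrow> \<theta> < E \<Longrightarrow> resonant P V1 V2 E \<theta> \<Longrightarrow>
       \<exists>T>0. T \<in> travel_times V1 X \<theta> \<and> T \<in> travel_times V2 Y (E - \<theta>)"
proof -
  from P obtain S where S: "finite S" "\<And>a b. (a, b) \<in> S \<Longrightarrow> fst a = fst b \<or> snd a = snd b"
    "frontier P = (\<Union>(a,b)\<in>S. closed_segment a b)"
    unfolding RP_def by blast
  define X Y where "X = fst ` fst ` S" and "Y = snd ` fst ` S"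
  have XY: "\<And>a b. (a, b) \<in> S \<Longrightarrow> fst a \<in> X" "\<And>a b. (a, b) \<in> S \<Longrightarrow> snd a \<in> Y"
    unfolding X_def Y_def by force+
  have geo: "vertical_side P c \<Longrightarrow> fst c \<in> X" "horizontal_side P c \<Longrightarrow> snd c \<in> Y"
    "convex_corner P c \<Longrightarrow> fst c \<in> X" "convex_corner P c \<Longrightarrow> snd c \<in> Y"
    "corner (P \<inter> ({l..r} \<times> {b..u})) c \<Longrightarrow> fst c \<in> X \<union> {l, r}"
    "corner (P \<inter> ({l..r} \<times> {b..u})) c \<Longrightarrow> snd c \<in> Y \<union> {b, u}" for c l r b u
    using vertical_side_coordinate[OF S, of X Y c] horizontal_side_coordinate[OF S, of X Y c]
      convex_corner_coordinates[OF S, of X Y c] corner_clipped_coordinates[OF S, of X Y l r b u c] XY by blast+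
  show thesis
  proof (rule that[of X Y])
    show fin: "finite X" "finite Y" using S(1) by (auto simp: X_def Y_def)
    fix E \<theta> assume \<theta>: "0 < \<theta>" "\<theta> < E" and res: "resonant P V1 V2 E \<theta>"
    then have \<theta>': "E - \<theta> > 0" by simp
    from res obtain T q where tr: "trajectory P V1 V2 E \<theta> T q"
      and c0: "corner (hill_polygon P V1 V2 E \<theta>) (q 0)" and cT: "corner (hill_polygon P V1 V2 E \<theta>) (q T)"
      unfolding resonant_def by blast
    from tr have T: "T > 0" unfolding trajectory_def by blast
    from tr obtain k t xs ps where t: "t 0 = 0" "t k = T" "\<And>i. i < k \<Longrightarrow> t i < t (Suc i)"
      and arc: "\<And>i. i < k \<Longrightarrow> hamilton_arc V1 V2 (t i) (t (Suc i)) (xs i) (ps i)"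
      and on: "\<And>i s. i < k \<Longrightarrow> s \<in> {t i..t (Suc i)} \<Longrightarrow> xs i s = q s \<and>
           (fst (ps i s))\<^sup>2 / 2 + V1 (fst (q s)) = \<theta> \<and> (snd (ps i s))\<^sup>2 / 2 + V2 (snd (q s)) = E - \<theta>"
      and ref: "\<And>i. 0 < i \<Longrightarrow> i < k \<Longrightarrow> reflect_ok P (q (t i)) (ps (i - 1) (t i)) (ps i (t i))"
      unfolding trajectory_def by blast
    have k: "k > 0" using t T by (cases "k = 0") auto
    have ends: "xs 0 0 = q 0" "xs (k - 1) (t k) = q T"
      using on[of 0 0] on[of "k - 1" "t k"] t(3)[of 0] t(3)[of "k - 1"] k t(1,2) by auto
    have cont: "xs (Suc i) (t (Suc i)) = xs i (t (Suc i))" "xs i (t (Suc i)) = q (t (Suc i))" if "Suc i < k" for i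
      using on[of i "t (Suc i)"] on[of "Suc i" "t (Suc i)"] t(3)[of i] t(3)[of "Suc i"] that by auto
    have refl: "reflect_ok P (q (t (Suc i))) (ps i (t (Suc i))) (ps (Suc i) (t (Suc i)))" if "Suc i < k" for i
      using ref[of "Suc i"] that by simp
    have D: "(xs i has_vector_derivative ps i s) (at s within {t i..t (Suc i)})"
      "((\<lambda>s. fst (ps i s)) has_real_derivative - deriv V1 (fst (xs i s))) (at s within {t i..t (Suc i)})"
      "((\<lambda>s. snd (ps i s)) has_real_derivative - deriv V2 (snd (xs i s))) (at s within {t i..t (Suc i)})"
      if "i < k" "s \<in> {t i..t (Suc i)}" for i s
      using arc[OF that(1)] that(2) unfolding hamilton_arc_def by auto
    have D': "((\<lambda>s. fst (xs i s)) has_real_derivative fst (ps i s)) (at s within {t i..t (Suc i)})"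
      "((\<lambda>s. snd (xs i s)) has_real_derivative snd (ps i s)) (at s within {t i..t (Suc i)})"
      if "i < k" "s \<in> {t i..t (Suc i)}" for i s
      using bounded_linear.has_vector_derivative[OF bounded_linear_fst D(1)[OF that]]
        bounded_linear.has_vector_derivative[OF bounded_linear_snd D(1)[OF that]]
      by (simp_all add: has_real_derivative_iff_has_vector_derivative)
    have en: "(fst (ps i s))\<^sup>2 / 2 + V1 (fst (xs i s)) = \<theta>" "(snd (ps i s))\<^sup>2 / 2 + V2 (snd (xs i s)) = E - \<theta>"
      if "i < k" "s \<in> {t i..t (Suc i)}" for i s
      using on[OF that] by auto
    have br: "fst (ps (Suc i) (t (Suc i))) = fst (ps i (t (Suc i))) \<or>
        (fst (ps (Suc i) (t (Suc i))) = - fst (ps i (t (Suc i))) \<and> fst (xs i (t (Suc i))) \<in> X)"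
      "snd (ps (Suc i) (t (Suc i))) = snd (ps i (t (Suc i))) \<or>
        (snd (ps (Suc i) (t (Suc i))) = - snd (ps i (t (Suc i))) \<and> snd (xs i (t (Suc i))) \<in> Y)"
      if "Suc i < k" for i
      using refl[OF that] geo(1-4)[of "q (t (Suc i))"] cont(2)[OF that] unfolding reflect_ok_def by auto
    have corner: "fst c \<in> X \<or> V1 (fst c) = \<theta>" "snd c \<in> Y \<or> V2 (snd c) = E - \<theta>"
      if "corner (hill_polygon P V1 V2 E \<theta>) c" for c
      using geo(5,6)[OF that[unfolded hill_polygon_def]]
        V_turning_points[OF V(1) less_imp_le[OF \<theta>(1)], of "fst c"] V_turning_points[OF V(2) less_imp_le[OF \<theta>'], of "snd c"]
      by auto
    have "t k \<in> travel_times V1 X \<theta>"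
      by (rule travel_times_broken_arc[where xs = "\<lambda>i s. fst (xs i s)" and ps = "\<lambda>i s. fst (ps i s)"])
        (use V \<theta> fin k t(1,3) D D' en cont(1) br corner[OF c0] corner[OF cT] ends in auto)
    moreover have "t k \<in> travel_times V2 Y (E - \<theta>)"
      by (rule travel_times_broken_arc[where xs = "\<lambda>i s. snd (xs i s)" and ps = "\<lambda>i s. snd (ps i s)"])
        (use V \<theta>' fin k t(1,3) D D' en cont(1) br corner[OF c0] corner[OF cT] ends in auto)
    ultimately show "\<exists>T>0. T \<in> travel_times V1 X \<theta> \<and> T \<in> travel_times V2 Y (E - \<theta>)"
      using T t(2) by auto
  qed
qed

section \<open>The identity between periods\<close>

text \<open>The open interval is exhausted by compact intervals, one of which keeps uncountably many
  points of \<open>U\<close>; limit points of these cannot escape to \<open>a\<close> or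
  \<open>b\<close>.\<close>

lemma uncountable_imp_islimpt_interval:
  fixes a b :: real
  assumes "uncountable U" "U \<subseteq> {a<..<b}"
  obtains z where "z \<in> {a<..<b}" "z islimpt U"
proof -
  define J where "J n = {a + 1 / real (Suc n)..b - 1 / real (Suc n)}" for n
  have "U \<subseteq> (\<Union>n. U \<inter> J n)"
  proof
    fix x assume x: "x \<in> U"
    with assms(2) have "min (x - a) (b - x) > 0" by auto
    then obtain n where "inverse (real (Suc n)) < min (x - a) (b - x)" using reals_Archimedean by blast
    then have "x \<in> J n" by (auto simp: J_def inverse_eq_divide)
    with x show "x \<in> (\<Union>n. U \<inter> J n)" by blast
  qed
  with assms(1) have "\<exists>n. uncountable (U \<inter> J n)"
    by (meson countable_UN countable_subset countableI_type)
  then obtain n where "uncountable (U \<inter> J n)" by blast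
  then obtain z where z: "z islimpt (U \<inter> J n)" using no_limpt_imp_countable by blast
  have "z islimpt J n" using z by (rule islimpt_subset) auto
  moreover have "closed (J n)" by (simp add: J_def)
  ultimately have "z \<in> J n" by (simp add: closed_limpt)
  moreover have "1 / real (Suc n) > 0" by simp
  ultimately have "z \<in> {a<..<b}"
    unfolding J_def atLeastAtMost_iff greaterThanLessThan_iff by linarith
  then show thesis using z by (intro that[of z]) (auto elim: islimpt_subset)
qed

definition period_sum :: "(real \<Rightarrow> real) \<Rightarrow> nat \<Rightarrow> nat \<Rightarrow> real \<Rightarrow> real" where
  "period_sum V N M \<theta> = real N * quarter_period V \<theta> + real M * quarter_period (refl_pot V) \<theta>"

lemma real_analytic_at_period_sum:
  assumes "UM V" "\<theta> > 0"
  shows "real_analytic_at (period_sum V N M) \<theta>"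
  unfolding period_sum_def[abs_def] using assms
  by (intro real_analytic_at_add real_analytic_at_mult real_analytic_at_const real_analytic_at_quarter_period UM_refl_pot)

lemma real_analytic_at_reflect_energy:
  assumes "real_analytic_at f (E - \<theta>)"
  shows "real_analytic_at (\<lambda>\<theta>. f (E - \<theta>)) \<theta>"
  by (rule real_analytic_at_compose[where f = "\<lambda>\<theta>. E - \<theta>" and h = f, OF _ assms])
    (intro real_analytic_at_diff real_analytic_at_const real_analytic_at_ident)

text \<open>Each resonant \<open>\<theta>\<close> satisfies one of countably many equations, so a
  single one holds on an uncountable set, hence by analyticity on a whole interval bounded by
  thresholds. The wall terms of \<open>V1\<close> are eliminated first, against the analytic other
  side, and then, in the variable \<open>\<eta> = E - \<theta>\<close>, those of
  \<open>V2\<close>.\<close>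

lemma resonant_energy_identity:
  assumes V: "UM V1" "UM V2" and P: "RP P" and E: "E \<in> resonant_energies P V1 V2"
  obtains N M N' M' where "N + M > 0" "N' + M' > 0"
    "\<And>\<theta>. 0 < \<theta> \<Longrightarrow> \<theta> < E \<Longrightarrow> period_sum V1 N M \<theta> = period_sum V2 N' M' (E - \<theta>)"
proof -
  define \<Theta> where "\<Theta> = {\<theta>. 0 < \<theta> \<and> \<theta> < E \<and> resonant P V1 V2 E \<theta>}"
  have E0: "E > 0" and unc: "uncountable \<Theta>"
    using E by (auto simp: resonant_energies_def \<Theta>_def)
  obtain X Y where XY: "finite X" "finite Y"
    and travel_XY: "\<And>E \<theta>. 0 < \<theta> \<Longrightarrow> \<theta> < E \<Longrightarrow> resonant P V1 V2 E \<theta> \<Longrightarrow>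
       \<exists>T>0. T \<in> travel_times V1 X \<theta> \<and> T \<in> travel_times V2 Y (E - \<theta>)"
  proof (rule resonant_travel_times[OF V P], goal_cases)
    case (1 X Y)
    from 1(1)[OF 1(2-4)] show ?case .
  qed
  have res: "\<exists>T>0. T \<in> travel_times V1 X \<theta> \<and> T \<in> travel_times V2 Y (E - \<theta>)" if "\<theta> \<in> \<Theta>" for \<theta>
    using that unfolding \<Theta>_def by (intro travel_XY) auto
  define F where "F V N M A n \<theta> = period_sum V N M \<theta> + (\<Sum>a\<in>A. of_int (n a) * signed_time V a \<theta>)"
    for V N M A and n :: "real \<Rightarrow> int" and \<theta>
  \<comment> \<open>Restricting \<open>n\<close> to \<open>X\<close> makes the choices of
    coefficients range over the countable set \<open>X \<rightarrow>\<^sub>E UNIV\<close>.\<close>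
  have travel: "\<exists>A N M n. A \<subseteq> X \<and> n \<in> X \<rightarrow>\<^sub>E UNIV \<and> 0 \<notin> A \<and> (\<forall>a\<in>A. V a < \<theta>) \<and> T = F V N M A n \<theta>"
    if T: "T \<in> travel_times V X \<theta>" for T V X \<theta>
  proof -
    define A where "A = {a. a \<in> X \<and> a \<noteq> 0 \<and> V a < \<theta>}"
    obtain N M n where "T = real N * quarter_period V \<theta> + real M * quarter_period (refl_pot V) \<theta> +
        (\<Sum>a\<in>A. of_int (n a :: int) * signed_time V a \<theta>)"
      using T unfolding travel_times_def A_def by blast
    moreover have "(\<Sum>a\<in>A. of_int (n a) * signed_time V a \<theta>) = (\<Sum>a\<in>A. of_int (restrict n X a) * signed_time V a \<theta>)"
      by (intro sum.cong) (auto simp: A_def)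
    ultimately have "T = F V N M A (restrict n X) \<theta>" by (simp add: F_def period_sum_def)
    then show ?thesis
      by (intro exI[of _ A] exI[of _ N] exI[of _ M] exI[of _ "restrict n X"]) (auto simp: A_def)
  qed
  define G where "G = (\<lambda>(A, B, n, m, N, M, N', M'). {\<theta>. 0 < \<theta> \<and> \<theta> < E \<and> 0 \<notin> A \<and> 0 \<notin> B \<and>
     (\<forall>a\<in>A. V1 a < \<theta>) \<and> (\<forall>b\<in>B. V2 b < E - \<theta>) \<and> F V1 N M A n \<theta> > 0 \<and>
     F V1 N M A n \<theta> = F V2 N' M' B m (E - \<theta>)})"
  define D where "D = Pow X \<times> Pow Y \<times> (X \<rightarrow>\<^sub>E (UNIV :: int set)) \<times> (Y \<rightarrow>\<^sub>E (UNIV :: int set)) \<times>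
     (UNIV :: nat set) \<times> (UNIV :: nat set) \<times> (UNIV :: nat set) \<times> (UNIV :: nat set)"
  have "countable D"
    unfolding D_def using XY by (intro countable_SIGMA countable_PiE) (auto intro: countable_finite)
  moreover have "\<Theta> \<subseteq> (\<Union>d\<in>D. G d)"
  proof
    fix \<theta> assume \<theta>: "\<theta> \<in> \<Theta>"
    then obtain T where T: "T > 0" "T \<in> travel_times V1 X \<theta>" "T \<in> travel_times V2 Y (E - \<theta>)"
      using res by blast
    obtain A N M n where 1: "A \<subseteq> X" "n \<in> X \<rightarrow>\<^sub>E UNIV" "0 \<notin> A" "\<forall>a\<in>A. V1 a < \<theta>" "T = F V1 N M A n \<theta>"
      using travel[OF T(2)] by blast
    obtain B N' M' m where 2: "B \<subseteq> Y" "m \<in> Y \<rightarrow>\<^sub>E UNIV" "0 \<notin> B" "\<forall>b\<in>B. V2 b < E - \<theta>" "T = F V2 N' M' B m (E - \<theta>)"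
      using travel[OF T(3)] by blast
    have "(A, B, n, m, N, M, N', M') \<in> D" using 1 2 unfolding D_def by auto
    moreover have "\<theta> \<in> G (A, B, n, m, N, M, N', M')"
      using 1 2 T(1) \<theta> unfolding G_def \<Theta>_def by simp
    ultimately show "\<theta> \<in> (\<Union>d\<in>D. G d)" by blast
  qed
  ultimately have "\<exists>d\<in>D. uncountable (G d)"
    using unc by (meson countable_UN countable_subset)
  then obtain A B n m N M N' M' where d: "A \<subseteq> X" "B \<subseteq> Y" "uncountable (G (A, B, n, m, N, M, N', M'))"
    unfolding D_def by auto
  have AB: "finite A" "finite B" using d XY finite_subset by auto
  define m1 where "m1 = Max (insert 0 (V1 ` A))"
  define m2 where "m2 = Max (insert 0 (V2 ` B))"
  have m1: "m1 < \<theta> \<longleftrightarrow> 0 < \<theta> \<and> (\<forall>a\<in>A. V1 a < \<theta>)" for \<theta> using AB by (auto simp: m1_def)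
  have m2: "m2 < \<theta> \<longleftrightarrow> 0 < \<theta> \<and> (\<forall>b\<in>B. V2 b < \<theta>)" for \<theta> using AB by (auto simp: m2_def)
  have m0: "0 \<le> m1" "0 \<le> m2" using AB by (auto simp: m1_def m2_def)
  \<comment> \<open>For \<open>\<theta> < \<beta>\<close> the energy \<open>E - \<theta>\<close>
    exceeds every threshold of \<open>B\<close>.\<close>
  define \<beta> where "\<beta> = E - m2"
  define F1 where "F1 = F V1 N M A n"
  define F2 where "F2 = F V2 N' M' B m"
  define U where "U = G (A, B, n, m, N, M, N', M')"
  have U: "0 \<notin> A" "0 \<notin> B" "\<theta> \<in> {m1<..<\<beta>}" "F1 \<theta> > 0" "F1 \<theta> = F2 (E - \<theta>)" if "\<theta> \<in> U" for \<theta>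
    using that m1[of \<theta>] m2[of "E - \<theta>"] unfolding U_def G_def F1_def F2_def \<beta>_def by auto
  have U_sub: "U \<subseteq> {m1<..<\<beta>}" using U(3) by blast
  have anF: "real_analytic_at (F V N M A n) \<theta>" if "UM V" "\<theta> > 0" "\<And>a. a \<in> A \<Longrightarrow> V a < \<theta>" for V N M A n \<theta>
    unfolding F_def[abs_def] using that
    by (intro real_analytic_at_add real_analytic_at_period_sum real_analytic_at_sum real_analytic_at_mult
        real_analytic_at_const real_analytic_at_signed_time) auto
  have an1: "real_analytic_at F1 \<theta>" if "m1 < \<theta>" for \<theta>
    unfolding F1_def using that m1 by (intro anF V) auto
  have an2: "real_analytic_at (\<lambda>\<theta>. F2 (E - \<theta>)) \<theta>" if "\<theta> < \<beta>" for \<theta>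
    unfolding F2_def using that m2[of "E - \<theta>"] by (intro real_analytic_at_reflect_energy anF V) (auto simp: \<beta>_def)
  obtain z where z: "z \<in> {m1<..<\<beta>}" "z islimpt U"
    using uncountable_imp_islimpt_interval[OF d(3) U_sub[unfolded U_def]] unfolding U_def by blast
  have F12: "F1 \<theta> = F2 (E - \<theta>)" if "\<theta> \<in> {m1<..<\<beta>}" for \<theta>
  proof -
    have "F1 \<theta> - F2 (E - \<theta>) = 0"
      by (rule real_analytic_identity[of "{m1<..<\<beta>}" "\<lambda>\<theta>. F1 \<theta> - F2 (E - \<theta>)" z U])
        (use z that U(5) in \<open>auto intro!: real_analytic_at_diff an1 an2\<close>)
    then show ?thesis by simp
  qed
  have "U \<noteq> {}" using d(3) unfolding U_def by auto
  then obtain \<xi> where \<xi>: "\<xi> \<in> U" by blast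
  note \<xi>U = U[OF \<xi>]
  have \<xi>0: "0 < \<xi>" "\<xi> < \<beta>" "\<xi> < E" "m1 < \<beta>" using \<xi>U(3) m0 by (auto simp: \<beta>_def)
  have base1: "period_sum V1 N M \<theta> = F2 (E - \<theta>)" if "0 < \<theta>" "\<theta> < \<beta>" for \<theta>
  proof (rule threshold_elimination[OF V(1) AB(1) \<xi>U(1), where n = "\<lambda>a. of_int (n a)" and \<beta> = \<beta>
        and B = "period_sum V1 N M" and M = "\<lambda>\<theta>. F2 (E - \<theta>)"])
    show "period_sum V1 N M \<theta> + (\<Sum>a\<in>A. of_int (n a) * signed_time V1 a \<theta>) = F2 (E - \<theta>)"
      if "0 < \<theta>" "\<theta> < \<beta>" "\<And>a. a \<in> A \<Longrightarrow> V1 a < \<theta>" for \<theta>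
      using F12[of \<theta>] that m1[of \<theta>] by (simp add: F1_def F_def)
  qed (use that \<xi>0 m1[of \<beta>] V in \<open>auto intro: an2 real_analytic_at_period_sum\<close>)
  \<comment> \<open>With the wall terms of \<open>A\<close> gone, the first side is analytic at all
    positive energies, so the thresholds of \<open>B\<close> can be removed on all of
    \<open>0 < \<eta> < E\<close>.\<close>
  have base2: "period_sum V2 N' M' \<eta> = period_sum V1 N M (E - \<eta>)" if "0 < \<eta>" "\<eta> < E" for \<eta>
  proof (rule threshold_elimination[OF V(2) AB(2) \<xi>U(2), where n = "\<lambda>a. of_int (m a)" and \<beta> = E
        and B = "period_sum V2 N' M'" and M = "\<lambda>\<eta>. period_sum V1 N M (E - \<eta>)"])
    show "period_sum V2 N' M' \<eta> + (\<Sum>a\<in>B. of_int (m a) * signed_time V2 a \<eta>) = period_sum V1 N M (E - \<eta>)"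
      if "0 < \<eta>" "\<eta> < E" "\<And>a. a \<in> B \<Longrightarrow> V2 a < \<eta>" for \<eta>
      using base1[of "E - \<eta>"] that m2[of \<eta>] by (simp add: F2_def F_def \<beta>_def)
    show "real_analytic_at (\<lambda>\<eta>. period_sum V1 N M (E - \<eta>)) \<eta>" if "0 < \<eta>" "\<eta> < E" for \<eta>
      using that V by (intro real_analytic_at_reflect_energy real_analytic_at_period_sum) auto
  qed (use that \<xi>0 E0 m2[of E] m0 V in \<open>auto intro: real_analytic_at_period_sum simp: \<beta>_def\<close>)
  \<comment> \<open>At the resonant \<open>\<xi>\<close> the duration is positive, which rules out
    \<open>N = M = 0\<close> and \<open>N' = M' = 0\<close>.\<close>
  have pos: "period_sum V1 N M \<xi> > 0" using base1[OF \<xi>0(1,2)] \<xi>U(4,5) by simp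
  moreover have "period_sum V2 N' M' (E - \<xi>) = period_sum V1 N M \<xi>"
    using base2[of "E - \<xi>"] \<xi>0 by simp
  ultimately have "N + M > 0" "N' + M' > 0" by (auto simp: period_sum_def intro!: Nat.gr0I)
  then show thesis
  proof (rule that)
    show "period_sum V1 N M \<theta> = period_sum V2 N' M' (E - \<theta>)" if "0 < \<theta>" "\<theta> < E" for \<theta>
      using base2[of "E - \<theta>"] that by simp
  qed
qed

section \<open>Behaviour near the minimum\<close>

text \<open>A vanishing second derivative gives \<open>V y \<le> \<epsilon> * y\<^sup>2\<close> near
  0 for any \<open>\<epsilon> > 0\<close>, so at small energies the turning point is far away
  compared with the maximal speed \<open>sqrt (2 * \<theta>)\<close>.\<close>

lemma quarter_period_unbounded:
  assumes V: "UM V" and flat: "(deriv V has_real_derivative 0) (at 0)" and K: "K > 0"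
  obtains d where "d > 0" "\<And>\<theta>. 0 < \<theta> \<Longrightarrow> \<theta> < d \<Longrightarrow> quarter_period V \<theta> \<ge> K"
proof -
  \<comment> \<open>With this choice \<open>\<theta> \<le> \<epsilon> * r\<^sup>2\<close> amounts to
    \<open>sqrt (2 * \<theta>) \<le> r / K\<close>.\<close>
  define \<epsilon> where "\<epsilon> = 1 / (2 * K\<^sup>2)"
  have \<epsilon>: "\<epsilon> > 0" using K by (simp add: \<epsilon>_def)
  have "((\<lambda>h. deriv V h / h) \<longlongrightarrow> 0) (at 0)"
    using flat UM_deriv_0[OF V] by (simp add: DERIV_def)
  from tendstoD[OF this \<epsilon>] obtain \<rho> where \<rho>: "\<rho> > 0" "\<And>y. y \<noteq> 0 \<Longrightarrow> \<bar>y\<bar> < \<rho> \<Longrightarrow> \<bar>deriv V y / y\<bar> < \<epsilon>"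
    unfolding eventually_at by (auto simp: dist_real_def)
  have Vle: "V y \<le> \<epsilon> * y\<^sup>2" if y: "0 < y" "y < \<rho>" for y
  proof -
    obtain z where z: "0 < z" "z < y" "V y - V 0 = (y - 0) * deriv V z"
      using MVT2[OF y(1), of V "deriv V"] UM_DERIV[OF V] by auto
    have "deriv V z \<le> \<epsilon> * z" using \<rho>(2)[of z] z y by (auto simp: abs_if field_simps split: if_splits)
    also have "\<dots> \<le> \<epsilon> * y" using z \<epsilon> by simp
    finally have "y * deriv V z \<le> y * (\<epsilon> * y)" using y by (intro mult_left_mono) auto
    then show ?thesis using z(3) UM_0[OF V] by (simp add: power2_eq_square mult_ac)
  qed
  show thesis
  proof (rule that[of "V (\<rho> / 2)"])
    show "V (\<rho> / 2) > 0" using UM_pos[OF V] \<rho>(1) by simp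
    fix \<theta> assume \<theta>: "0 < \<theta>" "\<theta> < V (\<rho> / 2)"
    define r where "r = inv_pos V \<theta>"
    have r: "r > 0" "V r = \<theta>" using V \<theta> by (auto simp: r_def inv_pos_pos V_inv_pos)
    then have "r < \<rho> / 2" using UM_less_iff[OF V, of r "\<rho> / 2"] \<theta> \<rho>(1) by simp
    then have "\<theta> \<le> \<epsilon> * r\<^sup>2" using Vle[of r] r \<rho>(1) by simp
    then have "2 * \<theta> \<le> (r / K)\<^sup>2" using K by (simp add: \<epsilon>_def field_simps)
    then have "sqrt (2 * \<theta>) \<le> r / K" using r K by (intro real_le_lsqrt) auto
    then have "K \<le> r / sqrt (2 * \<theta>)" using K \<theta> r by (simp add: field_simps)
    also have "\<dots> \<le> quarter_period V \<theta>" using quarter_period_lower_bound[OF V \<theta>(1)] by (simp add: r_def)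
    finally show "K \<le> quarter_period V \<theta>" .
  qed
qed

text \<open>As the energy tends to 0 both quarter periods tend to infinity, and at least one of them
  occurs in the sum, whereas \<open>g\<close> stays close to \<open>g 0\<close>.\<close>

lemma flat_minimum_not_periodic:
  assumes V: "UM V" and flat: "deriv (deriv V) 0 = 0" and NM: "N + M > 0" and E: "E > 0"
    and g: "isCont g 0" and eq: "\<And>\<theta>. 0 < \<theta> \<Longrightarrow> \<theta> < E \<Longrightarrow> period_sum V N M \<theta> = g \<theta>"
  shows False
proof -
  have D: "(deriv V has_real_derivative 0) (at 0)"
    using real_analytic_at_DERIV[OF real_analytic_at_deriv[OF UM_real_analytic_at[OF V]], of 0] flat by simp
  have "((\<lambda>y. - deriv V (- y)) has_real_derivative - (0 * - 1)) (at 0)"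
    using D by (intro DERIV_minus DERIV_chain2[of "deriv V"]) (auto intro!: derivative_eq_intros)
  moreover have "deriv (refl_pot V) = (\<lambda>y. - deriv V (- y))" by (rule ext) (rule deriv_refl_pot[OF V])
  ultimately have D': "(deriv (refl_pot V) has_real_derivative 0) (at 0)" by simp
  define K where "K = \<bar>g 0\<bar> + 1"
  have K: "K > 0" by (simp add: K_def)
  obtain d1 where d1: "d1 > 0" "\<And>\<theta>. 0 < \<theta> \<Longrightarrow> \<theta> < d1 \<Longrightarrow> quarter_period V \<theta> \<ge> K"
    using quarter_period_unbounded[OF V D K] by blast
  obtain d2 where d2: "d2 > 0" "\<And>\<theta>. 0 < \<theta> \<Longrightarrow> \<theta> < d2 \<Longrightarrow> quarter_period (refl_pot V) \<theta> \<ge> K"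
    using quarter_period_unbounded[OF UM_refl_pot[OF V] D' K] by blast
  obtain d3 where d3: "d3 > 0" "\<And>\<theta>. \<bar>\<theta>\<bar> < d3 \<Longrightarrow> \<bar>g \<theta> - g 0\<bar> < 1"
    using g unfolding continuous_at_eps_delta by (metis dist_real_def diff_zero zero_less_one)
  define \<theta> where "\<theta> = min (min d1 d2) (min d3 E) / 2"
  have \<theta>: "0 < \<theta>" "\<theta> < d1" "\<theta> < d2" "\<theta> < d3" "\<theta> < E"
    using d1(1) d2(1) d3(1) E by (auto simp: \<theta>_def min_def)
  have "1 * K \<le> real (N + M) * K" using NM K by (intro mult_right_mono) auto
  also have "\<dots> = real N * K + real M * K" by (simp add: algebra_simps)
  also have "\<dots> \<le> period_sum V N M \<theta>"
    unfolding period_sum_def using d1(2)[OF \<theta>(1,2)] d2(2)[OF \<theta>(1,3)]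
    by (intro add_mono mult_left_mono) auto
  also have "\<dots> = g \<theta>" using \<theta> by (intro eq)
  also have "\<dots> < K" using d3(2)[of \<theta>] \<theta> by (simp add: K_def)
  finally show False by simp
qed

text \<open>\<open>\<psi>\<close> is an analytic signed square root of \<open>V\<close> with left
  inverse \<open>\<phi>\<close>. Substituting \<open>\<psi> x = r * sin v\<close> turns
  \<open>sqrt (r\<^sup>2 - V x)\<close> into \<open>r * cos v\<close>, which cancels against the
  same factor of \<open>dx = deriv \<phi> (r * sin v) * r * cos v dv\<close>.\<close>

lemma quarter_period_via_square_root:
  assumes V: "UM V" and an: "\<And>y. real_analytic_at \<psi> y" "\<And>y. real_analytic_at \<phi> y"
    and \<psi>: "\<And>y. y \<ge> 0 \<Longrightarrow> \<psi> y \<ge> 0" "\<And>y. (\<psi> y)\<^sup>2 = V y" and inv: "\<And>y. \<phi> (\<psi> y) = y" and r: "r > 0"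
  shows "quarter_period V (r\<^sup>2) = integral {0..pi / 2} (\<lambda>v. deriv \<phi> (r * sin v)) / sqrt 2"
proof -
  define R where "R = inv_pos V (r\<^sup>2)"
  have R: "R > 0" "V R = r\<^sup>2" using V r by (auto simp: R_def inv_pos_pos V_inv_pos)
  define w where "w x = arcsin (\<psi> x / r)" for x
  define \<Gamma> where "\<Gamma> v = deriv \<phi> (r * sin v) / sqrt 2" for v
  have \<psi>s: "\<psi> x = sqrt (V x)" if "x \<ge> 0" for x using \<psi>[of x] that by (metis real_sqrt_unique)
  have le: "0 \<le> \<psi> x / r" "\<psi> x / r \<le> 1" if "x \<in> {0..R}" for x
  proof -
    have "V x \<le> r\<^sup>2" using that R UM_strict_mono[OF V, of x R] by (cases "x = R") auto
    then have "\<psi> x \<le> r" using \<psi>s[of x] that r by (metis atLeastAtMost_iff abs_of_pos real_sqrt_abs real_sqrt_le_iff)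
    then show "0 \<le> \<psi> x / r" "\<psi> x / r \<le> 1" using \<psi>(1)[of x] that r by auto
  qed
  have lt: "0 < \<psi> x / r" "\<psi> x / r < 1" if "x \<in> {0<..<R}" for x
  proof -
    have "V x < r\<^sup>2" "V x > 0" using that R UM_strict_mono[OF V, of x R] UM_pos[OF V, of x] by auto
    then have "\<psi> x < r" "\<psi> x > 0" using \<psi>s[of x] that r
      by (metis greaterThanLessThan_iff abs_of_pos real_sqrt_abs real_sqrt_less_iff less_imp_le)
        (use \<psi>s[of x] that \<open>V x > 0\<close> in auto)
    then show "0 < \<psi> x / r" "\<psi> x / r < 1" using r by auto
  qed
  have cont\<phi>: "continuous_on A (deriv \<phi>)" for A
    using an(2) by (intro continuous_at_imp_continuous_on ballI real_analytic_at_isCont real_analytic_at_deriv)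
  have "((\<lambda>q. 1 / sqrt (2 * (r\<^sup>2 - V q))) has_integral integral {0..w R} \<Gamma> - integral {0..w 0} \<Gamma>) {0..R}"
  proof (rule has_integral_substitution_interior)
    have "continuous_on {0..R} \<psi>"
      using an(1) by (intro continuous_at_imp_continuous_on ballI real_analytic_at_isCont)
    then show "continuous_on {0..R} w"
      unfolding w_def using le r by (intro continuous_on_arcsin continuous_on_divide continuous_on_const) (auto intro: order_trans[of _ 0])
    show "w x \<in> {0..pi / 2}" if "x \<in> {0..R}" for x
      unfolding w_def using le[OF that] arcsin_le_arcsin[of 0 "\<psi> x / r"] arcsin_bounded[of "\<psi> x / r"] by auto
    show "w x \<in> {0<..<pi / 2}" if "x \<in> {0<..<R}" for x
      unfolding w_def using lt[OF that] arcsin_less_arcsin[of 0 "\<psi> x / r"] arcsin_less_arcsin[of "\<psi> x / r" 1] by auto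
    show "continuous_on {0..pi / 2} \<Gamma>"
      unfolding \<Gamma>_def by (intro continuous_intros continuous_on_compose2[OF cont\<phi>[of UNIV]]) auto
    fix x assume x: "x \<in> {0<..<R}"
    let ?c = "sqrt (1 - (\<psi> x / r)\<^sup>2)"
    have D\<psi>: "(\<psi> has_real_derivative deriv \<psi> x) (at x)" by (rule real_analytic_at_DERIV[OF an(1)])
    have "((\<lambda>x. \<psi> x / r) has_real_derivative deriv \<psi> x / r) (at x)"
      by (rule DERIV_cdivide[OF D\<psi>])
    from DERIV_chain2[OF DERIV_arcsin this] lt[OF x]
    show "(w has_real_derivative inverse ?c * (deriv \<psi> x / r)) (at x)"
      unfolding w_def[abs_def] by (simp add: order_less_trans[of _ 0])
    have "((\<lambda>x. \<phi> (\<psi> x)) has_real_derivative deriv \<phi> (\<psi> x) * deriv \<psi> x) (at x)"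
      by (rule DERIV_chain2[OF real_analytic_at_DERIV[OF an(2)] D\<psi>])
    moreover have "((\<lambda>x. \<phi> (\<psi> x)) has_real_derivative 1) (at x)" by (simp add: inv)
    ultimately have one: "deriv \<phi> (\<psi> x) * deriv \<psi> x = 1" by (rule DERIV_unique)
    have rw: "r * sin (w x) = \<psi> x" using lt[OF x] r by (simp add: w_def)
    have "r\<^sup>2 * (1 - (\<psi> x / r)\<^sup>2) = r\<^sup>2 - V x"
      using r \<psi>(2)[of x] by (simp add: power_divide field_simps)
    then have c: "r * ?c = sqrt (r\<^sup>2 - V x)"
      using r by (metis abs_of_pos real_sqrt_abs real_sqrt_mult)
    have "\<Gamma> (w x) * (inverse ?c * (deriv \<psi> x / r)) = (deriv \<phi> (\<psi> x) * deriv \<psi> x) / (sqrt 2 * (r * ?c))"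
      unfolding \<Gamma>_def rw by (simp add: field_simps)
    also have "\<dots> = 1 / sqrt (2 * (r\<^sup>2 - V x))" unfolding one c by (simp only: real_sqrt_mult)
    finally show "1 / sqrt (2 * (r\<^sup>2 - V x)) = \<Gamma> (w x) * (inverse ?c * (deriv \<psi> x / r))" ..
  qed (use R in auto)
  moreover have "w R = pi / 2" "w 0 = 0" using \<psi>s[of R] \<psi>s[of 0] R r UM_0[OF V] by (auto simp: w_def)
  ultimately show ?thesis
    unfolding quarter_period_def travel_time_def R_def[symmetric]
    by (simp add: integral_unique \<Gamma>_def[abs_def] Henstock_Kurzweil_Integration.integral_divide)
qed

text \<open>Dividing twice by \<open>y\<close> gives \<open>V y = y\<^sup>2 * k y\<close> with
  \<open>k\<close> analytic and \<open>k 0\<close> half the second derivative at 0. Then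
  \<open>k\<close> is positive everywhere and \<open>\<psi> y = y * sqrt (k y)\<close>.\<close>

lemma nondegenerate_minimum_square_root:
  assumes V: "UM V" and nd: "deriv (deriv V) 0 \<noteq> 0"
  obtains \<psi> where "\<And>y. real_analytic_at \<psi> y" "\<And>y. (\<psi> y)\<^sup>2 = V y" "\<And>y. y > 0 \<Longrightarrow> \<psi> y > 0" "\<And>y. y < 0 \<Longrightarrow> \<psi> y < 0"
    "\<And>y. deriv \<psi> y \<noteq> 0"
proof -
  define k1 where "k1 y = (if y = 0 then deriv V 0 else V y / y)" for y
  have quot: "real_analytic_at (\<lambda>y. if y = 0 then d else f y / y) y" if "real_analytic_at f y" "y \<noteq> 0" for d y :: real and f
  proof (rule real_analytic_at_cong[of "\<lambda>y. f y / y"])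
    show "real_analytic_at (\<lambda>y. f y / y) y"
      using that by (intro real_analytic_at_divide real_analytic_at_ident)
    have "\<forall>\<^sub>F z in nhds y. z \<in> - {0}" using that by (intro eventually_nhds_in_open) auto
    then show "\<forall>\<^sub>F z in nhds y. f z / z = (if z = 0 then d else f z / z)" by eventually_elim auto
  qed
  have k1: "real_analytic_at k1 y" for y
    unfolding k1_def using real_analytic_at_divided_ident[OF UM_real_analytic_at[OF V] UM_0[OF V]]
      quot[OF UM_real_analytic_at[OF V]] by (cases "y = 0") auto
  have k10: "k1 0 = 0" by (simp add: k1_def UM_deriv_0[OF V])
  define k where "k y = (if y = 0 then deriv k1 0 else k1 y / y)" for y
  have k: "real_analytic_at k y" for y
    unfolding k_def using real_analytic_at_divided_ident[OF k1 k10] quot[OF k1] by (cases "y = 0") auto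
  have Vk: "V y = y\<^sup>2 * k y" for y
    by (simp add: k_def k1_def UM_0[OF V] power2_eq_square)
  have Dk: "(k has_real_derivative deriv k y) (at y)" for y by (rule real_analytic_at_DERIV[OF k])
  have "deriv V y = 2 * y * k y + y\<^sup>2 * deriv k y" for y
  proof (rule DERIV_imp_deriv)
    have "((\<lambda>y. y\<^sup>2 * k y) has_real_derivative 2 * y * k y + y\<^sup>2 * deriv k y) (at y)"
      using Dk by (auto intro!: derivative_eq_intros)
    moreover have "V = (\<lambda>y. y\<^sup>2 * k y)" using Vk by blast
    ultimately show "(V has_real_derivative 2 * y * k y + y\<^sup>2 * deriv k y) (at y)" by simp
  qed
  then have dV: "deriv V = (\<lambda>y. 2 * y * k y + y\<^sup>2 * deriv k y)" by blast
  have "((\<lambda>y. 2 * y * k y + y\<^sup>2 * deriv k y) has_real_derivative 2 * k 0) (at 0)"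
    using Dk[of 0] real_analytic_at_DERIV[OF real_analytic_at_deriv[OF k], of 0]
    by (auto intro!: derivative_eq_intros)
  then have "deriv (deriv V) 0 = 2 * k 0" unfolding dV by (rule DERIV_imp_deriv)
  with nd have k0: "k 0 \<noteq> 0" by simp
  have kpos': "k y > 0" if "y \<noteq> 0" for y
    using UM_pos[OF V that] that Vk[of y] by (simp add: zero_less_mult_iff)
  have "k 0 \<ge> 0"
  proof (rule ccontr)
    assume "\<not> k 0 \<ge> 0"
    then have "\<forall>\<^sub>F y in at 0. k y < 0"
      using real_analytic_at_isCont[OF k, of 0] by (intro order_tendstoD(2)) (auto simp: isCont_def)
    moreover have "\<forall>\<^sub>F y in at 0. k y > 0" using kpos' by (auto simp: eventually_at_filter)
    ultimately have "\<forall>\<^sub>F y in at (0::real). False" by eventually_elim simp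
    then show False by simp
  qed
  with k0 kpos' have kpos: "k y > 0" for y by (cases "y = 0") auto
  define \<psi> where "\<psi> y = y * sqrt (k y)" for y
  have an: "real_analytic_at \<psi> y" for y
    unfolding \<psi>_def using k kpos by (intro real_analytic_at_mult real_analytic_at_ident real_analytic_at_sqrt')
  have sq: "(\<psi> y)\<^sup>2 = V y" for y
    using kpos[of y] by (simp add: \<psi>_def power_mult_distrib Vk)
  have D\<psi>: "(\<psi> has_real_derivative deriv \<psi> y) (at y)" for y by (rule real_analytic_at_DERIV[OF an])
  \<comment> \<open>At 0 the derivative is \<open>sqrt (k 0)\<close>; elsewhere a zero of it would
    be a zero of \<open>deriv V y = 2 * \<psi> y * deriv \<psi> y\<close>.\<close>
  have "deriv \<psi> y \<noteq> 0" for y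
  proof (cases "y = 0")
    case True
    have "((\<lambda>y. sqrt (k y)) has_real_derivative deriv (\<lambda>y. sqrt (k y)) 0) (at 0)"
      using k kpos by (intro real_analytic_at_DERIV real_analytic_at_sqrt')
    from DERIV_mult[OF DERIV_ident this] have "(\<psi> has_real_derivative sqrt (k 0)) (at 0)"
      unfolding \<psi>_def[abs_def] by simp
    then show ?thesis using True kpos[of 0] by (simp add: DERIV_imp_deriv)
  next
    case False
    have "((\<lambda>y. (\<psi> y)\<^sup>2) has_real_derivative 2 * \<psi> y * deriv \<psi> y) (at y)"
      using D\<psi> by (auto intro!: derivative_eq_intros)
    then have "deriv V y = 2 * \<psi> y * deriv \<psi> y" by (simp add: sq DERIV_imp_deriv)
    then show ?thesis using UM_deriv_nonzero[OF V False] by auto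
  qed
  moreover have "\<psi> y > 0" if "y > 0" for y using that kpos[of y] by (simp add: \<psi>_def)
  moreover have "\<psi> y < 0" if "y < 0" for y using that kpos[of y] by (simp add: \<psi>_def mult_neg_pos)
  ultimately show thesis using an sq that by blast
qed

text \<open>The inverse \<open>\<phi>\<close> of the signed root is analytic through 0 and joins the
  inverses of both branches of \<open>V\<close>. The integral of
  \<open>deriv \<phi> (r * sin v)\<close> is therefore analytic in \<open>r\<close> of either sign,
  and changing the sign of \<open>r\<close> amounts to reflecting \<open>V\<close>.\<close>

lemma quarter_period_two_sided_extension:
  assumes V: "UM V" and nd: "deriv (deriv V) 0 \<noteq> 0"
  obtains A where "\<And>r. real_analytic_at A r" "\<And>r. r > 0 \<Longrightarrow> A r = quarter_period V (r\<^sup>2)"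
    "\<And>r. r > 0 \<Longrightarrow> A (- r) = quarter_period (refl_pot V) (r\<^sup>2)"
proof -
  obtain \<psi> where \<psi>: "\<And>y. real_analytic_at \<psi> y" "\<And>y. (\<psi> y)\<^sup>2 = V y" "\<And>y. y > 0 \<Longrightarrow> \<psi> y > 0" "\<And>y. y < 0 \<Longrightarrow> \<psi> y < 0"
    and d\<psi>: "\<And>y. deriv \<psi> y \<noteq> 0"
    using nondegenerate_minimum_square_root[OF assms] by blast
  have \<psi>0: "\<psi> 0 = 0" using \<psi>(2)[of 0] UM_0[OF V] by simp
  define W where "W = refl_pot V"
  have W: "UM W" using V by (simp add: W_def UM_refl_pot)
  define \<phi> where "\<phi> r = (if r \<ge> 0 then inv_pos V (r\<^sup>2) else - inv_pos W (r\<^sup>2))" for r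
  have \<phi>\<psi>: "\<phi> (\<psi> y) = y" for y
  proof (cases "y \<ge> 0")
    case True
    then have "\<psi> y \<ge> 0" using \<psi>(3)[of y] \<psi>0 by (cases "y = 0") auto
    then show ?thesis using True inv_pos_eq[OF V True] by (simp add: \<phi>_def \<psi>(2))
  next
    case False
    then have "\<psi> y < 0" using \<psi>(4) by simp
    then show ?thesis using False inv_pos_eq[OF W, of "- y"] by (simp add: \<phi>_def \<psi>(2) W_def refl_pot_def)
  qed
  have \<psi>\<phi>: "\<psi> (\<phi> r) = r" for r
  proof (cases "r \<ge> 0")
    case True
    have "V (\<phi> r) = r\<^sup>2" "\<phi> r \<ge> 0" using True V_inv_pos[OF V, of "r\<^sup>2"] inv_pos_nonneg[OF V, of "r\<^sup>2"] by (auto simp: \<phi>_def)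
    moreover from this have "\<psi> (\<phi> r) \<ge> 0" using \<psi>(3)[of "\<phi> r"] \<psi>0 by (cases "\<phi> r = 0") auto
    ultimately show ?thesis using True \<psi>(2)[of "\<phi> r"] by (simp add: power2_eq_iff_nonneg)
  next
    case False
    have "V (\<phi> r) = r\<^sup>2" "\<phi> r < 0" using False V_inv_pos[OF W, of "r\<^sup>2"] inv_pos_pos[OF W, of "r\<^sup>2"]
      by (auto simp: \<phi>_def W_def refl_pot_def)
    then have "(- \<psi> (\<phi> r))\<^sup>2 = (- r)\<^sup>2" "- \<psi> (\<phi> r) \<ge> 0" using \<psi>(2)[of "\<phi> r"] \<psi>(4)[of "\<phi> r"] by auto
    then have "- \<psi> (\<phi> r) = - r" using False by (subst (asm) power2_eq_iff_nonneg) auto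
    then show ?thesis by simp
  qed
  have an\<phi>: "real_analytic_at \<phi> r" for r
  proof -
    have "real_analytic_at \<phi> (\<psi> (\<phi> r))"
    proof (rule real_analytic_at_inverse_function[where f = \<psi> and x = "\<phi> r"])
      show "isCont \<phi> (\<psi> (\<phi> r))"
        using \<phi>\<psi> real_analytic_at_isCont[OF \<psi>(1)] by (intro isCont_inverse_function[where f = \<psi> and x = "\<phi> r" and d = 1]) auto
    qed (use \<psi>(1) d\<psi> \<phi>\<psi> \<psi>\<phi> in auto)
    then show ?thesis by (simp add: \<psi>\<phi>)
  qed
  define A where "A r = integral {0..pi / 2} (\<lambda>v. deriv \<phi> (0 + r * sin v)) / sqrt 2" for r
  have anA: "real_analytic_at A r" for r
  proof -
    have "real_analytic_at (\<lambda>r. integral {0..pi / 2} (\<lambda>v. deriv \<phi> (0 + r * sin v))) r"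
      by (rule real_analytic_at_parametric_integral)
        (auto intro!: real_analytic_at_deriv an\<phi> continuous_on_const continuous_on_sin continuous_on_id)
    then show ?thesis
      unfolding A_def by (intro real_analytic_at_divide real_analytic_at_const) auto
  qed
  have A1: "A r = quarter_period V (r\<^sup>2)" if "r > 0" for r
  proof -
    have "\<psi> y \<ge> 0" if "y \<ge> 0" for y using \<psi>(3)[of y] \<psi>0 that by (cases "y = 0") auto
    from quarter_period_via_square_root[OF V \<psi>(1) an\<phi> this \<psi>(2) \<phi>\<psi> that]
    show ?thesis by (simp add: A_def)
  qed
  have neg: "real_analytic_at (\<lambda>y. - f (- y)) y" if "\<And>y. real_analytic_at f y" for f y
    by (intro real_analytic_at_minus real_analytic_at_compose[OF _ that] real_analytic_at_ident)
  have A2: "A (- r) = quarter_period (refl_pot V) (r\<^sup>2)" if "r > 0" for r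
  proof -
    have "quarter_period W (r\<^sup>2) = integral {0..pi / 2} (\<lambda>v. deriv (\<lambda>y. - \<phi> (- y)) (r * sin v)) / sqrt 2"
    proof (rule quarter_period_via_square_root[OF W, where \<psi> = "\<lambda>y. - \<psi> (- y)"])
      show "- \<psi> (- y) \<ge> 0" if "y \<ge> 0" for y using \<psi>(4)[of "- y"] \<psi>0 that by (cases "y = 0") auto
    qed (use that \<psi>(1,2) an\<phi> \<phi>\<psi> in \<open>auto intro!: neg simp: W_def refl_pot_def\<close>)
    moreover have "deriv (\<lambda>y. - \<phi> (- y)) y = deriv \<phi> (- y)" for y
    proof (rule DERIV_imp_deriv)
      have "((\<lambda>y. \<phi> (- y)) has_real_derivative deriv \<phi> (- y) * - 1) (at y)"
        by (rule DERIV_chain2[OF real_analytic_at_DERIV[OF an\<phi>]]) (auto intro!: derivative_eq_intros)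
      from DERIV_minus[OF this] show "((\<lambda>y. - \<phi> (- y)) has_real_derivative deriv \<phi> (- y)) (at y)" by simp
    qed
    ultimately show ?thesis by (simp add: A_def W_def)
  qed
  show thesis using that[of A] anA A1 A2 by blast
qed

section \<open>Similar potentials and the ratio of their periods\<close>

lemma quarter_period_scale:
  assumes U: "UM U" and W: "UM W" and pos: "\<omega> > 0" "t > 0" "\<theta> > 0"
    and eq: "\<And>x. x \<ge> 0 \<Longrightarrow> U x = \<omega> * W (t * x)"
  shows "quarter_period U \<theta> = quarter_period W (\<theta> / \<omega>) / (t * sqrt \<omega>)"
proof -
  define R where "R = inv_pos W (\<theta> / \<omega>)"
  have R: "R > 0" "W R = \<theta> / \<omega>" using W pos by (auto simp: R_def inv_pos_pos V_inv_pos)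
  have "U (R / t) = \<theta>" using eq[of "R / t"] R pos by simp
  then have RU: "inv_pos U \<theta> = R / t" using inv_pos_eq[OF U, of "R / t"] R pos by simp
  let ?f = "\<lambda>q. 1 / sqrt (2 * (\<theta> / \<omega> - W q))"
  have "(?f has_integral quarter_period W (\<theta> / \<omega>)) (cbox 0 R)"
    unfolding quarter_period_def travel_time_def R_def[symmetric]
    using integrable_integral[OF travel_integrable[OF W, of "\<theta> / \<omega>"]] pos by (simp add: R_def)
  \<comment> \<open>The substitution of \<open>t * q\<close> for the position accounts for the
    factor \<open>t\<close>; the factor \<open>sqrt \<omega>\<close> comes from
    \<open>\<theta> - U q\<close> being \<open>\<omega>\<close> times the corresponding difference
    for \<open>W\<close>.\<close>
  from has_integral_affinity'[OF this pos(2), of 0]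
  have "((\<lambda>q. ?f (t * q)) has_integral quarter_period W (\<theta> / \<omega>) / t) {0..R / t}"
    using pos by (simp add: divide_inverse mult.commute)
  from has_integral_divide[OF this, of "sqrt \<omega>"]
  have I: "((\<lambda>q. ?f (t * q) / sqrt \<omega>) has_integral quarter_period W (\<theta> / \<omega>) / (t * sqrt \<omega>)) {0..R / t}"
    by simp
  have "?f (t * q) / sqrt \<omega> = 1 / sqrt (2 * (\<theta> - U q))" if "q \<in> {0..R / t}" for q
  proof -
    have "2 * (\<theta> - U q) = (2 * (\<theta> / \<omega> - W (t * q))) * \<omega>"
      using eq[of q] that pos by (simp add: field_simps)
    then have "sqrt (2 * (\<theta> - U q)) = sqrt (2 * (\<theta> / \<omega> - W (t * q))) * sqrt \<omega>"
      by (simp only: real_sqrt_mult)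
    then show ?thesis by simp
  qed
  then have "((\<lambda>q. 1 / sqrt (2 * (\<theta> - U q))) has_integral quarter_period W (\<theta> / \<omega>) / (t * sqrt \<omega>)) {0..R / t}"
    using I has_integral_cong by (metis (no_types, lifting))
  then show ?thesis
    by (simp add: quarter_period_def[of U] travel_time_def[of U] RU integral_unique)
qed

text \<open>A negative \<open>\<tau>\<close> exchanges the two branches, hence the roles of
  \<open>N\<close> and \<open>M\<close>.\<close>

lemma period_sum_scale:
  assumes U: "UM U" and W: "UM W" and pos: "\<omega> > 0" "\<tau> \<noteq> 0" "\<theta> > 0"
    and eq: "\<And>x. U x = \<omega> * W (\<tau> * x)"
  shows "period_sum U N M \<theta> =
    (if \<tau> > 0 then period_sum W N M (\<theta> / \<omega>) else period_sum W M N (\<theta> / \<omega>)) / (\<bar>\<tau>\<bar> * sqrt \<omega>)"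
proof (cases "\<tau> > 0")
  case True
  then show ?thesis
    using quarter_period_scale[OF U W pos(1) True pos(3)] eq
      quarter_period_scale[OF UM_refl_pot[OF U] UM_refl_pot[OF W] pos(1) True pos(3)]
    by (simp add: period_sum_def refl_pot_def add_divide_distrib)
next
  case False
  then have \<tau>: "- \<tau> > 0" using pos(2) by simp
  show ?thesis
    using quarter_period_scale[OF U UM_refl_pot[OF W] pos(1) \<tau> pos(3)] eq False
      quarter_period_scale[OF UM_refl_pot[OF U] W pos(1) \<tau> pos(3)]
    by (simp add: period_sum_def refl_pot_def add_divide_distrib)
qed

text \<open>With \<open>R\<close> analytic at 0 the relation extends to small negative
  \<open>r\<close>. Its right side is even, so the relations at \<open>r\<close> and
  \<open>- r\<close> together give \<open>(a - b) * (A r - A (- r)) = 0\<close> near 0; if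
  \<open>a\<close> and \<open>b\<close> differ, the identity theorem carries the symmetry of
  \<open>A\<close> to all \<open>r\<close>.\<close>

lemma two_sided_extension_even:
  assumes A: "\<And>r. real_analytic_at A r" and R: "real_analytic_at R 0" and \<delta>: "\<delta> > 0"
    and eq: "\<And>r. 0 < r \<Longrightarrow> r < \<delta> \<Longrightarrow> a * A r + b * A (- r) = R (r\<^sup>2)"
  shows "a = b \<or> (\<forall>r. A r = A (- r))"
proof (cases "a = b")
  case ab: False
  define D where "D r = a * A r + b * A (- r) - R (r\<^sup>2)" for r
  have An: "real_analytic_at (\<lambda>r. A (- r)) r" for r
    by (intro real_analytic_at_compose[OF _ A] real_analytic_at_minus real_analytic_at_ident)
  have "real_analytic_at (\<lambda>r. R (r\<^sup>2)) 0"
    by (rule real_analytic_at_compose[where f = "\<lambda>r. r\<^sup>2" and h = R])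
      (use R in \<open>auto intro!: real_analytic_at_power real_analytic_at_ident\<close>)
  then have D: "real_analytic_at D 0"
    unfolding D_def by (intro real_analytic_at_diff real_analytic_at_add real_analytic_at_mult real_analytic_at_const A An)
  have "(0::real) islimpt {0<..<\<delta>}" using \<delta> by (simp add: islimpt_greaterThanLessThan1)
  from real_analytic_at_eventually_zero[OF D this] eq
  obtain e where e: "e > 0" "\<And>r. \<bar>r\<bar> < e \<Longrightarrow> D r = 0"
    unfolding eventually_nhds_metric D_def by (auto simp: dist_real_def)
  have small: "A r - A (- r) = 0" if "r \<in> {-e<..<e}" for r
  proof -
    have "D r = 0" "D (- r) = 0" using that by (auto intro!: e(2))
    then have "(a - b) * (A r - A (- r)) = 0" by (simp add: D_def algebra_simps)
    with ab show ?thesis by simp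
  qed
  have lim: "(0::real) islimpt {-e<..<e}" using e(1) by (intro interior_limit_point) (auto simp: interior_open)
  have "A r - A (- r) = 0" for r
    by (rule real_analytic_identity[OF open_UNIV connected_UNIV _ UNIV_I lim small UNIV_I])
      (intro real_analytic_at_diff A An)
  then show ?thesis by simp
qed simp

text \<open>At each end of the energy interval one side is analytic, so on the other side the
  coefficients are equal or the two quarter periods agree. Either way only the sum of the two
  quarter periods matters, and comparing the sides at an energy where both are evaluated at the same
  point gives \<open>\<kappa>\<close> as a quotient of integers.\<close>

lemma self_similar_period_rational:
  assumes W: "UM W" and nd: "deriv (deriv W) 0 \<noteq> 0" and pos: "\<omega> > 0" "E > 0" "\<kappa> > 0" and N: "a2 + b2 > 0"
    and eq: "\<And>\<theta>. 0 < \<theta> \<Longrightarrow> \<theta> < E \<Longrightarrow> period_sum W a1 b1 (\<theta> / \<omega>) = \<kappa> * period_sum W a2 b2 (E - \<theta>)"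
  shows "\<kappa> \<in> \<rat>"
proof -
  obtain A where A: "\<And>r. real_analytic_at A r" "\<And>r. r > 0 \<Longrightarrow> A r = quarter_period W (r\<^sup>2)"
    "\<And>r. r > 0 \<Longrightarrow> A (- r) = quarter_period (refl_pot W) (r\<^sup>2)"
    using quarter_period_two_sided_extension[OF W nd] by blast
  have ps: "period_sum W a b (r\<^sup>2) = a * A r + b * A (- r)" if "r > 0" for a b r
    using A(2,3)[OF that] by (simp add: period_sum_def)
  have sq: "r\<^sup>2 < x" if "0 < r" "r < sqrt x" for r x :: real
    using that by (metis less_eq_real_def not_less real_le_rsqrt real_sqrt_le_iff real_sqrt_unique)
  \<comment> \<open>Near \<open>\<theta> = 0\<close> the right-hand side is an analytic function of
    \<open>\<theta> / \<omega> = r\<^sup>2\<close>.\<close>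
  have even1: "real a1 = real b1 \<or> (\<forall>r. A r = A (- r))"
  proof (rule two_sided_extension_even[OF A(1)])
    show "sqrt (E / \<omega>) > 0" using pos by simp
    show "real_analytic_at (\<lambda>s. \<kappa> * period_sum W a2 b2 (E - \<omega> * s)) 0"
      using pos by (intro real_analytic_at_mult real_analytic_at_const
          real_analytic_at_compose[where f = "\<lambda>s. E - \<omega> * s" and h = "period_sum W a2 b2"]
          real_analytic_at_diff real_analytic_at_ident real_analytic_at_period_sum[OF W]) auto
    show "a1 * A r + b1 * A (- r) = \<kappa> * period_sum W a2 b2 (E - \<omega> * r\<^sup>2)" if "0 < r" "r < sqrt (E / \<omega>)" for r
      using eq[of "\<omega> * r\<^sup>2"] ps[OF that(1), of a1 b1] sq[OF that] that pos by (simp add: field_simps)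
  qed
  have even2: "real a2 = real b2 \<or> (\<forall>r. A r = A (- r))"
  proof (rule two_sided_extension_even[OF A(1)])
    show "sqrt E > 0" using pos by simp
    show "real_analytic_at (\<lambda>s. period_sum W a1 b1 ((E - s) / \<omega>) / \<kappa>) 0"
      using pos by (intro real_analytic_at_divide[where g = "\<lambda>_. \<kappa>"] real_analytic_at_const
          real_analytic_at_compose[where f = "\<lambda>s. (E - s) / \<omega>" and h = "period_sum W a1 b1"]
          real_analytic_at_divide[where g = "\<lambda>_. \<omega>"]
          real_analytic_at_diff real_analytic_at_ident real_analytic_at_period_sum[OF W]) auto
    show "a2 * A r + b2 * A (- r) = period_sum W a1 b1 ((E - r\<^sup>2) / \<omega>) / \<kappa>" if "0 < r" "r < sqrt E" for r
      using eq[of "E - r\<^sup>2"] ps[OF that(1), of a2 b2] sq[OF that] that pos by (simp add: field_simps)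
  qed
  \<comment> \<open>The energy \<open>\<theta> = \<omega> * s\<close> is the one with
    \<open>\<theta> / \<omega> = E - \<theta>\<close>, both being \<open>s\<close>.\<close>
  define s where "s = E / (1 + \<omega>)"
  have s: "s > 0" "\<omega> * s > 0" "\<omega> * s < E" "E - \<omega> * s = s"
    using pos by (auto simp: s_def field_simps)
  define T T' where "T = A (sqrt s)" and "T' = A (- sqrt s)"
  have T: "T > 0" "T' > 0"
    using A(2,3)[of "sqrt s"] s quarter_period_pos[OF W, of s] quarter_period_pos[OF UM_refl_pot[OF W], of s]
    by (auto simp: T_def T'_def)
  have fixed: "a1 * T + b1 * T' = \<kappa> * (a2 * T + b2 * T')"
    using eq[of "\<omega> * s"] s pos ps[of "sqrt s"] by (simp add: T_def T'_def)
  \<comment> \<open>Equal coefficients and \<open>T = T'\<close> both lead to this expression in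
    \<open>T + T'\<close>.\<close>
  have "2 * (a1 * T + b1 * T') = (real a1 + real b1) * (T + T')"
    using even1 by (auto simp: T_def T'_def algebra_simps)
  moreover have "2 * (a2 * T + b2 * T') = (real a2 + real b2) * (T + T')"
    using even2 by (auto simp: T_def T'_def algebra_simps)
  ultimately have "(real a1 + real b1) * (T + T') = \<kappa> * (real a2 + real b2) * (T + T')"
    using fixed by (metis mult.assoc mult.left_commute)
  then have "real a1 + real b1 = \<kappa> * (real a2 + real b2)" using T by simp
  then have "\<kappa> = (real a1 + real b1) / (real a2 + real b2)" proof -
    have "real a2 + real b2 > 0" using N by linarith
    with \<open>real a1 + real b1 = _\<close> show ?thesis by simp
  qed
  then show ?thesis by (metis Rats_add Rats_divide Rats_of_nat)
qed

theorem theorem1: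
  fixes V1 V2 :: "real \<Rightarrow> real" and P :: "(real \<times> real) set"
  assumes "UM V1" and "UM V2"
    and "deg0 V1 > 2 \<or> deg0 V2 > 2 \<or>
         (deg0 V1 = 2 \<and> deg0 V2 = 2 \<and>
          (\<exists>\<omega> \<tau>::real. \<omega> > 0 \<and> \<tau> \<noteq> 0 \<and> (\<forall>x. V1 x = \<omega> * V2 (\<tau> * x)) \<and>
             sqrt ((deriv ^^ 2) V1 0 / (deriv ^^ 2) V2 0) = \<bar>\<tau>\<bar> * sqrt \<omega> \<and>
             \<bar>\<tau>\<bar> * sqrt \<omega> \<notin> \<rat>))"
    and "RP P"
  shows "resonant_energies P V1 V2 = {}"
proof (rule ccontr)
  assume "resonant_energies P V1 V2 \<noteq> {}"
  then obtain E where Er: "E \<in> resonant_energies P V1 V2" by blast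
  then have E: "E > 0" by (simp add: resonant_energies_def)
  obtain N M N' M' where NM: "N + M > 0" "N' + M' > 0"
    and id: "\<And>\<theta>. 0 < \<theta> \<Longrightarrow> \<theta> < E \<Longrightarrow> period_sum V1 N M \<theta> = period_sum V2 N' M' (E - \<theta>)"
    using resonant_energy_identity[OF assms(1,2,4) Er] by metis
  have cont: "isCont (\<lambda>\<theta>. period_sum V N M (E - \<theta>)) 0" if "UM V" for V N M
    using that E by (intro real_analytic_at_isCont real_analytic_at_reflect_energy real_analytic_at_period_sum) auto
  \<comment> \<open>The side of \<open>V2\<close> is continuous at \<open>\<theta> = 0\<close>
    because its argument there is \<open>E > 0\<close>, so \<open>V1\<close> cannot be flat at its
    minimum.\<close>
  have nd1: "deriv (deriv V1) 0 \<noteq> 0"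
    using flat_minimum_not_periodic[OF assms(1) _ NM(1) E cont[OF assms(2)] id] by blast
  have "period_sum V2 N' M' \<theta> = period_sum V1 N M (E - \<theta>)" if "0 < \<theta>" "\<theta> < E" for \<theta>
    using id[of "E - \<theta>"] that by simp
  then have nd2: "deriv (deriv V2) 0 \<noteq> 0"
    using flat_minimum_not_periodic[OF assms(2) _ NM(2) E cont[OF assms(1)]] by blast
  \<comment> \<open>Nonzero second derivatives exclude a degree above 2, so only the case of similar
    potentials remains.\<close>
  have deg: "deg0 V \<le> 2" if "deriv (deriv V) 0 \<noteq> 0" for V
    unfolding deg0_def by (rule Least_le) (use that in \<open>simp add: numeral_2_eq_2\<close>)
  then obtain \<omega> \<tau> where \<omega>: "\<omega> > 0" "\<tau> \<noteq> 0" "\<And>x. V1 x = \<omega> * V2 (\<tau> * x)" and irr: "\<bar>\<tau>\<bar> * sqrt \<omega> \<notin> \<rat>"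
    using assms(3) deg[OF nd1] deg[OF nd2] by (auto simp: not_less[symmetric])
  define a b where "a = (if \<tau> > 0 then N else M)" and "b = (if \<tau> > 0 then M else N)"
  have \<kappa>: "\<bar>\<tau>\<bar> * sqrt \<omega> > 0" using \<omega> by simp
  have "period_sum V2 a b (\<theta> / \<omega>) = (\<bar>\<tau>\<bar> * sqrt \<omega>) * period_sum V2 N' M' (E - \<theta>)" if "0 < \<theta>" "\<theta> < E" for \<theta>
  proof -
    have "period_sum V2 a b (\<theta> / \<omega>) / (\<bar>\<tau>\<bar> * sqrt \<omega>) = period_sum V1 N M \<theta>"
      using period_sum_scale[OF assms(1,2) \<omega>(1,2) that(1) \<omega>(3), of N M] by (simp add: a_def b_def)
    then show ?thesis using id[OF that] \<kappa> \<omega>(1,2) by (simp add: divide_eq_eq mult.commute)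
  qed
  from self_similar_period_rational[OF assms(2) nd2 \<omega>(1) E \<kappa> NM(2) this] irr show False by simp
qed

end
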